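(* Let $Q$ be the $q$-matrix on $\mathbf Z_+^n$ described in the context (resurrection rates equal to immigration rates), assumed conservative, with $\mathbf Z_+^n$ communicating, $G(1,\dots,1)$ positively regular, $\{B_i(u_1,\dots,u_n);1\le i\le n\}$ nonsingular, $B_{ij}(1,\dots,1)<\infty$ for all $i,j$, and $B_1(0,\dots,0)>0$. Let $P(t)=(p_{\mathbf{ij}}(t);\mathbf i,\mathbf j\in\mathbf Z_+^n)$ be the Feller minimal $Q$-function and $\lambda_Z$ the decay parameter of $\mathbf Z_+^n$. Then for any $\lambda\in[0,\lambda_Z]$: (i) There exists a $\lambda$-invariant measure $(m_{\mathbf i};\mathbf i=(i_1,\dots,i_n)\in\mathbf Z_+^n)$ for $Q$ on $\mathbf Z_+^n$. Moreover, the generating function of this $\lambda$-invariant measure, $M(u_1,\dots,u_n)=\sum_{\mathbf i\in\mathbf Z_+^n}m_{\mathbf i}u_1^{i_1}\cdots u_n^{i_n}$, satisfies the partial differential equation $$\sum_{i=1}^nB_i(u_1,\dots,u_n)\frac{\partial M}{\partial u_i}(u_1,\dots,u_n)+(\lambda+A(u_1,\dots,u_n))M(u_1,\dots,u_n)=0 .$$ (ii) This measure $(m_{\mathbf i};\mathbf i\in\mathbf Z_+^n)$ is also $\lambda$-invariant for $P(t)$ on $\mathbf Z_+^n$. (iii) For $\lambda\le\lambda_Z$, this $\lambda$-invariant measure is convergent (i.e. $\sum_{\mathbf i\in\mathbf Z_+^n}m_{\mathbf i}<\infty$) if and only if $\lambda=\lambda_Z$, $\rho(1,\dots,1)\le0$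 and $$\int_0^1\frac{\lambda+A(u,u_2(u),\dots,u_n(u))}{B_1(u,u_2(u),\dots,u_n(u))}\,du>-\infty .$$
   Context: Fix $n\ge1$; $\mathbf e_k$ is the $k$-th unit vector and $\chi$ the indicator function of $\mathbf Z_+^n$. The (conservative) $q$-matrix is $$q_{\mathbf{ij}}=\sum_{k=1}^n i_k b^{(k)}_{\mathbf j-\mathbf i+\mathbf e_k}\chi(\mathbf j-\mathbf i+\mathbf e_k)+a_{\mathbf j-\mathbf i}\chi(\mathbf j-\mathbf i),\qquad \mathbf i,\mathbf j\in\mathbf Z_+^n,$$ with $a_{\mathbf j}\ge0$ $(\mathbf j\ne\mathbf 0)$, $0<\sum_{\mathbf j\ne\mathbf 0}a_{\mathbf j}=-a_{\mathbf 0}<\infty$, and for each $k$: $b^{(k)}_{\mathbf j}\ge0$ $(\mathbf j\ne\mathbf e_k)$, $0<\sum_{\mathbf j\ne\mathbf e_k}b^{(k)}_{\mathbf j}=-b^{(k)}_{\mathbf e_k}<\infty$. On $[0,1]^n$: $A(u)=\sum_{\mathbf j}a_{\mathbf j}u_1^{j_1}\cdots u_n^{j_n}$, $B_k(u)=\sum_{\mathbf j}b^{(k)}_{\mathbf j}u_1^{j_1}\cdots u_n^{j_n}$, $B_{ij}=\partial B_i/\partial u_j$, $g_{ij}=\delta_{ij}-B_{ij}/b^{(i)}_{\mathbf e_i}$, $G=(g_{ij})$; $\rho(u)$ is the maximal eigenvalue of $(B_{ij}(u))$. $\{B_i\}$ is nonsingular if there is no $n\times n$ matrix $K$ with $(B_1(u),\dots,B_n(u))^{T}=K(u_1,\dots,u_n)^{T}$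 for all $u$. A nonnegative matrix is positively regular if some power has all entries strictly positive. When $\rho(1,\dots,1)\le0$ the smallest nonnegative solution in $[0,1]^n$ of $B_1=\dots=B_n=0$ is $(1,\dots,1)$, and $(u_2(u),\dots,u_n(u))$, $u\in[0,1]$, is the unique solution of $u_k'(u)=B_k(u,u_2,\dots,u_n)/B_1(u,u_2,\dots,u_n)$, $u_k(0)=0$ ($2\le k\le n$), with $u_k(1)=1$; the integral in (iii) is considered only in this case. Decay parameter $\lambda_Z\ge0$: the number with $\frac1t\log p_{\mathbf{ij}}(t)\to-\lambda_Z$ as $t\to\infty$ for all $\mathbf i,\mathbf j\in\mathbf Z_+^n$. A family $(m_{\mathbf i};\mathbf i\in\mathbf Z_+^n)$ of strictly positive numbers is a $\mu$-invariant measure for $Q$ on $\mathbf Z_+^n$ if $\sum_{\mathbf i}m_{\mathbf i}q_{\mathbf{ij}}=-\mu m_{\mathbf j}$ for all $\mathbf j$, and a $\mu$-invariant measure for $P(t)$ on $\mathbf Z_+^n$ if $\sum_{\mathbf i}m_{\mathbf i}p_{\mathbf{ij}}(t)=e^{-\mu t}m_{\mathbf j}$ for all $\mathbf j$ and $t\ge0$. *)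

theory Defs
  imports "HOL-Analysis.Analysis"
begin

text \<open>The coordinates \<open>1, \<dots>, n\<close> are the elements of a finite type \<open>'n\<close>, and
  \<open>\<^bold>Z\<^sub>+\<^sup>n\<close> is the type \<open>nat ^ 'n\<close>, ordered componentwise; \<open>axis k 1\<close> is the
  unit vector \<open>\<^bold>e\<^sub>k\<close>.  Where the first coordinate plays a special role
  it is an explicit argument \<open>k1 :: 'n\<close>.\<close>

subsection \<open>The q-matrix\<close>

definition immigration_rates :: "(nat ^ 'n \<Rightarrow> real) \<Rightarrow> bool" where
  "immigration_rates a \<longleftrightarrow>
     (\<forall>j. j \<noteq> 0 \<longrightarrow> 0 \<le> a j) \<and> 0 < - a 0 \<and> (a has_sum (- a 0)) (UNIV - {0})"

definition branching_rates :: "('n \<Rightarrow> nat ^ 'n \<Rightarrow> real) \<Rightarrow> bool" where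
  "branching_rates b \<longleftrightarrow>
     (\<forall>k. (\<forall>j. j \<noteq> axis k 1 \<longrightarrow> 0 \<le> b k j) \<and> 0 < - b k (axis k 1) \<and>
          (b k has_sum (- b k (axis k 1))) (UNIV - {axis k 1}))"

text \<open>The comparisons are the indicator \<open>\<chi>\<close>; they also guard the truncated subtraction.\<close>

definition qmat ::
  "(nat ^ 'n \<Rightarrow> real) \<Rightarrow> ('n \<Rightarrow> nat ^ 'n \<Rightarrow> real) \<Rightarrow> nat ^ 'n \<Rightarrow> nat ^ 'n \<Rightarrow> real" where
  "qmat a b i j =
     (\<Sum>k\<in>UNIV. real (i $ k) *
        (if i \<le> j + axis k 1 then b k (j + axis k 1 - i) else 0))
     + (if i \<le> j then a (j - i) else 0)"

definition conservative :: "('s \<Rightarrow> 's \<Rightarrow> real) \<Rightarrow> bool" where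
  "conservative Q \<longleftrightarrow> (\<forall>i. (Q i has_sum 0) UNIV)"

subsection \<open>Generating functions and their partial derivatives\<close>

definition unit_cube :: "(real ^ 'n) set" where
  "unit_cube = {u. \<forall>k. 0 \<le> u $ k \<and> u $ k \<le> 1}"

definition monomial :: "real ^ 'n \<Rightarrow> nat ^ 'n \<Rightarrow> real" where
  "monomial u j = (\<Prod>k\<in>UNIV. (u $ k) ^ (j $ k))"

definition genfun :: "(nat ^ 'n \<Rightarrow> real) \<Rightarrow> real ^ 'n \<Rightarrow> real" where
  "genfun c u = (\<Sum>\<^sub>\<infinity>j. c j * monomial u j)"

definition conv_domain :: "(nat ^ 'n \<Rightarrow> real) \<Rightarrow> (real ^ 'n) set" where
  "conv_domain c = {u. (\<lambda>j. c j * monomial u j) summable_on UNIV}"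

text \<open>Generating functions live on the unit cube, so partial derivatives are taken
  within \<open>[0,1]\<close>: one-sided on the faces, and in particular left derivatives at
  \<open>(1, \<dots>, 1)\<close>.\<close>

definition has_partial :: "(real ^ 'n \<Rightarrow> real) \<Rightarrow> real \<Rightarrow> 'n \<Rightarrow> real ^ 'n \<Rightarrow> bool" where
  "has_partial f d k u \<longleftrightarrow>
     ((\<lambda>s. f (\<chi> l. if l = k then s else u $ l)) has_real_derivative d)
       (at (u $ k) within {0..1})"

definition partial :: "(real ^ 'n \<Rightarrow> real) \<Rightarrow> 'n \<Rightarrow> real ^ 'n \<Rightarrow> real" where
  "partial f k u = (THE d. has_partial f d k u)"

definition Bjac :: "('n \<Rightarrow> nat ^ 'n \<Rightarrow> real) \<Rightarrow> real ^ 'n \<Rightarrow> real ^ 'n ^ 'n" where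
  "Bjac b u = (\<chi> i j. partial (genfun (b i)) j u)"

definition Gmat :: "('n \<Rightarrow> nat ^ 'n \<Rightarrow> real) \<Rightarrow> real ^ 'n \<Rightarrow> real ^ 'n ^ 'n" where
  "Gmat b u = (\<chi> i j. (if i = j then 1 else 0) - Bjac b u $ i $ j / b i (axis i 1))"

text \<open>Since the off-diagonal entries of the Jacobian are nonnegative, its maximal (Perron)
  eigenvalue is real, so only real eigenvalues are considered.\<close>

definition max_eigenvalue :: "real ^ 'n ^ 'n \<Rightarrow> real" where
  "max_eigenvalue K = Max {x. \<exists>v. v \<noteq> 0 \<and> K *v v = x *\<^sub>R v}"

definition rho :: "('n \<Rightarrow> nat ^ 'n \<Rightarrow> real) \<Rightarrow> real ^ 'n \<Rightarrow> real" where
  "rho b u = max_eigenvalue (Bjac b u)"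

definition positively_regular :: "real ^ 'n ^ 'n \<Rightarrow> bool" where
  "positively_regular K \<longleftrightarrow>
     (\<forall>i j. 0 \<le> K $ i $ j) \<and>
     (\<exists>N\<ge>1. \<forall>i j. 0 < (((**) K ^^ N) (mat 1)) $ i $ j)"

definition nonsingular :: "('n \<Rightarrow> nat ^ 'n \<Rightarrow> real) \<Rightarrow> bool" where
  "nonsingular b \<longleftrightarrow>
     \<not> (\<exists>K :: real ^ 'n ^ 'n. \<forall>u\<in>unit_cube. (\<chi> k. genfun (b k) u) = K *v u)"

definition is_least_zero :: "('n \<Rightarrow> nat ^ 'n \<Rightarrow> real) \<Rightarrow> real ^ 'n \<Rightarrow> bool" where
  "is_least_zero b q \<longleftrightarrow>
     q \<in> unit_cube \<and> (\<forall>k. genfun (b k) q = 0) \<and>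
     (\<forall>r\<in>unit_cube. (\<forall>k. genfun (b k) r = 0) \<longrightarrow> q \<le> r)"

subsection \<open>Q-functions, decay parameter, invariant measures\<close>

definition transition_function :: "(real \<Rightarrow> 's \<Rightarrow> 's \<Rightarrow> real) \<Rightarrow> bool" where
  "transition_function P \<longleftrightarrow>
     (\<forall>t\<ge>0. \<forall>i j. 0 \<le> P t i j) \<and>
     (\<forall>t\<ge>0. \<forall>i. P t i summable_on UNIV \<and> (\<Sum>\<^sub>\<infinity>j. P t i j) \<le> 1) \<and>
     (\<forall>i j. P 0 i j = (if i = j then 1 else 0)) \<and>
     (\<forall>s\<ge>0. \<forall>t\<ge>0. \<forall>i j. ((\<lambda>k. P s i k * P t k j) has_sum P (s + t) i j) UNIV) \<and>
     (\<forall>i. ((\<lambda>t. P t i i) \<longlongrightarrow> 1) (at_right 0))"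

definition Q_function :: "('s \<Rightarrow> 's \<Rightarrow> real) \<Rightarrow> (real \<Rightarrow> 's \<Rightarrow> 's \<Rightarrow> real) \<Rightarrow> bool" where
  "Q_function Q P \<longleftrightarrow>
     transition_function P \<and>
     (\<forall>i j. ((\<lambda>t. P t i j) has_real_derivative Q i j) (at 0 within {0..}))"

definition Feller_minimal :: "('s \<Rightarrow> 's \<Rightarrow> real) \<Rightarrow> (real \<Rightarrow> 's \<Rightarrow> 's \<Rightarrow> real) \<Rightarrow> bool" where
  "Feller_minimal Q P \<longleftrightarrow>
     Q_function Q P \<and>
     (\<forall>P'. Q_function Q P' \<longrightarrow> (\<forall>t\<ge>0. \<forall>i j. P t i j \<le> P' t i j))"

definition communicating :: "(real \<Rightarrow> 's \<Rightarrow> 's \<Rightarrow> real) \<Rightarrow> bool" where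
  "communicating P \<longleftrightarrow> (\<forall>i j. \<exists>t\<ge>0. 0 < P t i j)"

definition is_decay_parameter :: "(real \<Rightarrow> 's \<Rightarrow> 's \<Rightarrow> real) \<Rightarrow> real \<Rightarrow> bool" where
  "is_decay_parameter P lamZ \<longleftrightarrow>
     0 \<le> lamZ \<and> (\<forall>i j. ((\<lambda>t. ln (P t i j) / t) \<longlongrightarrow> - lamZ) at_top)"

definition invariant_for_Q :: "real \<Rightarrow> ('s \<Rightarrow> 's \<Rightarrow> real) \<Rightarrow> ('s \<Rightarrow> real) \<Rightarrow> bool" where
  "invariant_for_Q \<mu> Q m \<longleftrightarrow>
     (\<forall>i. 0 < m i) \<and> (\<forall>j. ((\<lambda>i. m i * Q i j) has_sum (- \<mu> * m j)) UNIV)"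

definition invariant_for_P ::
  "real \<Rightarrow> (real \<Rightarrow> 's \<Rightarrow> 's \<Rightarrow> real) \<Rightarrow> ('s \<Rightarrow> real) \<Rightarrow> bool" where
  "invariant_for_P \<mu> P m \<longleftrightarrow>
     (\<forall>i. 0 < m i) \<and>
     (\<forall>t\<ge>0. \<forall>j. ((\<lambda>i. m i * P t i j) has_sum (exp (- \<mu> * t) * m j)) UNIV)"

subsection \<open>The partial differential equation and the integral condition\<close>

text \<open>The equation for the generating function of \<open>m\<close> at a point \<open>u\<close>, including the
  existence of the partial derivatives in it.\<close>

definition satisfies_pde_at ::
  "(nat ^ 'n \<Rightarrow> real) \<Rightarrow> ('n \<Rightarrow> nat ^ 'n \<Rightarrow> real) \<Rightarrow> real \<Rightarrow> (nat ^ 'n \<Rightarrow> real) \<Rightarrow>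
   real ^ 'n \<Rightarrow> bool" where
  "satisfies_pde_at a b lam m u \<longleftrightarrow>
     (\<forall>k. \<exists>d. has_partial (genfun m) d k u) \<and>
     (\<Sum>k\<in>UNIV. genfun (b k) u * partial (genfun m) k u)
       + (lam + genfun a u) * genfun m u = 0"

text \<open>The curve \<open>s \<mapsto> (s, u\<^sub>2(s), \<dots>, u\<^sub>n(s))\<close>.  At \<open>s = 1\<close> the right-hand side of the
  differential equation is \<open>0/0\<close>; there only continuity is required.\<close>

definition is_curve :: "('n \<Rightarrow> nat ^ 'n \<Rightarrow> real) \<Rightarrow> 'n \<Rightarrow> (real \<Rightarrow> real ^ 'n) \<Rightarrow> bool" where
  "is_curve b k1 U \<longleftrightarrow>
     continuous_on {0..1} U \<and>
     (\<forall>s\<in>{0..1}. U s \<in> unit_cube \<and> U s $ k1 = s) \<and>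
     U 0 = 0 \<and> U 1 = 1 \<and>
     (\<forall>s\<in>{0..<1}. genfun (b k1) (U s) \<noteq> 0 \<and>
        (\<forall>k. k \<noteq> k1 \<longrightarrow>
           ((\<lambda>r. U r $ k) has_real_derivative genfun (b k) (U s) / genfun (b k1) (U s))
             (at s within {0..1})))"

text \<open>Improper integral over \<open>[0,1)\<close>, with values in the extended reals.\<close>

definition has_improper_integral :: "(real \<Rightarrow> real) \<Rightarrow> ereal \<Rightarrow> bool" where
  "has_improper_integral f L \<longleftrightarrow>
     (\<forall>x\<in>{0..<1}. f integrable_on {0..x}) \<and>
     ((\<lambda>x. ereal (integral {0..x} f)) \<longlongrightarrow> L) (at_left 1)"

end

theory Submission
  imports Defs "HOL-Library.Diagonal_Subsequence"
begin

text \<open>Let \<open>flow t u\<close> solve \<open>F' = B(F)\<close>, \<open>F(0) = u\<close> in the unit cube.  Since the first moments of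
  the offspring laws are finite, \<open>Q\<close> is regular, and any transition function \<open>P\<close> with this q-matrix has
  \<open>\<Sum>\<^sub>j p\<^sub>i\<^sub>j(t) u\<^sup>j = exp (\<integral>\<^sub>0\<^sup>t A(flow s u) ds) (flow t u)\<^sup>i\<close>: both sides solve the backward equation.
  In particular \<open>p\<^sub>i\<^sub>0(t) = p\<^sub>0\<^sub>0(t) (flow t 0)\<^sup>i\<close>, where \<open>flow t 0\<close> increases to the least zero \<open>q\<close>
  of \<open>B\<close>; communication makes it increase strictly in every coordinate over long times.
  Hence \<open>p\<^sub>i\<^sub>j(s)\<close> is exponentially smaller than \<open>p\<^sub>i\<^sub>0(\<tau>)\<close> for large \<open>i\<close> and \<open>\<tau>\<close>, and normalised
  \<open>\<lambda>\<close>-resolvents \<open>G(i, \<cdot>) / G(i, 0)\<close> converge, along a subsequence of \<open>i \<rightarrow> \<infinity>\<close>, to a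
  \<open>\<lambda>\<close>-invariant measure for \<open>P\<close>.  The equations for \<open>Q\<close> and for the generating function follow
  because each column of \<open>Q\<close> is finite.

  As \<open>P\<close> is honest, a convergent \<open>m\<close> forces \<open>\<lambda> = 0\<close> and keeps \<open>p\<^sub>0\<^sub>0(t)\<close> away from \<open>0\<close>, so that
  \<open>\<lambda>\<^sub>Z = 0\<close>, \<open>A(q) = 0\<close> and \<open>q = 1\<close>.  Conversely the curve is \<open>flow t 0\<close> parametrised by its first
  coordinate, and along it the generating function of \<open>m\<close> is \<open>m\<^sub>0 exp (- \<integral> (\<lambda> + A) / B\<^sub>1)\<close>.\<close>

section \<open>Infinite sums\<close>

text \<open>The state space is infinite and the jump rates grow linearly in the state, so neither
  uniqueness for the backward equation nor the exchange of limit and sum in the resolvents is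
  automatic. Finite means give a Lipschitz bound for \<open>B\<close> up to the corner
  \<open>1\<close>. Tested on \<open>1 - x ^ size1 i\<close> with \<open>x\<close> near 1 it limits
  the growth of the chain, and a maximum principle then needs care only on finitely many states. For
  the invariant measure the danger is loss of mass at infinity. Two times exclude it: with
  \<open>ext t = flow t 0\<close>, probabilities of going from \<open>k\<close> to \<open>j\<close>
  are at most a multiple of \<open>monomial (ext \<sigma>) k\<close>, normalised resolvents at most
  a multiple of \<open>1 / monomial (ext \<tau>) k\<close>, and strict increase of
  \<open>ext\<close> makes the product summable. Sums over a mesh \<open>1 / (N + 1)\<close> replace
  integrals, and the rate \<open>lam - 1 / (N + 1)\<close> stays below \<open>lamZ\<close>, so
  \<open>lam = lamZ\<close> is no special case. The neglected terms grow linearly in number with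
  \<open>N\<close>, but each is geometrically small relative to the mass at
  \<open>0\<close>.\<close>

lemma has_sum_swap_nonneg:
  fixes f :: "'a \<Rightarrow> 'b \<Rightarrow> real"
  assumes "\<And>x y. 0 \<le> f x y"
    and "\<And>x. (f x has_sum g x) UNIV" and "(g has_sum s) UNIV"
  shows "(\<lambda>x. f x y) summable_on UNIV"
    and "((\<lambda>y. \<Sum>\<^sub>\<infinity>x. f x y) has_sum s) UNIV"
proof -
  have sm: "(\<lambda>(x, y). f x y) summable_on (UNIV \<times> UNIV)"
    by (rule summable_on_SigmaI[where g = g]) (use assms in \<open>auto simp: summable_on_def\<close>)
  have hs: "((\<lambda>(x, y). f x y) has_sum s) (UNIV \<times> UNIV)"
    by (rule has_sum_SigmaI[where g = g]) (use assms sm in auto)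
  then have hs': "((\<lambda>(y, x). f x y) has_sum s) (UNIV \<times> UNIV)"
    by (subst (asm) has_sum_swap) simp
  then have sm': "(\<lambda>(y, x). f x y) summable_on (UNIV \<times> UNIV)"
    by (auto simp: summable_on_def)
  then show *: "(\<lambda>x. f x y) summable_on UNIV" for y
    using summable_on_SigmaD1[where A = UNIV and B = "\<lambda>_. UNIV" and f = "\<lambda>y x. f x y"]
    by auto
  show "((\<lambda>y. \<Sum>\<^sub>\<infinity>x. f x y) has_sum s) UNIV"
    by (rule has_sum_SigmaD[OF hs']) (use * in auto)
qed

lemma summable_on_le:
  fixes f g :: "'a \<Rightarrow> real"
  assumes "g summable_on A" "\<And>x. x \<in> A \<Longrightarrow> \<bar>f x\<bar> \<le> g x"
  shows "f summable_on A"
proof -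
  have "(\<lambda>x. norm (f x)) summable_on A"
    by (rule Infinite_Sum.abs_summable_on_comparison_test'[OF assms(1)]) (use assms(2) in auto)
  then show ?thesis by (rule Infinite_Sum.abs_summable_summable)
qed

text \<open>Dominated convergence for unordered sums. By the Weierstrass test the finite partial
  sums converge uniformly over all indices \<open>n\<close> at which the bound by \<open>d\<close>
  holds, and this permits the interchange of the two limits.\<close>

lemma tendsto_infsum_dominated:
  fixes f :: "'b \<Rightarrow> 'a \<Rightarrow> real"
  assumes lim: "\<And>k. ((\<lambda>n. f n k) \<longlongrightarrow> g k) F"
    and dom: "eventually (\<lambda>n. \<forall>k. \<bar>f n k\<bar> \<le> d k) F"
    and d: "d summable_on UNIV"
    and F: "F \<noteq> bot"
  shows "g summable_on UNIV"
    and "((\<lambda>n. \<Sum>\<^sub>\<infinity>k. f n k) \<longlongrightarrow> (\<Sum>\<^sub>\<infinity>k. g k)) F"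
proof -
  have gd: "\<bar>g k\<bar> \<le> d k" for k
  proof (rule tendsto_upperbound[OF _ _ F])
    show "((\<lambda>n. \<bar>f n k\<bar>) \<longlongrightarrow> \<bar>g k\<bar>) F" by (intro tendsto_intros lim)
    show "eventually (\<lambda>n. \<bar>f n k\<bar> \<le> d k) F" using dom by (rule eventually_mono) auto
  qed
  show gs: "g summable_on UNIV" by (rule summable_on_le[OF d]) (rule gd)
  define S where "S = {n. \<forall>k. \<bar>f n k\<bar> \<le> d k}"
  have "uniform_limit S (\<lambda>X n. \<Sum>k\<in>X. f n k) (\<lambda>n. \<Sum>\<^sub>\<infinity>k. f n k) (finite_subsets_at_top UNIV)"
    by (rule Weierstrass_m_test_general'[where M = d])
       (use d in \<open>auto simp: S_def intro!: has_sum_infsum summable_on_le[OF d]\<close>)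
  then show "((\<lambda>n. \<Sum>\<^sub>\<infinity>k. f n k) \<longlongrightarrow> (\<Sum>\<^sub>\<infinity>k. g k)) F"
  proof (rule swap_uniform_limit'[rotated 2])
    show "(sum g \<longlongrightarrow> (\<Sum>\<^sub>\<infinity>k. g k)) (finite_subsets_at_top UNIV)"
      using gs by (simp add: has_sum_def[symmetric])
    show "eventually (\<lambda>X. ((\<lambda>n. \<Sum>k\<in>X. f n k) \<longlongrightarrow> sum g X) F) (finite_subsets_at_top UNIV)"
      by (intro always_eventually allI tendsto_sum lim)
  qed (use dom in \<open>simp_all add: S_def\<close>)
qed

section \<open>Monomials and generating functions\<close>

text \<open>The total number of particles, equal to the degree of the monomial with exponent
  \<open>i\<close>. Its sublevel sets are finite, so it exhausts the state space.\<close>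

definition size1 :: "nat ^ 'n \<Rightarrow> nat" where
  "size1 i = (\<Sum>k\<in>UNIV. i $ k)"

lemma size1_0 [simp]: "size1 0 = 0" by (simp add: size1_def)
lemma size1_add [simp]: "size1 (i + j) = size1 i + size1 j"
  by (simp add: size1_def sum.distrib)
lemma size1_axis [simp]: "size1 (axis k m) = m"
  by (simp add: size1_def axis_def)
lemma size1_mono: "i \<le> j \<Longrightarrow> size1 i \<le> size1 j"
  unfolding size1_def less_eq_vec_def by (intro sum_mono) auto
lemma component_le_size1: "i $ k \<le> size1 i"
  unfolding size1_def by (rule member_le_sum) auto

lemma finite_size1_le: "finite {i :: nat ^ 'n. size1 i \<le> N}"
proof (rule finite_subset)
  show "{i :: nat ^ 'n. size1 i \<le> N} \<subseteq> vec_lambda ` (UNIV \<rightarrow>\<^sub>E {..N})"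
  proof
    fix i :: "nat ^ 'n" assume "i \<in> {i. size1 i \<le> N}"
    then have "vec_nth i \<in> UNIV \<rightarrow>\<^sub>E {..N}"
      using component_le_size1[of i] by (auto intro: order_trans)
    then show "i \<in> vec_lambda ` (UNIV \<rightarrow>\<^sub>E {..N})"
      by (metis image_eqI vec_nth_inverse)
  qed
  show "finite (vec_lambda ` (UNIV \<rightarrow>\<^sub>E {..N}) :: (nat ^ 'n) set)"
    by (intro finite_imageI finite_PiE) auto
qed

lemma monomial_0 [simp]: "monomial u 0 = 1" by (simp add: monomial_def)
lemma monomial_1 [simp]: "monomial 1 j = 1" by (simp add: monomial_def)
lemma monomial_add: "monomial u (i + j) = monomial u i * monomial u j"
  by (simp add: monomial_def power_add prod.distrib)
lemma monomial_axis [simp]: "monomial u (axis k m) = u $ k ^ m"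
proof -
  have "monomial u (axis k m) = (\<Prod>l\<in>UNIV. if l = k then u $ k ^ m else 1)"
    unfolding monomial_def axis_def by (intro prod.cong) auto
  then show ?thesis by simp
qed
lemma monomial_const: "monomial (\<chi> k. x) j = x ^ size1 j"
  by (simp add: monomial_def size1_def power_sum)
lemma monomial_nonneg: "(\<And>k. 0 \<le> u $ k) \<Longrightarrow> 0 \<le> monomial u j"
  by (simp add: monomial_def prod_nonneg)
lemma monomial_pos: "(\<And>k. 0 < u $ k) \<Longrightarrow> 0 < monomial u j"
  by (simp add: monomial_def prod_pos)
lemma monomial_mono: "(\<And>k. 0 \<le> u $ k) \<Longrightarrow> (\<And>k. u $ k \<le> v $ k) \<Longrightarrow> monomial u j \<le> monomial v j"
  unfolding monomial_def by (intro prod_mono conjI power_mono zero_le_power) auto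
lemma monomial_zero: "monomial 0 j = (if j = 0 then 1 else 0)"
proof (cases "j = 0")
  case False
  then obtain k where "j $ k \<noteq> 0" by (metis vec_eq_iff zero_index)
  then show ?thesis using False by (auto simp: monomial_def)
qed simp

lemma tendsto_monomial:
  assumes "(f \<longlongrightarrow> u) F"
  shows "((\<lambda>x. monomial (f x) j) \<longlongrightarrow> monomial u j) F"
  unfolding monomial_def by (intro tendsto_intros assms)

lemma unit_cubeD: "u \<in> unit_cube \<Longrightarrow> 0 \<le> u $ k" "u \<in> unit_cube \<Longrightarrow> u $ k \<le> 1"
  by (auto simp: unit_cube_def)

lemma one_in_unit_cube [simp]: "1 \<in> unit_cube" and zero_in_unit_cube [simp]: "0 \<in> unit_cube"
  by (auto simp: unit_cube_def)

lemma monomial_cube: "u \<in> unit_cube \<Longrightarrow> 0 \<le> monomial u j"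
  "u \<in> unit_cube \<Longrightarrow> monomial u j \<le> 1"
  using monomial_nonneg[of u j] monomial_mono[of u 1 j]
  by (auto simp: unit_cubeD)

lemma has_sum_genfun:
  assumes "c summable_on UNIV" "u \<in> unit_cube"
  shows "((\<lambda>j. c j * monomial u j) has_sum genfun c u) UNIV"
proof -
  have "(\<lambda>j. \<bar>c j\<bar>) summable_on UNIV"
    using assms(1) summable_on_iff_abs_summable_on_real by auto
  then have "(\<lambda>j. c j * monomial u j) summable_on UNIV"
    by (rule summable_on_le) (use assms(2) in \<open>auto simp: abs_mult monomial_cube intro!: mult_left_le\<close>)
  then show ?thesis unfolding genfun_def by simp
qed

lemma tendsto_genfun:
  assumes "c summable_on UNIV" "(f \<longlongrightarrow> u) F" "\<And>x. f x \<in> unit_cube" "F \<noteq> bot"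
  shows "((\<lambda>x. genfun c (f x)) \<longlongrightarrow> genfun c u) F"
  unfolding genfun_def
proof (rule tendsto_infsum_dominated(2)[where d = "\<lambda>j. \<bar>c j\<bar>"])
  show "(\<lambda>j. \<bar>c j\<bar>) summable_on UNIV"
    using assms(1) summable_on_iff_abs_summable_on_real by auto
  show "eventually (\<lambda>x. \<forall>j. \<bar>c j * monomial (f x) j\<bar> \<le> \<bar>c j\<bar>) F"
    using assms(3) by (intro always_eventually) (auto simp: abs_mult monomial_cube intro!: mult_left_le)
  show "((\<lambda>x. c j * monomial (f x) j) \<longlongrightarrow> c j * monomial u j) F" for j
    by (intro tendsto_intros tendsto_monomial assms)
qed (fact assms)

lemma continuous_on_genfun:
  assumes "c summable_on UNIV" shows "continuous_on unit_cube (genfun c)"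
  unfolding continuous_on_sequentially
  using tendsto_genfun[OF assms, where F = sequentially] by (auto simp: o_def)

lemma genfun_mono:
  assumes "c summable_on UNIV" "\<And>j. 0 \<le> c j" "u \<in> unit_cube" "v \<in> unit_cube" "u \<le> v"
  shows "genfun c u \<le> genfun c v"
  by (rule has_sum_mono[OF has_sum_genfun[OF assms(1,3)] has_sum_genfun[OF assms(1,4)]])
     (use assms in \<open>auto intro!: mult_left_mono monomial_mono simp: unit_cubeD less_eq_vec_def\<close>)

lemma genfun_0: "genfun c 0 = c 0"
proof -
  have "((\<lambda>j. c j * monomial 0 j) has_sum c 0) UNIV"
    using has_sum_finite_neutralI[of "{0}" UNIV "\<lambda>j. c j * monomial 0 j"]
    by (auto simp: monomial_zero)
  then show ?thesis unfolding genfun_def by (rule infsumI)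
qed

text \<open>The hypothesis on \<open>r\<close> covers both an interior point of the domain of convergence, with
  room above \<open>u $ k\<close>, and the end point \<open>u $ k = r = 1\<close>.\<close>

lemma has_partial_genfun:
  fixes c :: "nat ^ 'n \<Rightarrow> real"
  defines "rest \<equiv> \<lambda>u k i. \<Prod>l\<in>UNIV - {k}. u $ l ^ i $ l"
  assumes u: "u \<in> unit_cube" and r: "u $ k < r \<or> r = 1" "0 \<le> r"
    and sm0: "\<And>s. s \<in> {0..1} \<Longrightarrow> s \<le> r \<Longrightarrow> (\<lambda>i. c i * monomial (\<chi> l. if l = k then s else u $ l) i) summable_on UNIV"
    and sm: "(\<lambda>i. \<bar>c i\<bar> * (real (i $ k) * r ^ (i $ k - 1) * rest u k i)) summable_on UNIV"
  shows "has_partial (genfun c) (\<Sum>\<^sub>\<infinity>i. c i * (real (i $ k) * u $ k ^ (i $ k - 1) * rest u k i)) k u"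
    and "(\<lambda>i. c i * (real (i $ k) * u $ k ^ (i $ k - 1) * rest u k i)) summable_on UNIV"
proof -
  let ?x = "u $ k"
  let ?U = "\<lambda>s. \<chi> l. if l = k then s else u $ l"
  let ?F = "at ?x within {0..1}"
  have x01: "0 \<le> ?x" "?x \<le> 1" using u by (auto simp: unit_cubeD)
  have xr: "?x \<le> r" using r x01 by auto
  have rest0: "0 \<le> rest u k i" for i unfolding rest_def using u by (intro prod_nonneg) (auto simp: unit_cubeD)
  have mon: "monomial (?U s) i = s ^ (i $ k) * rest u k i" for s i
  proof -
    have "monomial (?U s) i = (?U s $ k) ^ (i $ k) * (\<Prod>l\<in>UNIV - {k}. (?U s $ l) ^ (i $ l))"
      unfolding monomial_def by (rule prod.remove) auto
    also have "(\<Prod>l\<in>UNIV - {k}. (?U s $ l) ^ (i $ l)) = rest u k i"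
      unfolding rest_def by (intro prod.cong) auto
    finally show ?thesis by simp
  qed
  have ntriv: "?F \<noteq> bot" using x01
    by (auto simp: trivial_limit_within islimpt_Icc)
  have evF: "eventually (\<lambda>s. s \<in> {0..1} \<and> s \<noteq> ?x \<and> s \<le> r) ?F"
  proof -
    have "eventually (\<lambda>s. s \<le> r \<or> r = 1) ?F"
    proof (cases "?x < r")
      case True
      then have "eventually (\<lambda>s. s < r) ?F"
        by (intro order_tendstoD(2)[OF tendsto_ident_at])
      then show ?thesis by (rule eventually_mono) auto
    qed (use r in auto)
    moreover have "eventually (\<lambda>s. s \<in> {0..1} \<and> s \<noteq> ?x) ?F"
      unfolding eventually_at by (auto intro: exI[of _ 1])
    ultimately show ?thesis by eventually_elim auto
  qed
  let ?q = "\<lambda>s i. c i * ((s ^ (i $ k) - ?x ^ (i $ k)) / (s - ?x) * rest u k i)"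
  \<comment> \<open>The quotient is a sum of \<open>m\<close> monomials of degree
    \<open>m - 1\<close> in \<open>s\<close> and \<open>?x\<close>, both at most \<open>r\<close>.
    Hence the derivative series at \<open>r\<close> dominates all difference quotients near
    \<open>?x\<close>.\<close>
  have bnd: "\<bar>(s ^ m - ?x ^ m) / (s - ?x)\<bar> \<le> real m * r ^ (m - 1)"
    if "s \<in> {0..1}" "s \<noteq> ?x" "s \<le> r" for s m
  proof (cases m)
    case (Suc m')
    have "(s ^ m - ?x ^ m) / (s - ?x) = (\<Sum>p<m. ?x ^ (m - Suc p) * s ^ p)"
      using that power_diff_sumr2[of s m ?x] by simp
    also have "\<bar>\<dots>\<bar> \<le> (\<Sum>p<m. \<bar>?x ^ (m - Suc p) * s ^ p\<bar>)" by (rule sum_abs)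
    also have "\<dots> \<le> (\<Sum>p<m. r ^ (m - 1))"
    proof (rule sum_mono)
      fix p assume p: "p \<in> {..<m}"
      have "\<bar>?x ^ (m - Suc p) * s ^ p\<bar> = ?x ^ (m - Suc p) * s ^ p" using x01 that by simp
      also have "\<dots> \<le> r ^ (m - Suc p) * r ^ p"
        using x01 that xr by (intro mult_mono power_mono) auto
      also have "\<dots> = r ^ (m - 1)" using p by (simp add: power_add[symmetric])
      finally show "\<bar>?x ^ (m - Suc p) * s ^ p\<bar> \<le> r ^ (m - 1)" .
    qed
    finally show ?thesis by simp
  qed simp
  have lim: "((\<lambda>s. ?q s i) \<longlongrightarrow> c i * (real (i $ k) * ?x ^ (i $ k - 1) * rest u k i)) ?F" for i
  proof -
    have "((\<lambda>s. s ^ (i $ k)) has_real_derivative real (i $ k) * ?x ^ (i $ k - 1)) ?F"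
      using DERIV_power[OF DERIV_ident, of "i $ k" ?x "{0..1}"] by simp
    then have "((\<lambda>s. (s ^ (i $ k) - ?x ^ (i $ k)) / (s - ?x)) \<longlongrightarrow> real (i $ k) * ?x ^ (i $ k - 1)) ?F"
      by (simp add: has_field_derivative_iff)
    then show ?thesis by (intro tendsto_mult tendsto_const)
  qed
  have dom: "eventually (\<lambda>s. \<forall>i. \<bar>?q s i\<bar> \<le> \<bar>c i\<bar> * (real (i $ k) * r ^ (i $ k - 1) * rest u k i)) ?F"
    using evF
  proof eventually_elim
    case (elim s)
    show ?case
    proof
      fix i
      have "\<bar>?q s i\<bar> = \<bar>c i\<bar> * (\<bar>(s ^ (i $ k) - ?x ^ (i $ k)) / (s - ?x)\<bar> * rest u k i)"
        using rest0 by (simp add: abs_mult)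
      also have "\<dots> \<le> \<bar>c i\<bar> * ((real (i $ k) * r ^ (i $ k - 1)) * rest u k i)"
        using elim rest0 bnd by (intro mult_left_mono mult_right_mono) auto
      finally show "\<bar>?q s i\<bar> \<le> \<bar>c i\<bar> * (real (i $ k) * r ^ (i $ k - 1) * rest u k i)" .
    qed
  qed
  note dc = tendsto_infsum_dominated[OF lim dom sm ntriv]
  show "(\<lambda>i. c i * (real (i $ k) * u $ k ^ (i $ k - 1) * rest u k i)) summable_on UNIV" by (rule dc(1))
  have "((\<lambda>s. (genfun c (?U s) - genfun c (?U ?x)) / (s - ?x)) \<longlongrightarrow>
        (\<Sum>\<^sub>\<infinity>i. c i * (real (i $ k) * u $ k ^ (i $ k - 1) * rest u k i))) ?F"
  proof (rule Lim_transform_eventually[OF dc(2)])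
    show "eventually (\<lambda>s. (\<Sum>\<^sub>\<infinity>i. ?q s i) = (genfun c (?U s) - genfun c (?U ?x)) / (s - ?x)) ?F"
      using evF
    proof eventually_elim
      case (elim s)
      have 1: "((\<lambda>i. c i * monomial (?U s) i) has_sum genfun c (?U s)) UNIV"
        unfolding genfun_def using elim by (intro has_sum_infsum sm0) auto
      have 2: "((\<lambda>i. c i * monomial (?U ?x) i) has_sum genfun c (?U ?x)) UNIV"
        unfolding genfun_def using x01 xr by (intro has_sum_infsum sm0) auto
      have "((\<lambda>i. (c i * monomial (?U s) i + (-1) * (c i * monomial (?U ?x) i)) * (1 / (s - ?x)))
        has_sum (genfun c (?U s) + (-1) * genfun c (?U ?x)) * (1 / (s - ?x))) UNIV"
        by (rule has_sum_cmult_left[OF has_sum_add[OF 1 has_sum_cmult_right[OF 2]]])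
      moreover have "(\<lambda>i. (c i * monomial (?U s) i + (-1) * (c i * monomial (?U ?x) i)) * (1 / (s - ?x))) = ?q s"
        unfolding mon by (intro ext) (simp add: diff_divide_distrib left_diff_distrib right_diff_distrib)
      ultimately show ?case by (intro infsumI) simp
    qed
  qed
  then show "has_partial (genfun c) (\<Sum>\<^sub>\<infinity>i. c i * (real (i $ k) * u $ k ^ (i $ k - 1) * rest u k i)) k u"
    unfolding has_partial_def has_field_derivative_iff .
qed

lemma has_partial_unique:
  assumes "u \<in> unit_cube" "has_partial f d k u" "has_partial f d' k u" shows "d = d'"
proof -
  have "at (u $ k) within {0..1} \<noteq> bot"
    using unit_cubeD[OF assms(1), of k] by (auto simp: trivial_limit_within islimpt_Icc)
  then show ?thesis
    using tendsto_unique assms(2,3) unfolding has_partial_def has_field_derivative_iff by blast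
qed

lemma partial_eqI: "u \<in> unit_cube \<Longrightarrow> has_partial f d k u \<Longrightarrow> partial f k u = d"
  unfolding partial_def by (rule the_equality) (auto intro: has_partial_unique)

section \<open>Calculus on the half line\<close>

lemma at_within_atLeast_eq:
  fixes t :: real assumes "0 \<le> t" "t < T" shows "at t within {0..} = at t within {0..T}"
  by (rule at_within_nhd[where S = "{..<T}"]) (use assms in auto)

lemma continuous_on_atLeastI:
  fixes f :: "real \<Rightarrow> 'a::topological_space"
  assumes "\<And>T. 0 \<le> T \<Longrightarrow> continuous_on {0..T} f" shows "continuous_on {0..} f"
  unfolding continuous_on_eq_continuous_within
proof
  fix t :: real assume t: "t \<in> {0..}"
  have "continuous (at t within {0..t + 1}) f"
    using assms[of "t + 1"] t by (auto simp: continuous_on_eq_continuous_within)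
  then show "continuous (at t within {0..}) f"
    using at_within_atLeast_eq[of t "t + 1"] t by simp
qed

lemma integral_has_real_derivative_atLeast:
  fixes g :: "real \<Rightarrow> real"
  assumes "continuous_on {0..} g" "0 \<le> t"
  shows "((\<lambda>t. integral {0..t} g) has_real_derivative g t) (at t within {0..})"
proof -
  have "continuous_on {0..t + 1} g" by (rule continuous_on_subset[OF assms(1)]) auto
  then have "((\<lambda>t. integral {0..t} g) has_real_derivative g t) (at t within {0..t + 1})"
    by (rule integral_has_real_derivative) (use assms in auto)
  then show ?thesis using at_within_atLeast_eq[of t "t + 1"] assms by simp
qed

lemma deriv_nonpos_imp_le:
  fixes f :: "real \<Rightarrow> real"
  assumes "x \<le> y" "{x..y} \<subseteq> S"
    and "\<And>s. s \<in> {x..y} \<Longrightarrow> (f has_real_derivative f' s) (at s within S)"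
    and "\<And>s. s \<in> {x..y} \<Longrightarrow> f' s \<le> 0"
  shows "f y \<le> f x"
proof (cases "x = y")
  case False
  then have "x < y" using assms(1) by simp
  moreover have "(f has_derivative (*) (f' s)) (at s within {x..y})" if "x \<le> s" "s \<le> y" for s
    using DERIV_subset[OF assms(3) assms(2)] that by (simp add: has_field_derivative_def)
  ultimately obtain z where "z \<in> {x<..<y}" "f y - f x = (y - x) * f' z"
    using mvt_simple[of x y f "\<lambda>s. (*) (f' s)"] by (auto simp: mult.commute)
  moreover from this have "(y - x) * f' z \<le> 0"
    using assms(4)[of z] by (intro mult_nonneg_nonpos) auto
  ultimately show ?thesis by simp
qed simp

lemma has_sum_diff_real:
  fixes f g :: "'a \<Rightarrow> real"
  assumes "(f has_sum x) A" "(g has_sum y) A" shows "((\<lambda>i. f i - g i) has_sum (x - y)) A"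
  using has_sum_add[OF assms(1) has_sum_cmult_right[OF assms(2), of "-1"]] by simp

lemma has_sum_single: "((\<lambda>j. if j = i then x else 0) has_sum (x :: real)) UNIV"
  using has_sum_finite_neutralI[of "{i}" UNIV "\<lambda>j. if j = i then x else 0"] by simp

lemma has_sum_finite_sum:
  fixes f :: "'i \<Rightarrow> 'a \<Rightarrow> real"
  assumes "finite I" "\<And>i. i \<in> I \<Longrightarrow> (f i has_sum s i) A"
  shows "((\<lambda>x. \<Sum>i\<in>I. f i x) has_sum (\<Sum>i\<in>I. s i)) A"
  using assms by (induction I rule: finite_induct) (auto intro!: has_sum_add)

lemma continuous_on_vecI:
  fixes f :: "'a::topological_space \<Rightarrow> real ^ 'n"
  assumes "\<And>k. continuous_on S (\<lambda>t. f t $ k)" shows "continuous_on S f"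
  using continuous_on_vec_lambda[of S "\<lambda>k t. f t $ k"] assms by (simp add: vec_nth_inverse)

section \<open>The branching mechanism and its flow\<close>

lemma monomial_Lipschitz:
  assumes u: "u \<in> unit_cube" and v: "v \<in> unit_cube"
  shows "\<bar>monomial u j - monomial v j\<bar> \<le> (\<Sum>l\<in>UNIV. real (j $ l) * \<bar>u $ l - v $ l\<bar>)"
proof -
  have "norm (monomial u j - monomial v j) \<le> (\<Sum>l\<in>UNIV. norm (u $ l ^ j $ l - v $ l ^ j $ l))"
    unfolding monomial_def by (rule norm_prod_diff)
      (use u v in \<open>auto simp: unit_cubeD power_le_one\<close>)
  also have "\<dots> \<le> (\<Sum>l\<in>UNIV. real (j $ l) * norm (u $ l - v $ l))"
    by (intro sum_mono norm_power_diff) (use u v in \<open>auto simp: unit_cubeD\<close>)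
  finally show ?thesis by simp
qed

locale branching =
  fixes b :: "'n::finite \<Rightarrow> nat ^ 'n \<Rightarrow> real"
  assumes rates: "branching_rates b"
    and partials: "\<And>i j. \<exists>d. has_partial (genfun (b i)) d j 1"
begin

definition death :: "'n \<Rightarrow> real" where "death k = - b k (axis k 1)"
text \<open>Splitting off the only negative coefficient of \<open>b k\<close> leaves a series
  \<open>H k\<close> with nonnegative coefficients, hence monotone on the cube. The order arguments
  rest on \<open>B k u = H k u - death k * u $ k\<close>.\<close>

definition births :: "'n \<Rightarrow> nat ^ 'n \<Rightarrow> real" where
  "births k j = (if j = axis k 1 then 0 else b k j)"
abbreviation B :: "'n \<Rightarrow> real ^ 'n \<Rightarrow> real" where "B k \<equiv> genfun (b k)"
abbreviation H :: "'n \<Rightarrow> real ^ 'n \<Rightarrow> real" where "H k \<equiv> genfun (births k)"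

lemma death_pos: "0 < death k"
  using rates unfolding branching_rates_def death_def by auto

lemma births_nonneg: "0 \<le> births k j"
  using rates unfolding branching_rates_def births_def by auto

lemma births_has_sum: "(births k has_sum death k) UNIV"
proof -
  have "(births k has_sum death k) (UNIV - {axis k 1})"
    using rates unfolding branching_rates_def death_def
    by (subst has_sum_cong[where g = "b k"]) (auto simp: births_def)
  then show ?thesis
    by (subst (asm) has_sum_cong_neutral[where T = UNIV and g = "births k"]) (auto simp: births_def)
qed

lemma births_summable: "births k summable_on UNIV"
  using births_has_sum by (auto simp: summable_on_def)

lemma b_eq: "b k j = births k j - (if j = axis k 1 then death k else 0)"
  by (simp add: births_def death_def)

lemma b_has_sum: "(b k has_sum 0) UNIV"
  using has_sum_diff_real[OF births_has_sum has_sum_single, of k "axis k 1" "death k"]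
  unfolding b_eq[symmetric] by simp

lemma b_summable: "b k summable_on UNIV"
  using b_has_sum by (auto simp: summable_on_def)

lemma H_has_sum: "u \<in> unit_cube \<Longrightarrow> ((\<lambda>j. births k j * monomial u j) has_sum H k u) UNIV"
  by (rule has_sum_genfun[OF births_summable])

lemma B_eq:
  assumes "u \<in> unit_cube" shows "B k u = H k u - death k * u $ k"
proof -
  have "((\<lambda>j. births k j * monomial u j - (if j = axis k 1 then death k * u $ k else 0))
      has_sum (H k u - death k * u $ k)) UNIV"
    by (intro has_sum_diff_real H_has_sum[OF assms] has_sum_single)
  also have "(\<lambda>j. births k j * monomial u j - (if j = axis k 1 then death k * u $ k else 0))
      = (\<lambda>j. b k j * monomial u j)"
    by (auto simp: b_eq algebra_simps)
  finally show ?thesis by (simp add: genfun_def infsumI)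
qed

lemma H_one: "H k 1 = death k"
  using births_has_sum unfolding genfun_def by (simp add: infsumI)

lemma B_one: "B k 1 = 0"
  by (simp add: B_eq H_one)

lemma H_mono: "u \<in> unit_cube \<Longrightarrow> v \<in> unit_cube \<Longrightarrow> u \<le> v \<Longrightarrow> H k u \<le> H k v"
  by (rule genfun_mono[OF births_summable births_nonneg])

lemma cube_le_one: "u \<in> unit_cube \<Longrightarrow> u \<le> 1"
  by (simp add: less_eq_vec_def unit_cubeD)
lemma cube_ge_zero: "u \<in> unit_cube \<Longrightarrow> 0 \<le> u"
  by (simp add: less_eq_vec_def unit_cubeD)

lemma H_le: "u \<in> unit_cube \<Longrightarrow> H k u \<le> death k"
  using H_mono[of u 1 k] by (simp add: H_one cube_le_one)

lemma H_nonneg: "u \<in> unit_cube \<Longrightarrow> 0 \<le> H k u"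
  using H_mono[of 0 u k] by (simp add: genfun_0 births_nonneg cube_ge_zero order_trans[OF births_nonneg])

lemma continuous_on_H: "continuous_on unit_cube (H k)"
  by (rule continuous_on_genfun[OF births_summable])

text \<open>Finite derivatives at the corner are finite means of the offspring laws:
  \<open>(s ^ m - 1) / (s - 1)\<close> tends to \<open>m\<close> as \<open>s\<close> tends to 1, and
  a bound for every finite partial sum survives this limit.\<close>

lemma births_moment: "(\<lambda>j. births i j * real (j $ l)) summable_on UNIV"
proof -
  obtain d where d: "has_partial (genfun (b i)) d l 1" using partials by blast
  let ?U = "\<lambda>s::real. (\<chi> m. if m = l then s else 1) :: real ^ 'n"
  let ?F = "at (1::real) within {0..1}"
  have U: "?U s \<in> unit_cube" if "s \<in> {0..1}" for s using that by (auto simp: unit_cube_def)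
  have U1: "?U 1 = 1" by (auto simp: vec_eq_iff)
  have mon: "monomial (?U s) j = s ^ (j $ l)" for s j
    unfolding monomial_def by (subst prod.remove[of _ l]) (auto intro!: prod.neutral)
  have "((\<lambda>s. (B i (?U s) - B i (?U 1)) / (s - 1)) \<longlongrightarrow> d) ?F"
    using d unfolding has_partial_def has_field_derivative_iff by (simp cong: if_cong)
  moreover have "B i (?U 1) = 0" unfolding U1 by (rule B_one)
  ultimately have lim: "((\<lambda>s. B i (?U s) / (s - 1)) \<longlongrightarrow> d) ?F" by (simp only: diff_zero)
  have nt: "?F \<noteq> bot" by (auto simp: trivial_limit_within islimpt_Icc)
  \<comment> \<open>The summand \<open>death i\<close> covers the coefficient at
    \<open>axis i 1\<close>, which \<open>births\<close> omits: its share of the quotient is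
    \<open>death i\<close> when \<open>l = i\<close> and 0 otherwise.\<close>
  have fin: "(\<Sum>j\<in>T. births i j * real (j $ l)) \<le> d + death i" if T: "finite T" for T
  proof (rule tendsto_le[OF nt])
    show "((\<lambda>s. B i (?U s) / (s - 1) + death i) \<longlongrightarrow> d + death i) ?F"
      by (intro tendsto_intros lim)
    have "((\<lambda>s. (s ^ m - 1) / (s - 1)) \<longlongrightarrow> real m) ?F" for m
      using DERIV_power[OF DERIV_ident, of m 1 "{0..1}"] by (simp add: has_field_derivative_iff)
    then show "((\<lambda>s. \<Sum>j\<in>T. births i j * ((s ^ (j $ l) - 1) / (s - 1))) \<longlongrightarrow> (\<Sum>j\<in>T. births i j * real (j $ l))) ?F"
      by (intro tendsto_intros)
    have "eventually (\<lambda>s. s \<in> {0..<1}) ?F"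
      unfolding eventually_at by (auto intro!: exI[of _ 1])
    then show "eventually (\<lambda>s. (\<Sum>j\<in>T. births i j * ((s ^ (j $ l) - 1) / (s - 1))) \<le> B i (?U s) / (s - 1) + death i) ?F"
    proof eventually_elim
      case (elim s)
      then have s: "0 \<le> s" "s < 1" by auto
      have "((\<lambda>j. (births i j - births i j * monomial (?U s) j) * (1 / (1 - s))) has_sum
          (death i - H i (?U s)) * (1 / (1 - s))) UNIV"
        by (rule has_sum_cmult_left[OF has_sum_diff_real[OF births_has_sum H_has_sum[OF U]]]) (use s in auto)
      then have "(\<Sum>j\<in>T. (births i j - births i j * monomial (?U s) j) * (1 / (1 - s))) \<le> (death i - H i (?U s)) * (1 / (1 - s))"
        by (rule finite_sum_le_has_sum)
           (use s T in \<open>auto intro!: divide_nonneg_pos mult_left_le simp: births_nonneg mon power_le_one\<close>)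
      moreover have "(births i j - births i j * monomial (?U s) j) * (1 / (1 - s)) = births i j * ((s ^ (j $ l) - 1) / (s - 1))" for j
        using s by (simp add: mon field_simps)
      moreover have "(death i - H i (?U s)) * (1 / (1 - s)) = B i (?U s) / (s - 1) + death i * ((1 - ?U s $ i) / (1 - s))"
      proof -
        have "(x - y) * (1 / e) = (y - x * v) / - e + x * ((1 - v) / e)" if "0 < e" for x y v e :: real
          using that by (simp add: field_simps)
        from this[of "1 - s" "death i" "H i (?U s)" "?U s $ i"] show ?thesis
          using s by (subst B_eq[OF U]) auto
      qed
      moreover have "(1 - ?U s $ i) / (1 - s) \<le> 1" using s by auto
      then have "death i * ((1 - ?U s $ i) / (1 - s)) \<le> death i"
        using death_pos[of i] by (intro mult_left_le) auto
      ultimately show ?case by simp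
    qed
  qed
  show ?thesis
    by (rule nonneg_bdd_above_summable_on) (use fin births_nonneg in \<open>auto intro!: bdd_aboveI2\<close>)
qed

text \<open>Finite means bound the increments of \<open>H k\<close> through those of the monomials.
  The bound reaches the corner \<open>1\<close>, where uniqueness of trajectories and the control of
  explosion rely on it.\<close>

lemma B_Lipschitz:
  obtains L where "0 \<le> L" and
    "\<And>k u v. u \<in> unit_cube \<Longrightarrow> v \<in> unit_cube \<Longrightarrow> \<bar>B k u - B k v\<bar> \<le> L * (\<Sum>l\<in>UNIV. \<bar>u $ l - v $ l\<bar>)"
proof -
  define mom where "mom k l = (\<Sum>\<^sub>\<infinity>j. births k j * real (j $ l))" for k l
  have mom: "((\<lambda>j. births k j * real (j $ l)) has_sum mom k l) UNIV" for k l
    unfolding mom_def by (rule has_sum_infsum[OF births_moment])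
  have mom0: "0 \<le> mom k l" for k l
    by (rule has_sum_nonneg[OF mom]) (simp add: births_nonneg)
  define L where "L = (\<Sum>k\<in>UNIV. death k + (\<Sum>l\<in>UNIV. mom k l))"
  have dk: "death k + (\<Sum>l\<in>UNIV. mom k l) \<le> L" for k
    unfolding L_def by (rule member_le_sum) (auto intro!: add_nonneg_nonneg sum_nonneg mom0 less_imp_le[OF death_pos])
  have L0: "0 \<le> L" unfolding L_def by (auto intro!: add_nonneg_nonneg sum_nonneg mom0 less_imp_le[OF death_pos])
  show thesis
  proof (rule that[OF L0])
    fix k and u v :: "real ^ 'n" assume u: "u \<in> unit_cube" and v: "v \<in> unit_cube"
    let ?S = "\<Sum>l\<in>UNIV. \<bar>u $ l - v $ l\<bar>"
    have 1: "((\<lambda>j. births k j * monomial u j - births k j * monomial v j) has_sum (H k u - H k v)) UNIV"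
      by (intro has_sum_diff_real H_has_sum u v)
    have 2: "((\<lambda>j. \<Sum>l\<in>UNIV. births k j * real (j $ l) * \<bar>u $ l - v $ l\<bar>) has_sum (\<Sum>l\<in>UNIV. mom k l * \<bar>u $ l - v $ l\<bar>)) UNIV"
      by (rule has_sum_finite_sum[OF finite has_sum_cmult_left[OF mom]])
    have 3: "\<bar>births k j * monomial u j - births k j * monomial v j\<bar> \<le> (\<Sum>l\<in>UNIV. births k j * real (j $ l) * \<bar>u $ l - v $ l\<bar>)" for j
      using mult_left_mono[OF monomial_Lipschitz[OF u v, of j] births_nonneg[of k j]]
      by (simp add: births_nonneg abs_mult sum_distrib_left mult.assoc flip: right_diff_distrib)
    have "norm (H k u - H k v) \<le> (\<Sum>l\<in>UNIV. mom k l * \<bar>u $ l - v $ l\<bar>)"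
      by (rule norm_infsum_le[OF 1 2]) (use 3 in simp)
    then have "\<bar>H k u - H k v\<bar> \<le> (\<Sum>l\<in>UNIV. mom k l * \<bar>u $ l - v $ l\<bar>)" by simp
    also have "\<dots> \<le> (\<Sum>l\<in>UNIV. (\<Sum>l\<in>UNIV. mom k l) * \<bar>u $ l - v $ l\<bar>)"
      by (intro sum_mono mult_right_mono member_le_sum) (auto simp: mom0)
    finally have 1: "\<bar>H k u - H k v\<bar> \<le> (\<Sum>l\<in>UNIV. mom k l) * ?S" by (simp add: sum_distrib_left)
    have 2: "\<bar>death k * u $ k - death k * v $ k\<bar> \<le> death k * ?S"
      using member_le_sum[of k UNIV "\<lambda>l. \<bar>u $ l - v $ l\<bar>"] death_pos[of k]
      by (simp add: abs_mult flip: right_diff_distrib)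
    have "\<bar>B k u - B k v\<bar> \<le> (death k + (\<Sum>l\<in>UNIV. mom k l)) * ?S"
      using 1 2 unfolding B_eq[OF u] B_eq[OF v] by (simp add: algebra_simps)
    also have "\<dots> \<le> L * ?S" by (intro mult_right_mono dk sum_nonneg) auto
    finally show "\<bar>B k u - B k v\<bar> \<le> L * ?S" .
  qed
qed

text \<open>The factor \<open>g\<close> is a change of time: it is constant for the flow itself, and the
  reciprocal of one component of the vector field for the curve parametrised by that coordinate.\<close>

lemma flow_unique:
  fixes x y :: "real \<Rightarrow> real ^ 'n" and \<tau> g :: "real \<Rightarrow> real"
  assumes T: "0 \<le> T"
    and x: "\<And>s. s \<in> {0..T} \<Longrightarrow> x s \<in> unit_cube" and y: "\<And>s. s \<in> {0..T} \<Longrightarrow> y s \<in> unit_cube"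
    and x': "\<And>s k. s \<in> {0..T} \<Longrightarrow> ((\<lambda>s. x s $ k) has_real_derivative g s * B k (x s)) (at s within {0..T})"
    and y': "\<And>s k. s \<in> {0..T} \<Longrightarrow> ((\<lambda>s. y s $ k) has_real_derivative g s * B k (y s)) (at s within {0..T})"
    and \<tau>: "\<And>s. s \<in> {0..T} \<Longrightarrow> (\<tau> has_real_derivative g s) (at s within {0..T})"
    and g: "\<And>s. s \<in> {0..T} \<Longrightarrow> 0 \<le> g s"
    and eq: "x 0 = y 0"
  shows "x T = y T"
proof -
  obtain L where L: "0 \<le> L"
    "\<And>k u v. u \<in> unit_cube \<Longrightarrow> v \<in> unit_cube \<Longrightarrow> \<bar>B k u - B k v\<bar> \<le> L * (\<Sum>l\<in>UNIV. \<bar>u $ l - v $ l\<bar>)"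
    using B_Lipschitz by metis
  define K where "K = L * real CARD('n)"
  \<comment> \<open>Gronwall argument for the squared Euclidean distance; \<open>CARD('n)\<close> in
    \<open>K\<close> comes from comparing the squared l1 distance with the sum of squares.\<close>
  define D where "D s = (\<Sum>k\<in>UNIV. (x s $ k - y s $ k)\<^sup>2)" for s
  define D' where "D' s = (\<Sum>k\<in>UNIV. 2 * (x s $ k - y s $ k) * (g s * B k (x s) - g s * B k (y s)))" for s
  have D': "(D has_real_derivative D' s) (at s within {0..T})" if "s \<in> {0..T}" for s
    unfolding D_def D'_def
    by (rule derivative_eq_intros x'[OF that] y'[OF that] refl sum.cong)+ (simp add: algebra_simps)
  have D'_le: "D' s \<le> 2 * K * g s * D s" if s: "s \<in> {0..T}" for s
  proof -
    let ?S = "\<Sum>l\<in>UNIV. \<bar>x s $ l - y s $ l\<bar>"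
    have "D' s \<le> (\<Sum>k\<in>UNIV. 2 * g s * L * ?S * \<bar>x s $ k - y s $ k\<bar>)"
      unfolding D'_def
    proof (rule sum_mono)
      fix k
      have "2 * (x s $ k - y s $ k) * (g s * B k (x s) - g s * B k (y s))
          \<le> 2 * g s * (\<bar>x s $ k - y s $ k\<bar> * \<bar>B k (x s) - B k (y s)\<bar>)"
        using mult_left_mono[OF abs_ge_self[of "(x s $ k - y s $ k) * (B k (x s) - B k (y s))"], of "2 * g s"] g[OF s]
        unfolding abs_mult[of "x s $ k - y s $ k"] by (simp add: algebra_simps)
      also have "\<dots> \<le> 2 * g s * (\<bar>x s $ k - y s $ k\<bar> * (L * ?S))"
        by (intro mult_left_mono L(2) x y s) (use g[OF s] in auto)
      finally show "2 * (x s $ k - y s $ k) * (g s * B k (x s) - g s * B k (y s)) \<le> 2 * g s * L * ?S * \<bar>x s $ k - y s $ k\<bar>"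
        by (simp add: algebra_simps)
    qed
    also have "\<dots> = 2 * g s * L * ?S\<^sup>2" by (simp add: power2_eq_square flip: sum_distrib_left)
    also have "\<dots> \<le> 2 * g s * L * (D s * real CARD('n))"
      using sum_squared_le_sum_of_squares[of "\<lambda>l. \<bar>x s $ l - y s $ l\<bar>" UNIV] L(1) g[OF s]
      unfolding D_def by (intro mult_left_mono) auto
    finally show ?thesis unfolding K_def by (simp add: algebra_simps)
  qed
  \<comment> \<open>The integrating factor uses the changed time \<open>\<tau>\<close>, so no upper
    bound on \<open>g\<close> enters.\<close>
  define E where "E s = exp (- 2 * K * \<tau> s) * D s" for s
  have E': "(E has_real_derivative exp (- 2 * K * \<tau> s) * (D' s - 2 * K * g s * D s)) (at s within {0..T})"
    if s: "s \<in> {0..T}" for s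
    unfolding E_def
    by (rule derivative_eq_intros D'[OF s] \<tau>[OF s] refl)+ (simp add: algebra_simps)
  have "E T \<le> E 0"
    by (rule deriv_nonpos_imp_le[OF T subset_refl E'])
       (use D'_le in \<open>auto intro!: mult_nonneg_nonpos simp: less_imp_le\<close>)
  also have "E 0 = 0" by (simp add: E_def D_def eq)
  finally have "D T \<le> 0" unfolding E_def by (simp add: mult_le_0_iff)
  then have "D T = 0" unfolding D_def by (intro antisym sum_nonneg) auto
  then show ?thesis unfolding D_def by (simp add: sum_nonneg_eq_0_iff vec_eq_iff)
qed

section \<open>Existence of the flow by monotone Picard iteration\<close>

definition picard :: "real ^ 'n \<Rightarrow> (real \<Rightarrow> real ^ 'n) \<Rightarrow> real \<Rightarrow> real ^ 'n" where
  "picard u f t = (\<chi> k. exp (- death k * t) * (u $ k + integral {0..t} (\<lambda>s. exp (death k * s) * H k (f s))))"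

text \<open>Integrability is demanded in place of continuity: the limit of the iterates is a
  \<open>cube_path\<close> before it is known to be continuous, and continuity then follows from the
  fixed-point equation.\<close>

definition cube_path :: "(real \<Rightarrow> real ^ 'n) \<Rightarrow> bool" where
  "cube_path f \<longleftrightarrow> (\<forall>t\<ge>0. f t \<in> unit_cube) \<and>
     (\<forall>k. \<forall>t\<ge>0. (\<lambda>s. exp (death k * s) * H k (f s)) integrable_on {0..t})"

lemma integral_exp_death: "0 \<le> t \<Longrightarrow> ((\<lambda>s. exp (death k * s) * (death k * c)) has_integral c * (exp (death k * t) - 1)) {0..t}"
proof -
  assume t: "0 \<le> t"
  have "((\<lambda>s. exp (death k * s) * (death k * c)) has_integral (c * exp (death k * t) - c * exp (death k * 0))) {0..t}"
    by (intro fundamental_theorem_of_calculus t)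
       (auto intro!: derivative_eq_intros simp flip: has_real_derivative_iff_has_vector_derivative)
  then show ?thesis by (simp add: algebra_simps)
qed

text \<open>\<open>r\<close> is a supersolution in the coordinates with
  \<open>B k r \<le> 0\<close>; in a coordinate equal to 1 the general bound \<open>H_le\<close>
  takes over. Either way \<open>H k (f s)\<close> is at most \<open>death k * r $ k\<close>, whose
  weighted integral is explicit. The case \<open>r = 1\<close> keeps the iteration in the
  cube.\<close>

lemma picard_le:
  assumes f: "cube_path f" and r: "r \<in> unit_cube" and u: "u \<le> r" and t: "0 \<le> t"
    and fr: "\<And>s. 0 \<le> s \<Longrightarrow> f s \<le> r" and Br: "\<And>k. B k r \<le> 0 \<or> r $ k = 1"
  shows "picard u f t \<le> r"
proof (clarsimp simp: less_eq_vec_def picard_def)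
  fix k
  have Hr: "H k (f s) \<le> death k * r $ k" if s: "0 \<le> s" for s
  proof (cases "r $ k = 1")
    case True then show ?thesis using f s by (auto simp: cube_path_def intro!: H_le)
  next
    case False
    have "H k (f s) \<le> H k r" using f s r fr by (intro H_mono) (auto simp: cube_path_def)
    then show ?thesis using Br[of k] False B_eq[OF r, of k] by linarith
  qed
  have "integral {0..t} (\<lambda>s. exp (death k * s) * H k (f s)) \<le> r $ k * (exp (death k * t) - 1)"
    by (rule has_integral_le[OF integrable_integral integral_exp_death[OF t]])
       (use f t Hr in \<open>auto simp: cube_path_def\<close>)
  moreover have "u $ k \<le> r $ k" using u by (simp add: less_eq_vec_def)
  ultimately have "exp (- death k * t) * (u $ k + integral {0..t} (\<lambda>s. exp (death k * s) * H k (f s)))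
      \<le> exp (- death k * t) * (r $ k * exp (death k * t))"
    by (intro mult_left_mono) (auto simp: algebra_simps)
  also have "\<dots> = r $ k" by (simp add: exp_minus)
  finally show "exp (- (death k * t)) * (u $ k + integral {0..t} (\<lambda>s. exp (death k * s) * H k (f s))) \<le> r $ k"
    by simp
qed

text \<open>Variation of constants leaves only the monotone part \<open>H k\<close> under the
  integral, with a positive weight, and moves the linear loss term into the exponential. This is why
  the iteration uses \<open>picard\<close> and not the integral of \<open>B\<close>.\<close>

lemma picard_mono:
  assumes f: "cube_path f" and g: "cube_path g" and u: "u \<le> v" and t: "0 \<le> t"
    and fg: "\<And>s. 0 \<le> s \<Longrightarrow> f s \<le> g s"
  shows "picard u f t \<le> picard v g t"
proof (clarsimp simp: less_eq_vec_def picard_def)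
  fix k
  have "integral {0..t} (\<lambda>s. exp (death k * s) * H k (f s)) \<le> integral {0..t} (\<lambda>s. exp (death k * s) * H k (g s))"
    by (intro integral_le mult_left_mono H_mono fg) (use f g t in \<open>auto simp: cube_path_def\<close>)
  then show "u $ k + integral {0..t} (\<lambda>s. exp (death k * s) * H k (f s)) \<le> v $ k + integral {0..t} (\<lambda>s. exp (death k * s) * H k (g s))"
    using u by (auto simp: less_eq_vec_def intro!: add_mono)
qed

lemma picard_nonneg:
  assumes f: "cube_path f" and u: "0 \<le> u" and t: "0 \<le> t" shows "0 \<le> picard u f t"
  unfolding less_eq_vec_def
proof
  fix k
  have "0 \<le> integral {0..t} (\<lambda>s. exp (death k * s) * H k (f s))"
    by (rule integral_nonneg) (use f t in \<open>auto simp: cube_path_def H_nonneg\<close>)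
  moreover have "0 \<le> u $ k" using u by (simp add: less_eq_vec_def)
  ultimately show "0 $ k \<le> picard u f t $ k" unfolding picard_def by simp
qed

lemma picard_cube:
  assumes "cube_path f" "u \<in> unit_cube" "0 \<le> t" shows "picard u f t \<in> unit_cube"
proof -
  have "picard u f t \<le> 1"
    by (rule picard_le[OF assms(1)]) (use assms in \<open>auto simp: cube_le_one cube_path_def\<close>)
  moreover have "0 \<le> picard u f t" by (rule picard_nonneg) (use assms in \<open>auto simp: cube_ge_zero\<close>)
  ultimately show ?thesis by (auto simp: unit_cube_def less_eq_vec_def)
qed



lemma continuous_on_picard:
  assumes f: "cube_path f" shows "continuous_on {0..} (picard u f)"
proof (rule continuous_on_vecI)
  fix k
  have "continuous_on {0..} (\<lambda>t. integral {0..t} (\<lambda>s. exp (death k * s) * H k (f s)))"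
    by (rule continuous_on_atLeastI, rule indefinite_integral_continuous_1)
       (use f in \<open>auto simp: cube_path_def\<close>)
  then show "continuous_on {0..} (\<lambda>t. picard u f t $ k)"
    unfolding picard_def by (auto intro!: continuous_intros)
qed

lemma continuous_on_H_path:
  assumes "continuous_on {0..} f" "\<And>t. 0 \<le> t \<Longrightarrow> f t \<in> unit_cube"
  shows "continuous_on {0..} (\<lambda>s. exp (death k * s) * H k (f s))"
  by (intro continuous_intros continuous_on_compose2[OF continuous_on_H assms(1)]) (use assms(2) in auto)

lemma cube_pathI:
  assumes "continuous_on {0..} f" "\<And>t. 0 \<le> t \<Longrightarrow> f t \<in> unit_cube" shows "cube_path f"
  unfolding cube_path_def
proof (intro conjI allI impI)
  show "(\<lambda>s. exp (death k * s) * H k (f s)) integrable_on {0..t}" for k t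
    by (rule integrable_continuous_real, rule continuous_on_subset[OF continuous_on_H_path[OF assms]]) auto
qed (use assms in auto)

text \<open>Starting from the zero path, and not from \<open>u\<close>, makes the iterates increase
  in \<open>N\<close>, stay below every supersolution above \<open>u\<close> and depend
  monotonically on \<open>u\<close>. Convergence is then immediate.\<close>

definition iter :: "real ^ 'n \<Rightarrow> nat \<Rightarrow> real \<Rightarrow> real ^ 'n" where
  "iter u N = (picard u ^^ N) (\<lambda>_. 0)"

lemma iter_0: "iter u 0 t = 0" and iter_Suc: "iter u (Suc N) = picard u (iter u N)"
  by (simp_all add: iter_def)

lemma iter_path: "u \<in> unit_cube \<Longrightarrow> cube_path (iter u N)"
proof (induction N)
  case 0
  show ?case by (rule cube_pathI) (auto simp: iter_0[abs_def])
next
  case (Suc N)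
  then show ?case unfolding iter_Suc
    by (metis cube_pathI continuous_on_picard picard_cube)
qed

lemma iter_cube: "u \<in> unit_cube \<Longrightarrow> 0 \<le> t \<Longrightarrow> iter u N t \<in> unit_cube"
  using iter_path by (auto simp: cube_path_def)

lemma iter_incseq:
  assumes u: "u \<in> unit_cube" and t: "0 \<le> t" shows "iter u N t \<le> iter u (Suc N) t"
  using t
proof (induction N arbitrary: t)
  case 0 then show ?case using iter_cube[OF u, of t 1] by (simp add: iter_0 cube_ge_zero)
next
  case (Suc N)
  have "picard u (iter u N) t \<le> picard u (iter u (Suc N)) t"
    by (rule picard_mono[OF iter_path[OF u] iter_path[OF u]]) (use Suc in auto)
  then show ?case by (simp only: iter_Suc)
qed

lemma iter_mono:
  assumes u: "u \<in> unit_cube" and v: "v \<in> unit_cube" and "u \<le> v" and t: "0 \<le> t"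
  shows "iter u N t \<le> iter v N t"
  using t
proof (induction N arbitrary: t)
  case (Suc N)
  show ?case unfolding iter_Suc
    by (rule picard_mono) (use Suc assms in \<open>auto intro: iter_path\<close>)
qed (simp add: iter_0)

lemma iter_le:
  assumes u: "u \<in> unit_cube" and r: "r \<in> unit_cube" "u \<le> r" "\<And>k. B k r \<le> 0 \<or> r $ k = 1" and t: "0 \<le> t"
  shows "iter u N t \<le> r"
  using t
proof (induction N arbitrary: t)
  case 0 then show ?case using r by (simp add: iter_0 cube_ge_zero)
next
  case (Suc N)
  show ?case unfolding iter_Suc
    by (rule picard_le) (use Suc r u in \<open>auto intro: iter_path\<close>)
qed

definition flow :: "real \<Rightarrow> real ^ 'n \<Rightarrow> real ^ 'n" where
  "flow t u = (\<chi> k. SUP N. iter u N t $ k)"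

lemma iter_tendsto_flow:
  assumes "u \<in> unit_cube" "0 \<le> t" shows "(\<lambda>N. iter u N t) \<longlonglongrightarrow> flow t u"
proof (rule vec_tendstoI)
  fix k
  have "incseq (\<lambda>N. iter u N t $ k)"
    using iter_incseq[OF assms] by (intro incseq_SucI) (auto simp: less_eq_vec_def)
  moreover have "bdd_above (range (\<lambda>N. iter u N t $ k))"
    using iter_cube[OF assms] by (intro bdd_aboveI2[where M = 1]) (auto simp: unit_cubeD)
  ultimately show "(\<lambda>N. iter u N t $ k) \<longlonglongrightarrow> flow t u $ k"
    unfolding flow_def by (simp add: LIMSEQ_incseq_SUP)
qed

lemma flow_component_le:
  assumes "u \<in> unit_cube" "0 \<le> t" "\<And>N. iter u N t $ k \<le> x" shows "flow t u $ k \<le> x"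
  by (rule LIMSEQ_le_const2[OF tendsto_vec_nth[OF iter_tendsto_flow]]) (use assms in auto)

lemma iter_le_flow:
  assumes "u \<in> unit_cube" "0 \<le> t" shows "iter u N t \<le> flow t u"
proof -
  have "incseq (\<lambda>N. iter u N t $ k)" for k
    using iter_incseq[OF assms] by (intro incseq_SucI) (auto simp: less_eq_vec_def)
  then show ?thesis
    unfolding less_eq_vec_def using incseq_le[OF _ tendsto_vec_nth[OF iter_tendsto_flow[OF assms]]] by blast
qed

lemma flow_cube:
  assumes "u \<in> unit_cube" "0 \<le> t" shows "flow t u \<in> unit_cube"
proof -
  have "flow t u $ k \<le> 1" for k
    by (rule flow_component_le[OF assms]) (use iter_cube[OF assms] in \<open>auto simp: unit_cubeD\<close>)
  moreover have "0 \<le> flow t u" using iter_le_flow[OF assms, of 0] by (simp add: iter_0)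
  ultimately show ?thesis by (auto simp: unit_cube_def less_eq_vec_def)
qed

lemma flow_le:
  assumes "u \<in> unit_cube" "r \<in> unit_cube" "u \<le> r" "\<And>k. B k r \<le> 0 \<or> r $ k = 1" "0 \<le> t"
  shows "flow t u \<le> r"
  using flow_component_le[OF assms(1,5)] iter_le[OF assms] by (auto simp: less_eq_vec_def)

lemma flow_mono:
  assumes "u \<in> unit_cube" "v \<in> unit_cube" "u \<le> v" "0 \<le> t"
  shows "flow t u \<le> flow t v"
proof -
  have "iter u N t \<le> flow t v" for N
    using iter_mono[OF assms] iter_le_flow[OF assms(2,4)] by (rule order_trans)
  then show ?thesis using flow_component_le[OF assms(1,4)] by (auto simp: less_eq_vec_def)
qed

text \<open>The majorant \<open>exp (death k * s) * death k\<close> allows dominated convergence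
  under the integral. It also supplies integrability along the limit path, which so far is a mere
  pointwise supremum.\<close>

lemma flow_picard:
  assumes u: "u \<in> unit_cube"
  shows "cube_path (\<lambda>t. flow t u)" and "0 \<le> t \<Longrightarrow> flow t u = picard u (\<lambda>t. flow t u) t"
proof -
  have dc: "(\<lambda>s. exp (death k * s) * H k (flow s u)) integrable_on {0..t} \<and>
     (\<lambda>N. integral {0..t} (\<lambda>s. exp (death k * s) * H k (iter u N s))) \<longlonglongrightarrow> integral {0..t} (\<lambda>s. exp (death k * s) * H k (flow s u))"
    if t: "0 \<le> t" for t k
  proof -
    have 1: "(\<lambda>s. exp (death k * s) * H k (iter u N s)) integrable_on {0..t}" for N
      using iter_path[OF u] t by (auto simp: cube_path_def)
    have 2: "(\<lambda>s. exp (death k * s) * (death k * 1)) integrable_on {0..t}"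
      using integral_exp_death[OF t] by blast
    have 3: "norm (exp (death k * s) * H k (iter u N s)) \<le> exp (death k * s) * (death k * 1)" if "s \<in> {0..t}" for N s
      using that iter_cube[OF u] by (auto simp: abs_mult H_nonneg H_le)
    have 4: "(\<lambda>N. exp (death k * s) * H k (iter u N s)) \<longlonglongrightarrow> exp (death k * s) * H k (flow s u)" if "s \<in> {0..t}" for s
      using that u by (intro tendsto_intros tendsto_genfun births_summable iter_tendsto_flow iter_cube) auto
    show ?thesis using dominated_convergence[OF 1 2 3 4] by auto
  qed
  then show "cube_path (\<lambda>t. flow t u)" using flow_cube[OF u] by (auto simp: cube_path_def)
  show "flow t u = picard u (\<lambda>t. flow t u) t" if t: "0 \<le> t"
  proof (rule LIMSEQ_unique)
    show "(\<lambda>N. iter u (Suc N) t) \<longlonglongrightarrow> flow t u"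
      by (rule LIMSEQ_Suc[OF iter_tendsto_flow[OF u t]])
    show "(\<lambda>N. iter u (Suc N) t) \<longlonglongrightarrow> picard u (\<lambda>t. flow t u) t"
      unfolding iter_Suc
    proof (rule vec_tendstoI)
      fix k
      show "(\<lambda>N. picard u (iter u N) t $ k) \<longlonglongrightarrow> picard u (\<lambda>t. flow t u) t $ k"
        unfolding picard_def vec_lambda_beta by (intro tendsto_intros) (use dc[OF t] in blast)
    qed
  qed
qed

lemma continuous_on_flow: "u \<in> unit_cube \<Longrightarrow> continuous_on {0..} (\<lambda>t. flow t u)"
  using continuous_on_picard[OF flow_picard(1), of u u] flow_picard(2)[of u]
  by (subst continuous_on_cong[where g = "picard u (\<lambda>t. flow t u)"]) auto

lemma flow_0: "u \<in> unit_cube \<Longrightarrow> flow 0 u = u"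
  by (subst flow_picard(2)) (auto simp: picard_def vec_eq_iff)

lemma flow_derivative:
  assumes u: "u \<in> unit_cube" and t: "0 \<le> t"
  shows "((\<lambda>t. flow t u $ k) has_real_derivative B k (flow t u)) (at t within {0..})"
proof -
  let ?I = "\<lambda>t. integral {0..t} (\<lambda>s. exp (death k * s) * H k (flow s u))"
  have I: "(?I has_real_derivative exp (death k * t) * H k (flow t u)) (at t within {0..})"
    by (rule integral_has_real_derivative_atLeast[OF continuous_on_H_path t])
       (use u in \<open>auto intro: continuous_on_flow flow_cube\<close>)
  have eq: "flow s u $ k = exp (- death k * s) * (u $ k + ?I s)" if "0 \<le> s" for s
    using arg_cong[OF flow_picard(2)[OF u that], of "\<lambda>v. v $ k"] unfolding picard_def by simp
  have "((\<lambda>s. exp (- death k * s) * (u $ k + ?I s)) has_real_derivative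
      exp (- death k * t) * (exp (death k * t) * H k (flow t u)) - death k * (exp (- death k * t) * (u $ k + ?I t))) (at t within {0..})"
    by (rule derivative_eq_intros I refl)+ (simp add: algebra_simps)
  also have "exp (- death k * t) * (exp (death k * t) * H k (flow t u)) - death k * (exp (- death k * t) * (u $ k + ?I t)) = B k (flow t u)"
    unfolding B_eq[OF flow_cube[OF u t]] eq[OF t] by (simp add: exp_minus)
  finally show ?thesis
    by (rule has_field_derivative_transform_within[where d = 1]) (use eq t in auto)
qed

lemma flow_le_linear:
  assumes u: "u \<in> unit_cube" and t: "0 \<le> t" shows "flow t u $ k \<le> u $ k + death k * t"
proof -
  have "flow t u $ k - death k * t \<le> flow 0 u $ k - death k * 0"
  proof (rule deriv_nonpos_imp_le[where S = "{0..}", OF t])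
    fix s assume s: "s \<in> {0..t}"
    show "((\<lambda>t. flow t u $ k - death k * t) has_real_derivative B k (flow s u) - death k) (at s within {0..})"
      by (rule derivative_eq_intros flow_derivative u refl)+ (use s in auto)
    have c: "flow s u \<in> unit_cube" using s u by (intro flow_cube) auto
    have "0 \<le> death k * flow s u $ k" using unit_cubeD(1)[OF c] death_pos[of k] by simp
    then show "B k (flow s u) - death k \<le> 0"
      unfolding B_eq[OF c] using H_le[OF c, of k] by linarith
  qed auto
  then show ?thesis by (simp add: flow_0 u)
qed

lemma flow_eqI:
  assumes T: "0 \<le> T" and x: "\<And>s. s \<in> {0..T} \<Longrightarrow> x s \<in> unit_cube"
    and x': "\<And>s k. s \<in> {0..T} \<Longrightarrow> ((\<lambda>s. x s $ k) has_real_derivative B k (x s)) (at s within {0..T})"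
  shows "x T = flow T (x 0)"
proof (rule flow_unique[where g = "\<lambda>_. 1" and \<tau> = "\<lambda>s. s", OF T])
  have u: "x 0 \<in> unit_cube" using x T by auto
  show "flow s (x 0) \<in> unit_cube" if "s \<in> {0..T}" for s using that u by (auto intro: flow_cube)
  show "((\<lambda>s. flow s (x 0) $ k) has_real_derivative 1 * B k (flow s (x 0))) (at s within {0..T})" if "s \<in> {0..T}" for s k
    using that DERIV_subset[OF flow_derivative[OF u], of s "{0..T}" k] by auto
  show "x 0 = flow 0 (x 0)" using flow_0[OF u] by simp
qed (use x x' in \<open>auto intro!: derivative_eq_intros\<close>)

lemma flow_one: "0 \<le> t \<Longrightarrow> flow t 1 = 1"
  using flow_eqI[of t "\<lambda>_. 1"] by (auto simp: B_one)

end

section \<open>Transition functions with a conservative q-matrix\<close>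

lemma continuous_on_atLeast_incrementI:
  fixes f :: "real \<Rightarrow> real"
  assumes inc: "\<And>s t. 0 \<le> s \<Longrightarrow> 0 \<le> t \<Longrightarrow> \<bar>f (s + t) - f t\<bar> \<le> g s"
    and g: "(g \<longlongrightarrow> 0) (at_right 0)"
  shows "continuous_on {0..} f"
  unfolding continuous_on_iff
proof (intro ballI allI impI)
  fix t e :: real assume t: "t \<in> {0..}" and e: "0 < e"
  have "eventually (\<lambda>s. dist (g s) 0 < e) (at_right 0)" using g e by (rule tendstoD)
  then obtain d where d: "d > 0" "\<And>s. 0 < s \<Longrightarrow> s < d \<Longrightarrow> \<bar>g s\<bar> < e"
    by (auto simp: eventually_at_right_field)
  show "\<exists>d>0. \<forall>x'\<in>{0..}. dist x' t < d \<longrightarrow> dist (f x') (f t) < e"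
  proof (intro exI[of _ d] conjI ballI impI d)
    fix x' assume x': "x' \<in> {0..}" "dist x' t < d"
    consider "x' = t" | "x' > t" | "x' < t" by linarith
    then show "dist (f x') (f t) < e"
    proof cases
      case 2
      then show ?thesis using inc[of "x' - t" t] d(2)[of "x' - t"] x' t by (auto simp: dist_real_def)
    next
      case 3
      then show ?thesis using inc[of "t - x'" x'] d(2)[of "t - x'"] x' t by (auto simp: dist_real_def)
    qed (use e in auto)
  qed
qed

locale q_process =
  fixes Q :: "'s \<Rightarrow> 's \<Rightarrow> real" and P :: "real \<Rightarrow> 's \<Rightarrow> 's \<Rightarrow> real"
  assumes Q_function: "Q_function Q P" and conserv: "conservative Q"
begin

lemma P_nonneg: "0 \<le> t \<Longrightarrow> 0 \<le> P t i j"
  and P_summable: "0 \<le> t \<Longrightarrow> P t i summable_on UNIV"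
  and P_mass: "0 \<le> t \<Longrightarrow> (\<Sum>\<^sub>\<infinity>j. P t i j) \<le> 1"
  and P_0: "P 0 i j = (if i = j then 1 else 0)"
  and P_CK: "0 \<le> s \<Longrightarrow> 0 \<le> t \<Longrightarrow> ((\<lambda>k. P s i k * P t k j) has_sum P (s + t) i j) UNIV"
  and P_standard: "((\<lambda>t. P t i i) \<longlongrightarrow> 1) (at_right 0)"
  using Q_function unfolding Q_function_def transition_function_def by auto

lemma P_deriv: "((\<lambda>h. (P h i j - (if i = j then 1 else 0)) / h) \<longlongrightarrow> Q i j) (at_right 0)"
  using Q_function unfolding Q_function_def has_field_derivative_iff
  by (simp add: at_within_Ici_at_right P_0)

lemma Q_has_sum: "(Q i has_sum 0) UNIV" using conserv unfolding conservative_def by auto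

lemma Q_nonneg: "i \<noteq> j \<Longrightarrow> 0 \<le> Q i j"
proof (rule tendsto_lowerbound[OF P_deriv])
  assume "i \<noteq> j"
  then show "eventually (\<lambda>h. 0 \<le> (P h i j - (if i = j then 1 else 0)) / h) (at_right 0)"
    by (auto intro!: eventually_mono[OF eventually_at_right_less[of 0]] simp: P_nonneg)
qed simp

section \<open>The semigroup acting on functions with values in the unit interval\<close>

definition semi :: "('s \<Rightarrow> real) \<Rightarrow> real \<Rightarrow> 's \<Rightarrow> real" where
  "semi y t i = (\<Sum>\<^sub>\<infinity>k. P t i k * y k)"

context
  fixes y :: "'s \<Rightarrow> real" assumes y: "\<And>k. 0 \<le> y k" "\<And>k. y k \<le> 1"
begin

lemma semi_has_sum: "0 \<le> t \<Longrightarrow> ((\<lambda>k. P t i k * y k) has_sum semi y t i) UNIV"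
  unfolding semi_def
  by (intro has_sum_infsum summable_on_le[OF P_summable]) (use y in \<open>auto simp: abs_mult P_nonneg intro!: mult_left_le\<close>)

lemma semi_bounds: assumes t: "0 \<le> t" shows "0 \<le> semi y t i" "semi y t i \<le> 1"
proof -
  show "0 \<le> semi y t i" by (rule has_sum_nonneg[OF semi_has_sum[OF t]]) (use y P_nonneg t in auto)
  have "semi y t i \<le> (\<Sum>\<^sub>\<infinity>j. P t i j)"
    by (rule has_sum_mono[OF semi_has_sum[OF t] has_sum_infsum[OF P_summable[OF t]]])
       (use y P_nonneg t in \<open>auto intro!: mult_left_le\<close>)
  then show "semi y t i \<le> 1" using P_mass[OF t, of i] by linarith
qed

lemma semi_CK:
  assumes s: "0 \<le> s" and t: "0 \<le> t" shows "((\<lambda>k. P s i k * semi y t k) has_sum semi y (s + t) i) UNIV"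
proof -
  have "((\<lambda>k. \<Sum>\<^sub>\<infinity>j. P s i k * P t k j * y j) has_sum semi y (s + t) i) UNIV"
  proof (rule has_sum_swap_nonneg(2))
    show "((\<lambda>k. P s i k * P t k j * y j) has_sum (P (s + t) i j * y j)) UNIV" for j
      by (rule has_sum_cmult_left[OF P_CK[OF s t]])
    show "((\<lambda>j. P (s + t) i j * y j) has_sum semi y (s + t) i) UNIV"
      by (rule semi_has_sum) (use s t in auto)
  qed (use s t y P_nonneg in auto)
  moreover have "(\<Sum>\<^sub>\<infinity>j. P s i k * P t k j * y j) = P s i k * semi y t k" for k
    using has_sum_cmult_right[OF semi_has_sum[OF t, of k], of "P s i k"] by (simp add: infsumI mult.assoc)
  ultimately show ?thesis by simp
qed

text \<open>Only the diagonal term of \<open>P s i\<close> is kept, once in the sum for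
  \<open>semi y t\<close> and once in that for \<open>1 - semi y t\<close>. The resulting bound is
  uniform in \<open>t\<close>.\<close>

lemma semi_increment:
  assumes s: "0 \<le> s" and t: "0 \<le> t" shows "\<bar>semi y (s + t) i - semi y t i\<bar> \<le> 1 - P s i i"
proof -
  have bb: "0 \<le> semi y t k" "semi y t k \<le> 1" for k using semi_bounds[OF t] by auto
  have 1: "((\<lambda>k. P s i k * semi y t k) has_sum semi y (s + t) i) UNIV" by (rule semi_CK[OF s t])
  have Pi: "P s i i \<le> 1"
    using finite_sum_le_has_sum[OF has_sum_infsum[OF P_summable[OF s, of i]], of "{i}"] P_nonneg[OF s] P_mass[OF s, of i]
    by auto
  have lo: "P s i i * semi y t i \<le> semi y (s + t) i"
    using finite_sum_le_has_sum[OF 1, of "{i}"] P_nonneg[OF s] bb by auto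
  have "((\<lambda>k. P s i k - P s i k * semi y t k) has_sum ((\<Sum>\<^sub>\<infinity>j. P s i j) - semi y (s + t) i)) UNIV"
    by (rule has_sum_diff_real[OF has_sum_infsum[OF P_summable[OF s]] 1])
  from finite_sum_le_has_sum[OF this, of "{i}"]
  have "P s i i - P s i i * semi y t i \<le> (\<Sum>\<^sub>\<infinity>j. P s i j) - semi y (s + t) i"
    using mult_left_le[OF bb(2) P_nonneg[OF s]] by auto
  then have hi: "semi y (s + t) i \<le> 1 - P s i i + P s i i * semi y t i" using P_mass[OF s, of i] by linarith
  have "(1 - P s i i) * semi y t i \<le> 1 - P s i i" using Pi bb by (intro mult_left_le) auto
  moreover have "P s i i * semi y t i \<le> semi y t i"
    using Pi bb[of i] mult_right_mono[of "P s i i" 1 "semi y t i"] by simp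
  ultimately show ?thesis using lo hi by (auto simp: algebra_simps abs_le_iff)
qed

lemma continuous_on_semi: "continuous_on {0..} (\<lambda>t. semi y t i)"
proof (rule continuous_on_atLeast_incrementI[OF semi_increment])
  have "((\<lambda>s. 1 - P s i i) \<longlongrightarrow> 1 - 1) (at_right 0)" by (intro tendsto_intros P_standard)
  then show "((\<lambda>s. 1 - P s i i) \<longlongrightarrow> 0) (at_right 0)" by simp
qed

lemma Q_y_summable: "(\<lambda>k. Q i k * y k) summable_on UNIV"
proof (rule summable_on_le)
  show "(\<lambda>k. \<bar>Q i k\<bar>) summable_on UNIV"
    using has_sum_imp_summable[OF Q_has_sum] summable_on_iff_abs_summable_on_real by auto
qed (use y in \<open>auto simp: abs_mult intro!: mult_left_le\<close>)

text \<open>Scheffe's argument: the difference quotients converge pointwise to \<open>Q i\<close>, they are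
  nonnegative off the diagonal, and their total is at most that of \<open>Q i\<close>.\<close>

lemma generator: "((\<lambda>h. (semi y h i - y i) / h) \<longlongrightarrow> (\<Sum>\<^sub>\<infinity>k. Q i k * y k)) (at_right 0)"
proof (rule tendstoI)
  fix e :: real assume e: "0 < e"
  define r where "r h k = (P h i k - (if i = k then 1 else 0)) / h" for h k
  let ?Qy = "\<Sum>\<^sub>\<infinity>k. Q i k * y k"
  have "((\<lambda>X. sum (Q i) X) \<longlongrightarrow> 0) (finite_subsets_at_top UNIV)"
    using Q_has_sum by (simp add: has_sum_def)
  then have "eventually (\<lambda>X. dist (sum (Q i) X) 0 < e/6) (finite_subsets_at_top UNIV)"
    using e by (intro tendstoD) auto
  then obtain X where X: "finite X" "\<And>Y. finite Y \<Longrightarrow> X \<subseteq> Y \<Longrightarrow> \<bar>sum (Q i) Y\<bar> < e/6"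
    by (auto simp: eventually_finite_subsets_at_top)
  \<comment> \<open>Including \<open>i\<close> leaves only nonnegative rates and nonnegative
    difference quotients outside \<open>T\<close>.\<close>
  define T where "T = insert i X"
  have T: "finite T" "i \<in> T" "\<bar>sum (Q i) T\<bar> < e/6" using X unfolding T_def by auto
  have lim1: "((\<lambda>h. sum (r h) T) \<longlongrightarrow> sum (Q i) T) (at_right 0)"
    unfolding r_def by (intro tendsto_sum P_deriv)
  have lim2: "((\<lambda>h. \<Sum>k\<in>T. r h k * y k) \<longlongrightarrow> (\<Sum>k\<in>T. Q i k * y k)) (at_right 0)"
    unfolding r_def by (intro tendsto_sum tendsto_mult P_deriv tendsto_const)
  have ev1: "eventually (\<lambda>h. dist (sum (r h) T) (sum (Q i) T) < e/6) (at_right 0)"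
    by (rule tendstoD[OF lim1]) (use e in auto)
  have ev2: "eventually (\<lambda>h. dist (\<Sum>k\<in>T. r h k * y k) (\<Sum>k\<in>T. Q i k * y k) < e/6) (at_right 0)"
    by (rule tendstoD[OF lim2]) (use e in auto)
  \<comment> \<open>Off \<open>T\<close> the weights \<open>f\<close> are nonnegative and
    \<open>y \<le> 1\<close>, so the weighted tail is at most the tail \<open>m - sum f T\<close>,
    and \<open>m \<le> 0\<close>. One finite sum thus controls the tail of \<open>Q i\<close> as
    well as that of the difference quotients.\<close>
  have tail: "\<bar>s - (\<Sum>k\<in>T. f k * y k)\<bar> \<le> - sum f T"
    if f: "(f has_sum m) UNIV" "m \<le> 0" "\<And>k. k \<notin> T \<Longrightarrow> 0 \<le> f k" and s: "((\<lambda>k. f k * y k) has_sum s) UNIV" for f m s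
  proof -
    have 1: "(f has_sum (m - sum f T)) (UNIV - T)"
      by (intro has_sum_Diff f has_sum_finite T) auto
    have 2: "((\<lambda>k. f k * y k) has_sum (s - (\<Sum>k\<in>T. f k * y k))) (UNIV - T)"
      by (intro has_sum_Diff s has_sum_finite T) auto
    have "norm (s - (\<Sum>k\<in>T. f k * y k)) \<le> m - sum f T"
      by (rule norm_infsum_le[OF 2 1]) (use f y in \<open>auto simp: abs_mult intro!: mult_left_le\<close>)
    then show ?thesis using f(2) by simp
  qed
  have Qt: "\<bar>?Qy - (\<Sum>k\<in>T. Q i k * y k)\<bar> \<le> - sum (Q i) T"
  proof (rule tail[OF Q_has_sum])
    show "0 \<le> Q i k" if "k \<notin> T" for k using that T(2) Q_nonneg[of i k] by auto
  qed (use has_sum_infsum[OF Q_y_summable] in auto)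
  show "eventually (\<lambda>h. dist ((semi y h i - y i) / h) ?Qy < e) (at_right 0)"
    using ev1 ev2 eventually_at_right_less[of 0]
  proof eventually_elim
    case (elim h)
    then have h: "0 \<le> h" "0 < h" by auto
    have sg: "((\<lambda>k. if i = k then 1 else 0) has_sum (1::real)) UNIV" "((\<lambda>k. (if i = k then 1 else 0) * y k) has_sum y i) UNIV"
      using has_sum_single[of i 1] has_sum_single[of i "y i"]
      by (auto simp: eq_commute[of i] if_distrib[of "\<lambda>x. x * _"] cong: if_cong)
    have "((\<lambda>k. (P h i k - (if i = k then 1 else 0)) * (1 / h)) has_sum (((\<Sum>\<^sub>\<infinity>j. P h i j) - 1) * (1 / h))) UNIV"
      by (rule has_sum_cmult_left[OF has_sum_diff_real[OF has_sum_infsum[OF P_summable[OF h(1)]] sg(1)]])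
    then have rs: "(r h has_sum ((\<Sum>\<^sub>\<infinity>j. P h i j) - 1) / h) UNIV" unfolding r_def[abs_def] by simp
    have "((\<lambda>k. (P h i k * y k - (if i = k then 1 else 0) * y k) * (1 / h)) has_sum ((semi y h i - y i) * (1 / h))) UNIV"
      by (rule has_sum_cmult_left[OF has_sum_diff_real[OF semi_has_sum[OF h(1)] sg(2)]])
    then have rys: "((\<lambda>k. r h k * y k) has_sum ((semi y h i - y i) / h)) UNIV"
      unfolding r_def[abs_def] by (simp add: diff_divide_distrib left_diff_distrib)
    have "\<bar>(semi y h i - y i) / h - (\<Sum>k\<in>T. r h k * y k)\<bar> \<le> - sum (r h) T"
    proof (rule tail[OF rs _ _ rys])
      show "((\<Sum>\<^sub>\<infinity>j. P h i j) - 1) / h \<le> 0" using P_mass[OF h(1), of i] h by (simp add: divide_le_0_iff)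
      show "0 \<le> r h k" if "k \<notin> T" for k using that T(2) h P_nonneg[OF h(1)] unfolding r_def by auto
    qed
    then show ?case using elim(1,2) Qt T(3) unfolding dist_real_def by linarith
  qed
qed

end

end

text \<open>At the infimum \<open>t0\<close> of the bad times continuity still gives nonnegativity.
  Just afterwards a positive value persists by continuity and a zero value is pushed up by its
  positive right derivative; finiteness of \<open>S\<close> makes one time interval serve all
  states. Right derivatives are what \<open>generator\<close> provides.\<close>

lemma maximum_principle:
  fixes w :: "real \<Rightarrow> 's \<Rightarrow> real" and d :: "real \<Rightarrow> 's \<Rightarrow> real"
  assumes S: "finite S" "\<And>t i. t \<in> {0..T} \<Longrightarrow> i \<notin> S \<Longrightarrow> 0 \<le> w t i"
    and w0: "\<And>i. 0 \<le> w 0 i"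
    and cont: "\<And>i. continuous_on {0..T} (\<lambda>t. w t i)"
    and right: "\<And>t i. t \<in> {0..<T} \<Longrightarrow> ((\<lambda>h. (w (t + h) i - w t i) / h) \<longlongrightarrow> d t i) (at_right 0)"
    and dpos: "\<And>t i. t \<in> {0..<T} \<Longrightarrow> (\<And>k. 0 \<le> w t k) \<Longrightarrow> w t i = 0 \<Longrightarrow> 0 < d t i"
    and t: "t \<in> {0..T}"
  shows "0 \<le> w t i"
proof (rule ccontr)
  assume neg: "\<not> 0 \<le> w t i"
  define Z where "Z = {s \<in> {0..T}. \<exists>i. w s i < 0}"
  have tZ: "t \<in> Z" using neg t unfolding Z_def by (auto simp: not_le)
  have bdd: "bdd_below Z" unfolding Z_def by (auto intro!: bdd_belowI[of _ 0])
  define t0 where "t0 = Inf Z"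
  have t0: "0 \<le> t0" "t0 \<le> t" unfolding t0_def
    using tZ bdd by (auto intro!: cInf_greatest cInf_lower simp: Z_def)
  have before: "0 \<le> w s k" if "0 \<le> s" "s < t0" for s k
  proof (rule ccontr)
    assume "\<not> 0 \<le> w s k"
    then have "s \<in> Z" using that t0 t unfolding Z_def by (auto simp: not_le)
    then have "t0 \<le> s" unfolding t0_def by (rule cInf_lower[OF _ bdd])
    then show False using that by simp
  qed
  have at0: "0 \<le> w t0 k" for k
  proof (cases "t0 = 0")
    case False
    then have t0': "0 < t0" using t0 by simp
    have "((\<lambda>t. w t k) \<longlongrightarrow> w t0 k) (at t0 within {0..<t0})"
      using cont[of k] t0 t unfolding continuous_on_def
      by (auto intro: tendsto_within_subset[where S = "{0..T}"])
    moreover have "at t0 within {0..<t0} = at_left t0"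
      by (rule at_within_nhd[where S = "{0<..}"]) (use t0' in auto)
    moreover have "eventually (\<lambda>s. 0 \<le> w s k) (at_left t0)"
      using before by (auto intro!: eventually_mono[OF eventually_at_left_real[OF t0']])
    ultimately show ?thesis by (intro tendsto_lowerbound[where F = "at_left t0"]) auto
  qed (use w0 in auto)
  have "t0 \<noteq> t" using at0 neg by auto
  then have t0T: "t0 < t" "t0 \<in> {0..<T}" using t0 t by auto
  have "eventually (\<lambda>h. 0 \<le> w (t0 + h) k) (at_right 0)" for k
  proof (cases "w t0 k = 0")
    case True
    have "eventually (\<lambda>h. 0 < (w (t0 + h) k - w t0 k) / h) (at_right 0)"
      by (rule order_tendstoD(1)[OF right[OF t0T(2)] dpos[OF t0T(2) at0 True]])
    then show ?thesis using eventually_at_right_less[of 0]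
      by eventually_elim (auto simp: True zero_less_divide_iff)
  next
    case False
    then have pos: "0 < w t0 k" using at0[of k] by simp
    have "((\<lambda>t. w t k) \<longlongrightarrow> w t0 k) (at t0 within {t0<..T})"
      using cont[of k] t0 t unfolding continuous_on_def
      by (auto intro: tendsto_within_subset[where S = "{0..T}"])
    moreover have "at t0 within {t0<..T} = at_right t0"
      by (rule at_within_nhd[where S = "{..<T}"]) (use t0T in auto)
    ultimately have "eventually (\<lambda>s. 0 < w s k) (at_right t0)"
      using pos by (auto dest: order_tendstoD)
    then show ?thesis
      by (subst (asm) eventually_at_right_to_0) (auto elim: eventually_mono simp: add.commute)
  qed
  then have "eventually (\<lambda>h. \<forall>k\<in>S. 0 \<le> w (t0 + h) k) (at_right 0)"
    using S(1) by (simp add: eventually_ball_finite_distrib)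
  then obtain e where e: "0 < e" "\<And>h k. 0 < h \<Longrightarrow> h < e \<Longrightarrow> k \<in> S \<Longrightarrow> 0 \<le> w (t0 + h) k"
    by (auto simp: eventually_at_right_field)
  have "Inf Z < t0 + e" unfolding t0_def[symmetric] using e by simp
  then obtain z where z: "z \<in> Z" "z < t0 + e" using cInf_lessD[of Z] tZ by blast
  then obtain k where k: "w z k < 0" and zT: "z \<in> {0..T}" unfolding Z_def by auto
  have "t0 \<le> z" unfolding t0_def by (rule cInf_lower[OF z(1) bdd])
  moreover have "z \<noteq> t0" using at0[of k] k by auto
  ultimately have "0 < z - t0" "z - t0 < e" using z by auto
  then have "k \<in> S \<Longrightarrow> 0 \<le> w z k" using e(2)[of "z - t0" k] by simp
  then show False using S(2)[OF zT, of k] k by (cases "k \<in> S") auto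
qed

lemma monomial_minus_axis:
  "monomial u (i - axis k 1) = u $ k ^ (i $ k - 1) * (\<Prod>l\<in>UNIV - {k}. u $ l ^ i $ l)"
proof -
  have "monomial u (i - axis k 1) = u $ k ^ ((i - axis k 1) $ k) * (\<Prod>l\<in>UNIV - {k}. u $ l ^ ((i - axis k 1) $ l))"
    unfolding monomial_def by (rule prod.remove) auto
  also have "(\<Prod>l\<in>UNIV - {k}. u $ l ^ ((i - axis k 1) $ l)) = (\<Prod>l\<in>UNIV - {k}. u $ l ^ i $ l)"
    by (rule prod.cong) (auto simp: axis_def)
  finally show ?thesis by (simp add: axis_def)
qed

lemma monomial_derivative:
  fixes f :: "real \<Rightarrow> real ^ 'n"
  assumes "\<And>k. ((\<lambda>t. f t $ k) has_real_derivative f' k) (at t within S)"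
  shows "((\<lambda>t. monomial (f t) i) has_real_derivative (\<Sum>k\<in>UNIV. real (i $ k) * (f' k * monomial (f t) (i - axis k 1)))) (at t within S)"
proof -
  have 1: "((\<lambda>t. f t $ k ^ i $ k) has_derivative (\<lambda>y. y * (real (i $ k) * (f' k * f t $ k ^ (i $ k - 1))))) (at t within S)" for k
    using DERIV_power[OF assms[of k], of "i $ k"]
    by (simp add: has_field_derivative_def mult_commute_abs)
  note 2 = monomial_minus_axis[of "f t" i]
  have "((\<lambda>t. monomial (f t) i) has_derivative
     (\<lambda>y. \<Sum>k\<in>UNIV. y * (real (i $ k) * (f' k * f t $ k ^ (i $ k - 1))) * (\<Prod>l\<in>UNIV - {k}. f t $ l ^ i $ l))) (at t within S)"
    unfolding monomial_def by (rule has_derivative_prod[OF 1])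
  also have "(\<lambda>y. \<Sum>k\<in>UNIV. y * (real (i $ k) * (f' k * f t $ k ^ (i $ k - 1))) * (\<Prod>l\<in>UNIV - {k}. f t $ l ^ i $ l))
      = (*) (\<Sum>k\<in>UNIV. real (i $ k) * (f' k * monomial (f t) (i - axis k 1)))"
    unfolding 2 by (simp add: fun_eq_iff sum_distrib_left sum_distrib_right mult_ac)
  finally show ?thesis unfolding has_field_derivative_def .
qed

section \<open>The branching process with immigration\<close>

locale immigration_branching = branching b for b :: "'n::finite \<Rightarrow> nat ^ 'n \<Rightarrow> real" +
  fixes a :: "nat ^ 'n \<Rightarrow> real" and P :: "real \<Rightarrow> nat ^ 'n \<Rightarrow> nat ^ 'n \<Rightarrow> real"
  assumes immig: "immigration_rates a"
    and Qf: "Q_function (qmat a b) P" and consv: "conservative (qmat a b)"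

sublocale immigration_branching \<subseteq> q_process "qmat a b" P
  by unfold_locales (rule Qf, rule consv)

context immigration_branching
begin

abbreviation Q where "Q \<equiv> qmat a b"
abbreviation A :: "real ^ 'n \<Rightarrow> real" where "A \<equiv> genfun a"
definition arrivals :: "nat ^ 'n \<Rightarrow> real" where "arrivals j = (if j = 0 then 0 else a j)"

lemma arrivals_nonneg: "0 \<le> arrivals j"
  using immig unfolding immigration_rates_def arrivals_def by auto

lemma arrivals_has_sum: "(arrivals has_sum (- a 0)) UNIV"
proof -
  have "(arrivals has_sum (- a 0)) (UNIV - {0})"
    using immig unfolding immigration_rates_def
    by (subst has_sum_cong[where g = a]) (auto simp: arrivals_def)
  then show ?thesis
    by (subst (asm) has_sum_cong_neutral[where T = UNIV and g = arrivals]) (auto simp: arrivals_def)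
qed

lemma arrivals_summable: "arrivals summable_on UNIV"
  using arrivals_has_sum by (auto simp: summable_on_def)

lemma a_eq: "a j = arrivals j - (if j = 0 then - a 0 else 0)" by (simp add: arrivals_def)

lemma a_has_sum: "(a has_sum 0) UNIV"
  using has_sum_diff_real[OF arrivals_has_sum has_sum_single, of 0 "- a 0"]
  unfolding a_eq[symmetric] by simp

lemma a_summable: "a summable_on UNIV" using a_has_sum by (auto simp: summable_on_def)

lemma A_one: "A 1 = 0" using a_has_sum unfolding genfun_def by (simp add: infsumI)

lemma A_eq: assumes "u \<in> unit_cube" shows "A u = genfun arrivals u + a 0"
proof -
  have "((\<lambda>j. arrivals j * monomial u j - (if j = 0 then - a 0 else 0)) has_sum (genfun arrivals u - - a 0)) UNIV"
    by (intro has_sum_diff_real has_sum_genfun[OF arrivals_summable assms] has_sum_single)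
  also have "(\<lambda>j. arrivals j * monomial u j - (if j = 0 then - a 0 else 0)) = (\<lambda>j. a j * monomial u j)"
    by (auto simp: arrivals_def)
  finally show ?thesis by (simp add: genfun_def infsumI)
qed

lemma A_mono: "u \<in> unit_cube \<Longrightarrow> v \<in> unit_cube \<Longrightarrow> u \<le> v \<Longrightarrow> A u \<le> A v"
  using genfun_mono[OF arrivals_summable arrivals_nonneg] by (simp add: A_eq)

lemma A_nonpos: "u \<in> unit_cube \<Longrightarrow> A u \<le> 0"
  using A_mono[of u 1] by (simp add: A_one cube_le_one)

section \<open>The q-matrix applied to monomials\<close>

lemma shift_has_sum:
  fixes c :: "nat ^ 'n \<Rightarrow> real"
  assumes "((\<lambda>j. c j * monomial u j) has_sum s) UNIV"
  shows "((\<lambda>j. (if i \<le> j then c (j - i) else 0) * monomial u j) has_sum (s * monomial u i)) UNIV"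
proof -
  have inj: "inj_on ((+) i) UNIV" by simp
  have "((\<lambda>j. (if i \<le> j then c (j - i) else 0) * monomial u j) \<circ> (+) i) = (\<lambda>j. c j * monomial u j * monomial u i)"
    by (auto simp: fun_eq_iff monomial_add less_eq_vec_def)
  then have "(((\<lambda>j. (if i \<le> j then c (j - i) else 0) * monomial u j) \<circ> (+) i) has_sum (s * monomial u i)) UNIV"
    using has_sum_cmult_left[OF assms] by simp
  then have "((\<lambda>j. (if i \<le> j then c (j - i) else 0) * monomial u j) has_sum (s * monomial u i)) (range ((+) i))"
    by (subst has_sum_reindex[OF inj])
  moreover have "j \<in> range ((+) i)" if "i \<le> j" for j
  proof -
    have "j = i + (j - i)" using that by (auto simp: vec_eq_iff less_eq_vec_def)
    then show ?thesis by blast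
  qed
  ultimately show ?thesis
    by (subst has_sum_cong_neutral[where T = "range ((+) i)"]) auto
qed

text \<open>The value at \<open>i\<close> of \<open>qmat a b\<close> applied to the function
  \<open>\<lambda>j. monomial u j\<close>, as \<open>qmat_has_sum\<close> shows. The same expression
  governs time derivatives along the flow.\<close>

definition generator_symbol :: "nat ^ 'n \<Rightarrow> real ^ 'n \<Rightarrow> real" where
  "generator_symbol i u = A u * monomial u i + (\<Sum>k\<in>UNIV. real (i $ k) * (B k u * monomial u (i - axis k 1)))"

lemma minus_axis_add:
  fixes i :: "nat ^ 'n" assumes "i $ k \<noteq> 0" shows "i - axis k 1 + axis k 1 = i"
  using assms by (auto simp: vec_eq_iff axis_def)

lemma qmat_has_sum:
  assumes u: "u \<in> unit_cube"
  shows "((\<lambda>j. Q i j * monomial u j) has_sum generator_symbol i u) UNIV"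
proof -
  have "((\<lambda>j. real (i $ k) * ((if i \<le> j + axis k 1 then b k (j + axis k 1 - i) else 0) * monomial u j)) has_sum
       (real (i $ k) * (B k u * monomial u (i - axis k 1)))) UNIV" for k
  proof (cases "i $ k = 0")
    case False
    \<comment> \<open>The branching particle of type \<open>k\<close> is removed before its
      offspring are added. This turns the guarded difference \<open>j + axis k 1 - i\<close> into
      the shift \<open>j - i'\<close>; for \<open>i $ k = 0\<close> the whole term vanishes.\<close>
    define i' where "i' = i - axis k 1"
    have i: "i = i' + axis k 1" unfolding i'_def using minus_axis_add[OF False] by simp
    have 1: "i \<le> j + axis k 1 \<longleftrightarrow> i' \<le> j" for j unfolding i by (auto simp: less_eq_vec_def)
    have 2: "j + axis k 1 - i = j - i'" for j unfolding i by (auto simp: vec_eq_iff)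
    show ?thesis unfolding 1 2 i'_def[symmetric]
      by (intro has_sum_cmult_right shift_has_sum has_sum_genfun[OF b_summable u])
  qed simp
  then have "((\<lambda>j. \<Sum>k\<in>UNIV. real (i $ k) * ((if i \<le> j + axis k 1 then b k (j + axis k 1 - i) else 0) * monomial u j)) has_sum
       (\<Sum>k\<in>UNIV. real (i $ k) * (B k u * monomial u (i - axis k 1)))) UNIV"
    by (intro has_sum_finite_sum) auto
  from has_sum_add[OF this shift_has_sum[OF has_sum_genfun[OF a_summable u], of i]]
  show ?thesis unfolding generator_symbol_def qmat_def
    by (simp add: sum_distrib_right distrib_right mult.assoc add.commute)
qed

section \<open>Generating functions of the transition probabilities\<close>

definition mass0 :: "real \<Rightarrow> real ^ 'n \<Rightarrow> real" where
  "mass0 t u = exp (integral {0..t} (\<lambda>s. A (flow s u)))"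

lemma continuous_on_A_flow: "u \<in> unit_cube \<Longrightarrow> continuous_on {0..} (\<lambda>s. A (flow s u))"
  by (rule continuous_on_compose2[OF continuous_on_genfun[OF a_summable] continuous_on_flow]) (auto intro: flow_cube)

lemma integral_A_derivative:
  "u \<in> unit_cube \<Longrightarrow> 0 \<le> t \<Longrightarrow> ((\<lambda>t. integral {0..t} (\<lambda>s. A (flow s u))) has_real_derivative A (flow t u)) (at t within {0..})"
  by (rule integral_has_real_derivative_atLeast[OF continuous_on_A_flow])

lemma mass0_pos: "0 < mass0 t u" by (simp add: mass0_def)

lemma mass0_le_one: "u \<in> unit_cube \<Longrightarrow> 0 \<le> t \<Longrightarrow> mass0 t u \<le> 1"
proof -
  assume u: "u \<in> unit_cube" and t: "0 \<le> t"
  have "integral {0..t} (\<lambda>s. A (flow s u)) \<le> integral {0..t} (\<lambda>s. 0)"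
    by (rule integral_le) (use u t in \<open>auto intro!: integrable_continuous_real continuous_on_subset[OF continuous_on_A_flow] A_nonpos flow_cube\<close>)
  then show ?thesis by (simp add: mass0_def)
qed

text \<open>By \<open>qmat_has_sum\<close> the derivative is \<open>Q\<close> applied to the
  candidate \<open>mass0 t u * monomial (flow t u)\<close>, so the candidate solves the backward
  equation. At \<open>i = 0\<close> it reduces to \<open>mass0 t u\<close>, which
  \<open>genfun_P\<close> identifies as the generating function of \<open>P t 0\<close>.\<close>

lemma mass0_monomial_derivative:
  assumes u: "u \<in> unit_cube" and t: "0 \<le> t"
  shows "((\<lambda>t. mass0 t u * monomial (flow t u) i) has_real_derivative mass0 t u * generator_symbol i (flow t u)) (at t within {0..})"
proof -
  have "((\<lambda>t. mass0 t u) has_real_derivative mass0 t u * A (flow t u)) (at t within {0..})"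
    unfolding mass0_def by (rule derivative_eq_intros integral_A_derivative[OF u t] refl)+
  from DERIV_mult[OF this monomial_derivative[OF flow_derivative[OF u t], of i]]
  show ?thesis unfolding generator_symbol_def by (simp add: algebra_simps)
qed

text \<open>For the constant vector \<open>x\<close>, the function \<open>1 - x ^ size1 i\<close> is a barrier: it is close to
  its supremum off a finite set, and for \<open>x\<close> near \<open>1\<close> it is almost a supersolution.\<close>

lemma barrier:
  obtains C where "0 \<le> C" and
    "\<And>x i. 0 < x \<Longrightarrow> x < 1 \<Longrightarrow> - generator_symbol i (\<chi> k. x) \<le> - A (\<chi> k. x) + C * (1 - x ^ size1 i)"
proof -
  obtain L where L: "0 \<le> L"
    "\<And>k u v. u \<in> unit_cube \<Longrightarrow> v \<in> unit_cube \<Longrightarrow> \<bar>B k u - B k v\<bar> \<le> L * (\<Sum>l\<in>UNIV. \<bar>u $ l - v $ l\<bar>)"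
    using B_Lipschitz by metis
  define C where "C = L * real CARD('n)"
  show thesis
  proof (rule that)
    show "0 \<le> C" unfolding C_def using L(1) by simp
    fix x :: real and i :: "nat ^ 'n" assume x: "0 < x" "x < 1"
    let ?x = "(\<chi> k. x) :: real ^ 'n"
    have xc: "?x \<in> unit_cube" using x by (auto simp: unit_cube_def)
    \<comment> \<open>Since \<open>B k 1 = 0\<close>, the Lipschitz bound controls the field at
      \<open>?x\<close> by its l1 distance from the corner, which accounts for
      \<open>CARD('n)\<close> in \<open>C\<close>.\<close>
    have Bx: "- B k ?x \<le> C * (1 - x)" for k
      using L(2)[OF xc one_in_unit_cube, of k] x by (simp add: B_one C_def mult.assoc)
    have "- (\<Sum>k\<in>UNIV. real (i $ k) * (B k ?x * monomial ?x (i - axis k 1)))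
        = (\<Sum>k\<in>UNIV. real (i $ k) * (- B k ?x * monomial ?x (i - axis k 1)))" by (simp add: sum_negf)
    also have "\<dots> \<le> (\<Sum>k\<in>UNIV. real (i $ k) * (C * (1 - x) * x ^ (size1 i - 1)))"
    proof (rule sum_mono)
      fix k
      show "real (i $ k) * (- B k ?x * monomial ?x (i - axis k 1)) \<le> real (i $ k) * (C * (1 - x) * x ^ (size1 i - 1))"
      proof (cases "i $ k = 0")
        case False
        have "size1 (i - axis k 1) = size1 i - 1"
          using arg_cong[OF minus_axis_add[OF False], of size1] by simp
        moreover have "- B k ?x * x ^ (size1 i - 1) \<le> C * (1 - x) * x ^ (size1 i - 1)"
          by (rule mult_right_mono[OF Bx]) (use x in auto)
        ultimately show ?thesis unfolding monomial_const by (intro mult_left_mono) simp_all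
      qed simp
    qed
    also have "\<dots> = C * (real (size1 i) * (1 - x) * x ^ (size1 i - 1))"
      by (simp add: size1_def sum_distrib_left sum_distrib_right mult_ac)
    also have "\<dots> \<le> C * (1 - x ^ size1 i)"
    proof (rule mult_left_mono)
      \<comment> \<open>Every term of the geometric sum is at least its last one. After
        multiplication by \<open>1 - x\<close>, the linear growth of the rates is absorbed into
        \<open>1 - x ^ size1 i\<close>, uniformly in \<open>i\<close>.\<close>
      have "real (size1 i) * x ^ (size1 i - 1) \<le> (\<Sum>p<size1 i. x ^ p)"
      proof -
        have "(\<Sum>p<size1 i. x ^ (size1 i - 1)) \<le> (\<Sum>p<size1 i. x ^ p)"
          by (rule sum_mono) (use x in \<open>auto intro!: power_decreasing\<close>)
        then show ?thesis by simp
      qed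
      then have "(1 - x) * (real (size1 i) * x ^ (size1 i - 1)) \<le> (1 - x) * (\<Sum>p<size1 i. x ^ p)"
        using x by (intro mult_left_mono) auto
      then show "real (size1 i) * (1 - x) * x ^ (size1 i - 1) \<le> 1 - x ^ size1 i"
        by (simp add: one_diff_power_eq mult_ac)
    qed (use L C_def in auto)
    finally have 1: "- (\<Sum>k\<in>UNIV. real (i $ k) * (B k ?x * monomial ?x (i - axis k 1))) \<le> C * (1 - x ^ size1 i)" .
    have "- A ?x * monomial ?x i \<le> - A ?x"
      using A_nonpos[OF xc] monomial_cube[OF xc, of i] by (intro mult_left_le) auto
    then show "- generator_symbol i ?x \<le> - A ?x + C * (1 - x ^ size1 i)"
      using 1 unfolding generator_symbol_def by simp
  qed
qed

lemma genfun_P_eq_semi: "genfun (P t i) u = semi (monomial u) t i"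
  by (simp add: genfun_def semi_def)

lemma right_quotient:
  fixes f :: "real \<Rightarrow> real"
  assumes "(f has_real_derivative D) (at t within {0..})" "0 \<le> t"
  shows "((\<lambda>h. (f (t + h) - f t) / h) \<longlongrightarrow> D) (at_right 0)"
proof -
  have "(f has_real_derivative D) (at t within {t<..})"
    by (rule DERIV_subset[OF assms(1)]) (use assms(2) in auto)
  then have "((\<lambda>y. (f y - f t) / (y - t)) \<longlongrightarrow> D) (at_right t)"
    unfolding has_field_derivative_iff .
  then show ?thesis
    by (subst (asm) filterlim_at_right_to_0) (simp add: add.commute)
qed

lemma semi_bounds_monomial: "u \<in> unit_cube \<Longrightarrow> 0 \<le> t \<Longrightarrow> 0 \<le> genfun (P t i) u \<and> genfun (P t i) u \<le> 1"
  unfolding genfun_P_eq_semi by (auto intro: semi_bounds monomial_cube)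

text \<open>Maximum principle for the difference of the process and the candidate against the
  barrier. Off finitely many states the barrier is at least 1, the largest possible difference; at a
  zero of \<open>w\<close> its growth rate outweighs the effect of \<open>Q\<close>. The sign
  \<open>sg\<close> yields both inequalities.\<close>

lemma genfun_P_comparison:
  assumes u: "u \<in> unit_cube" and C: "0 \<le> C"
    "\<And>x i. 0 < x \<Longrightarrow> x < 1 \<Longrightarrow> - generator_symbol i (\<chi> k. x) \<le> - A (\<chi> k. x) + C * (1 - x ^ size1 i)"
    and x: "0 < x" "x < 1" and t: "0 \<le> t" and sg: "sg = 1 \<or> sg = - 1"
  shows "sg * (genfun (P t i) u - mass0 t u * monomial (flow t u) i)
    \<le> 2 * exp (C * t) * (1 - x ^ size1 i + (- A (\<chi> k. x) + (1 - x)) * t + (1 - x))"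
proof -
  let ?x = "(\<chi> k. x) :: real ^ 'n"
  \<comment> \<open>The rate \<open>c\<close> pays for the term \<open>- A ?x\<close> in the barrier
    estimate, and its second summand makes the final inequality strict. Both tend to 0 as
    \<open>x\<close> tends to 1.\<close>
  define c where "c = - A ?x + (1 - x)"
  define y where "y t i = genfun (P t i) u" for t i
  define z where "z t i = mass0 t u * monomial (flow t u) i" for t i
  let ?g = "\<lambda>s i. 1 - x ^ size1 i + c * s + (1 - x)"
  let ?q = "\<lambda>s i. (\<Sum>\<^sub>\<infinity>k. Q i k * y s k) - mass0 s u * generator_symbol i (flow s u)"
  define w where "w t i = 2 * exp (C * t) * ?g t i - sg * (y t i - z t i)" for t i
  have xc: "?x \<in> unit_cube" using x by (auto simp: unit_cube_def)
  have c: "1 - x \<le> c" "0 < c" using A_nonpos[OF xc] x unfolding c_def by auto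
  have y01: "0 \<le> y t i" "y t i \<le> 1" if "0 \<le> t" for t i
    using semi_bounds_monomial[OF u that] by (auto simp: y_def)
  have z01: "0 \<le> z t i" "z t i \<le> 1" if "0 \<le> t" for t i
    using mass0_pos[of t u] mass0_le_one[OF u that] monomial_cube[OF flow_cube[OF u that], of i]
    unfolding z_def by (auto intro!: mult_le_one)
  have yz: "sg * (y t i - z t i) \<le> 1" if "0 \<le> t" for t i using y01[OF that, of i] z01[OF that, of i] sg by auto
  have e1: "1 \<le> exp (C * t)" if "0 \<le> t" for t using C(1) that by simp
  \<comment> \<open>The factor 2 in \<open>w\<close> matches this 1/2: with more than
    \<open>N\<close> particles the barrier is at least 1.\<close>
  obtain N where N: "x ^ N < 1/2" using real_arch_pow_inv[of "1/2" x] x by auto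
  have "0 \<le> w t i"
  proof (rule maximum_principle[where S = "{i. size1 i \<le> N}" and T = t and w = w
      and d = "\<lambda>t i. C * (2 * exp (C * t) * ?g t i) + 2 * exp (C * t) * c
         - sg * ?q t i"])
    show "finite {i :: nat ^ 'n. size1 i \<le> N}" by (rule finite_size1_le)
    show "t \<in> {0..t}" using t by simp
    fix i :: "nat ^ 'n"
    have p1: "x ^ size1 i \<le> 1" using x by (simp add: power_le_one)
    show "0 \<le> w 0 i"
      using p1 x u by (auto simp: w_def y_def z_def genfun_P_eq_semi mass0_def flow_0 semi_def P_0
          if_distrib[of "\<lambda>x. x * _"] infsumI[OF has_sum_single] eq_commute[of i] cong: if_cong)
    show "0 \<le> w s i" if s: "s \<in> {0..t}" and i: "i \<notin> {i. size1 i \<le> N}" for s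
    proof -
      have "x ^ size1 i \<le> x ^ N" using i x by (intro power_decreasing) auto
      moreover have "0 \<le> c * s" using c s by auto
      ultimately have "1/2 \<le> 1 - x ^ size1 i + c * s + (1 - x)" using N x by linarith
      moreover have "1 \<le> exp (C * s)" using e1 s by auto
      ultimately have "1 * (1/2) \<le> exp (C * s) * ?g s i"
        by (intro mult_mono) auto
      then show ?thesis using yz[of s i] s unfolding w_def by simp
    qed
    have ycont: "continuous_on {0..} (\<lambda>t. y t i)"
      unfolding y_def genfun_P_eq_semi by (rule continuous_on_semi) (auto simp: monomial_cube u)
    have zcont: "continuous_on {0..} (\<lambda>t. z t i)"
      unfolding z_def
      by (rule DERIV_continuous_on) (rule mass0_monomial_derivative[OF u], simp)
    show "continuous_on {0..t} (\<lambda>t. w t i)" unfolding w_def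
      by (intro continuous_intros continuous_on_subset[OF ycont] continuous_on_subset[OF zcont]) auto
    show "((\<lambda>h. (w (s + h) i - w s i) / h) \<longlongrightarrow>
       C * (2 * exp (C * s) * ?g s i) + 2 * exp (C * s) * c
         - sg * ?q s i) (at_right 0)"
      if s: "s \<in> {0..<t}" for s
    proof -
      have s0: "0 \<le> s" using s by simp
      have "((\<lambda>s. 2 * exp (C * s) * ?g s i) has_real_derivative
         C * (2 * exp (C * s) * ?g s i) + 2 * exp (C * s) * c) (at s within {0..})"
        by (rule derivative_eq_intros refl)+ (simp add: algebra_simps)
      note l1 = right_quotient[OF this s0]
      have "((\<lambda>h. (semi (y s) h i - y s i) / h) \<longlongrightarrow> (\<Sum>\<^sub>\<infinity>k. Q i k * y s k)) (at_right 0)"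
        by (rule generator) (use y01[OF s0] in auto)
      then have l2: "((\<lambda>h. (y (s + h) i - y s i) / h) \<longlongrightarrow> (\<Sum>\<^sub>\<infinity>k. Q i k * y s k)) (at_right 0)"
      proof (rule Lim_transform_eventually)
        have "semi (y s) h i = y (s + h) i" if "0 < h" for h
          using semi_CK[of "monomial u" h s i] monomial_cube[OF u] that s0
          unfolding y_def genfun_P_eq_semi semi_def by (simp add: infsumI add.commute)
        then show "eventually (\<lambda>h. (semi (y s) h i - y s i) / h = (y (s + h) i - y s i) / h) (at_right 0)"
          using eventually_at_right_less[of 0] by (auto elim: eventually_mono)
      qed
      have l3: "((\<lambda>h. (z (s + h) i - z s i) / h) \<longlongrightarrow> mass0 s u * generator_symbol i (flow s u)) (at_right 0)"
        unfolding z_def by (rule right_quotient[OF mass0_monomial_derivative[OF u s0] s0])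
      have "((\<lambda>h. (2 * exp (C * (s + h)) * (1 - x ^ size1 i + c * (s + h) + (1 - x)) - 2 * exp (C * s) * ?g s i) / h
           - sg * ((y (s + h) i - y s i) / h - (z (s + h) i - z s i) / h)) \<longlongrightarrow>
           C * (2 * exp (C * s) * ?g s i) + 2 * exp (C * s) * c
         - sg * ?q s i) (at_right 0)"
        by (intro tendsto_diff tendsto_mult tendsto_const l1 l2 l3)
      then show ?thesis unfolding w_def
        by (simp add: diff_divide_distrib right_diff_distrib add_divide_distrib algebra_simps)
    qed
    fix s assume s: "s \<in> {0..<t}" and w0: "\<And>k. 0 \<le> w s k" and wi: "w s i = 0"
    have s0: "0 \<le> s" using s by simp
    let ?E = "2 * exp (C * s)"
    have hy: "((\<lambda>k. Q i k * y s k) has_sum (\<Sum>\<^sub>\<infinity>k. Q i k * y s k)) UNIV"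
      by (rule has_sum_infsum[OF Q_y_summable]) (use y01[OF s0] in auto)
    have hz: "((\<lambda>k. Q i k * z s k) has_sum (mass0 s u * generator_symbol i (flow s u))) UNIV"
      unfolding z_def using has_sum_cmult_right[OF qmat_has_sum[OF flow_cube[OF u s0], of i], of "mass0 s u"]
      by (simp add: mult_ac)
    have hx: "((\<lambda>k. Q i k * x ^ size1 k) has_sum generator_symbol i ?x) UNIV"
      using qmat_has_sum[OF xc, of i] by (simp add: monomial_const)
    have "((\<lambda>k. (Q i k * (1 + c * s + (1 - x)) - Q i k * x ^ size1 k) * ?E - sg * (Q i k * y s k - Q i k * z s k)) has_sum
       ((0 * (1 + c * s + (1 - x)) - generator_symbol i ?x) * ?E
         - sg * ?q s i)) UNIV"
      by (rule has_sum_diff_real[OF has_sum_cmult_left[OF has_sum_diff_real[OF has_sum_cmult_left[OF Q_has_sum] hx]]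
             has_sum_cmult_right[OF has_sum_diff_real[OF hy hz]]])
    moreover have "(Q i k * (1 + c * s + (1 - x)) - Q i k * x ^ size1 k) * ?E - sg * (Q i k * y s k - Q i k * z s k) = Q i k * w s k" for k
      unfolding w_def by (simp add: algebra_simps)
    ultimately have hw: "((\<lambda>k. Q i k * w s k) has_sum
       (- generator_symbol i ?x * ?E - sg * ?q s i)) UNIV"
      by simp
    have "0 \<le> - generator_symbol i ?x * ?E - sg * ?q s i"
    proof (rule has_sum_nonneg[OF hw])
      \<comment> \<open>The only possibly negative entry of the row is on the diagonal, where it
        meets \<open>w s i = 0\<close>.\<close>
      show "0 \<le> Q i k * w s k" for k using wi w0[of k] Q_nonneg[of i k] by (cases "k = i") auto
    qed
    moreover have "- generator_symbol i ?x * ?E \<le> (- A ?x + C * (1 - x ^ size1 i)) * ?E"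
      by (intro mult_right_mono C(2) x) auto
    moreover have "0 < ?E * (C * (c * s + (1 - x)) + (1 - x))"
    proof (intro mult_pos_pos add_nonneg_pos mult_nonneg_nonneg add_nonneg_nonneg)
    qed (use C(1) c s0 x in auto)
    ultimately show "0 < C * (2 * exp (C * s) * ?g s i) + 2 * exp (C * s) * c
         - sg * ?q s i"
      unfolding c_def by (simp add: algebra_simps)
  qed
  then show ?thesis unfolding w_def y_def z_def c_def by simp
qed

text \<open>For fixed \<open>i\<close> and \<open>t\<close> the barrier tends to 0 as
  \<open>x\<close> tends to 1, because \<open>A\<close> is continuous on the cube with
  \<open>A 1 = 0\<close>.\<close>

theorem genfun_P:
  assumes u: "u \<in> unit_cube" and t: "0 \<le> t"
  shows "genfun (P t i) u = mass0 t u * monomial (flow t u) i"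
proof -
  obtain C where C: "0 \<le> C"
    "\<And>x i. 0 < x \<Longrightarrow> x < 1 \<Longrightarrow> - generator_symbol i (\<chi> k. x) \<le> - A (\<chi> k. x) + C * (1 - x ^ size1 i)"
    using barrier by metis
  let ?xs = "\<lambda>N. 1 - inverse (real (Suc (Suc N)))"
  have xs: "0 < ?xs N" "?xs N < 1" for N by (auto simp: field_simps)
  have cube: "(\<chi> k. ?xs N) \<in> (unit_cube :: (real ^ 'n) set)" for N
    using xs[of N] unfolding unit_cube_def by (auto simp: less_imp_le)
  have lim1: "?xs \<longlonglongrightarrow> 1 - 0"
    by (intro tendsto_intros LIMSEQ_inverse_real_of_nat[THEN LIMSEQ_Suc])
  have "(\<lambda>N. (\<chi> k. ?xs N) :: real ^ 'n) \<longlonglongrightarrow> 1"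
    by (rule vec_tendstoI) (use lim1 in simp)
  from tendsto_genfun[OF a_summable this cube]
  have lim2: "(\<lambda>N. A (\<chi> k. ?xs N)) \<longlonglongrightarrow> 0" by (simp add: A_one)
  have "sg * (genfun (P t i) u - mass0 t u * monomial (flow t u) i) \<le> 0" if sg: "sg = 1 \<or> sg = - 1" for sg
  proof (rule LIMSEQ_le_const)
    have "(\<lambda>N. 2 * exp (C * t) * (1 - ?xs N ^ size1 i + (- A (\<chi> k. ?xs N) + (1 - ?xs N)) * t + (1 - ?xs N)))
        \<longlonglongrightarrow> 2 * exp (C * t) * (1 - (1 - 0) ^ size1 i + (- 0 + (1 - (1 - 0))) * t + (1 - (1 - 0)))"
      by (intro tendsto_intros lim1 lim2)
    then show "(\<lambda>N. 2 * exp (C * t) * (1 - ?xs N ^ size1 i + (- A (\<chi> k. ?xs N) + (1 - ?xs N)) * t + (1 - ?xs N))) \<longlonglongrightarrow> 0"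
      by simp
    show "\<exists>N0. \<forall>N\<ge>N0. sg * (genfun (P t i) u - mass0 t u * monomial (flow t u) i)
       \<le> 2 * exp (C * t) * (1 - ?xs N ^ size1 i + (- A (\<chi> k. ?xs N) + (1 - ?xs N)) * t + (1 - ?xs N))"
      using genfun_P_comparison[OF u C xs t sg] by blast
  qed
  from this[of 1] this[of "-1"] show ?thesis by simp
qed

end

section \<open>Compactness and summability for the limit of the resolvents\<close>

lemma pointwise_convergent_subsequence:
  fixes c :: "nat \<Rightarrow> 'a::countable \<Rightarrow> real"
  assumes "\<And>N k. \<bar>c N k\<bar> \<le> D k"
  obtains r m where "strict_mono (r :: nat \<Rightarrow> nat)" "\<And>k. (\<lambda>N. c (r N) k) \<longlonglongrightarrow> m k"
proof -
  let ?P = "\<lambda>n s. convergent (\<lambda>N. c (s N) (from_nat n :: 'a))"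
  interpret subseqs ?P
  proof
    fix n and s :: "nat \<Rightarrow> nat" assume "strict_mono s"
    have "bounded (range (\<lambda>N. c (s N) (from_nat n)))"
      using assms by (auto simp: bounded_iff)
    then obtain l r where "strict_mono r" "((\<lambda>N. c (s N) (from_nat n)) \<circ> r) \<longlonglongrightarrow> l"
      using bounded_imp_convergent_subsequence by blast
    then show "\<exists>r'. strict_mono r' \<and> convergent (\<lambda>N. c ((s \<circ> r') N) (from_nat n))"
      by (auto simp: o_def convergent_def)
  qed
  have "convergent (\<lambda>N. c (diagseq N) k)" for k
  proof -
    have "?P n (s \<circ> r)" if "strict_mono r" "?P n s" for n s and r :: "nat \<Rightarrow> nat"
      using convergent_subseq_convergent[OF that(2,1)] by (simp add: o_def)
    from diagseq_holds[OF this, of "to_nat k"]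
    have "convergent (\<lambda>N. c (diagseq (N + Suc (to_nat k))) k)" by (simp add: o_def add.commute)
    then show ?thesis using convergent_ignore_initial_segment by blast
  qed
  then show thesis using that[OF subseq_diagseq, of "\<lambda>k. lim (\<lambda>N. c (diagseq N) k)"]
    by (simp add: convergent_LIMSEQ_iff)
qed

text \<open>A finite set of exponents lies in a box, over which the sum factorises into one finite
  geometric sum per coordinate.\<close>

lemma monomial_summable:
  fixes r :: "real ^ 'n"
  assumes r: "\<And>l. 0 \<le> r $ l" "\<And>l. r $ l < 1"
  shows "(\<lambda>k. monomial r k) summable_on UNIV"
proof (rule nonneg_bdd_above_summable_on)
  show "0 \<le> monomial r k" for k using r by (intro monomial_nonneg)
  show "bdd_above (sum (monomial r) ` {F. F \<subseteq> UNIV \<and> finite F})"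
  proof (rule bdd_aboveI2)
    fix F :: "(nat ^ 'n) set" assume "F \<in> {F. F \<subseteq> UNIV \<and> finite F}"
    then have F: "finite F" by simp
    then obtain R where R: "\<And>k. k \<in> F \<Longrightarrow> size1 k < R"
      by (metis finite_nat_set_iff_bounded finite_imageI imageI)
    have "sum (monomial r) F \<le> sum (monomial r) (vec_lambda ` (UNIV \<rightarrow>\<^sub>E {..<R}))"
    proof (rule sum_mono2)
      show "finite (vec_lambda ` (UNIV \<rightarrow>\<^sub>E {..<R}) :: (nat ^ 'n) set)" by (intro finite_imageI finite_PiE) auto
      show "F \<subseteq> vec_lambda ` (UNIV \<rightarrow>\<^sub>E {..<R})"
      proof
        fix k assume "k \<in> F"
        then have "k $ l < R" for l using R[of k] component_le_size1[of k l] by simp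
        then have "vec_nth k \<in> UNIV \<rightarrow>\<^sub>E {..<R}" by auto
        then show "k \<in> vec_lambda ` (UNIV \<rightarrow>\<^sub>E {..<R})" by (metis image_eqI vec_nth_inverse)
      qed
    qed (use r in \<open>auto intro: monomial_nonneg\<close>)
    also have "\<dots> = (\<Sum>g\<in>UNIV \<rightarrow>\<^sub>E {..<R}. monomial r (vec_lambda g))"
      by (subst sum.reindex) (auto simp: inj_on_def vec_lambda_inject)
    also have "\<dots> = (\<Prod>l\<in>UNIV. \<Sum>p\<in>{..<R}. r $ l ^ p)"
      unfolding monomial_def by (subst prod_sum_PiE) auto
    also have "\<dots> \<le> (\<Prod>l\<in>UNIV. 1 / (1 - r $ l))"
    proof (rule prod_mono, intro conjI)
      fix l
      show "0 \<le> (\<Sum>p\<in>{..<R}. r $ l ^ p)" using r by (intro sum_nonneg) auto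
      show "(\<Sum>p\<in>{..<R}. r $ l ^ p) \<le> 1 / (1 - r $ l)"
        using r[of l] by (simp add: sum_gp_strict divide_right_mono less_imp_neq)
    qed
    finally show "sum (monomial r) F \<le> (\<Prod>l\<in>UNIV. 1 / (1 - r $ l))" .
  qed
qed

locale irreducible_branching = immigration_branching b a P
  for b :: "'n::finite \<Rightarrow> nat ^ 'n \<Rightarrow> real" and a P +
  assumes comm: "communicating P"

section \<open>Semigroup property of the flow and extinction probabilities\<close>

context immigration_branching
begin

lemma genfun_P_has_sum: "0 \<le> t \<Longrightarrow> u \<in> unit_cube \<Longrightarrow> ((\<lambda>j. P t i j * monomial u j) has_sum (mass0 t u * monomial (flow t u) i)) UNIV"
  using has_sum_genfun[OF P_summable, of t u i] by (simp add: genfun_P)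

text \<open>Chapman-Kolmogorov in terms of generating functions. The choice \<open>i = 0\<close>
  isolates \<open>mass0\<close>, and \<open>i = axis k 1\<close> then isolates coordinate
  \<open>k\<close> of the flow, so the semigroup law comes from the process.\<close>

lemma flow_semigroup_aux:
  assumes s: "0 \<le> s" and t: "0 \<le> t" and u: "u \<in> unit_cube"
  shows "mass0 (s + t) u * monomial (flow (s + t) u) i = mass0 t u * (mass0 s (flow t u) * monomial (flow s (flow t u)) i)"
proof -
  have "((\<lambda>k. P s i k * semi (monomial u) t k) has_sum semi (monomial u) (s + t) i) UNIV"
    by (rule semi_CK) (use u s t in \<open>auto simp: monomial_cube\<close>)
  then have "((\<lambda>k. P s i k * (mass0 t u * monomial (flow t u) k)) has_sum (mass0 (s + t) u * monomial (flow (s + t) u) i)) UNIV"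
    using s t u by (simp add: genfun_P_eq_semi[symmetric] genfun_P)
  moreover have "((\<lambda>k. mass0 t u * (P s i k * monomial (flow t u) k)) has_sum
      (mass0 t u * (mass0 s (flow t u) * monomial (flow s (flow t u)) i))) UNIV"
    by (rule has_sum_cmult_right[OF genfun_P_has_sum]) (use s t u in \<open>auto intro: flow_cube\<close>)
  ultimately show ?thesis by (simp add: mult_ac has_sum_unique)
qed

lemma mass0_add:
  assumes "0 \<le> s" "0 \<le> t" "u \<in> unit_cube" shows "mass0 (s + t) u = mass0 t u * mass0 s (flow t u)"
  using flow_semigroup_aux[OF assms, of 0] by simp

lemma flow_add:
  assumes "0 \<le> s" "0 \<le> t" "u \<in> unit_cube" shows "flow (s + t) u = flow s (flow t u)"
proof -
  have "flow (s + t) u $ k = flow s (flow t u) $ k" for k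
    using flow_semigroup_aux[OF assms, of "axis k 1"] mass0_pos[of "s + t" u]
    unfolding mult.assoc[symmetric] mass0_add[OF assms, symmetric] by simp
  then show ?thesis by (simp add: vec_eq_iff)
qed

text \<open>Coordinate \<open>k\<close> is the quotient of the generating functions of
  \<open>P t (axis k 1)\<close> and \<open>P t 0\<close>, and these are continuous on the closed
  cube.\<close>

lemma tendsto_flow:
  assumes t: "0 \<le> t" and f: "(f \<longlongrightarrow> u) F" "\<And>x. f x \<in> unit_cube" "u \<in> unit_cube" "F \<noteq> bot"
  shows "((\<lambda>x. flow t (f x)) \<longlongrightarrow> flow t u) F"
proof (rule vec_tendstoI)
  fix k
  have eq: "flow t v $ k = genfun (P t (axis k 1)) v / genfun (P t 0) v" if "v \<in> unit_cube" for v
    using that t mass0_pos[of t v] by (simp add: genfun_P)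
  have "genfun (P t 0) u \<noteq> 0" using mass0_pos[of t u] t f by (simp add: genfun_P)
  then show "((\<lambda>x. flow t (f x) $ k) \<longlongrightarrow> flow t u $ k) F"
    unfolding eq[OF f(2)] eq[OF f(3)] by (intro tendsto_divide tendsto_genfun P_summable t f)
qed

lemma P_honest: "0 \<le> t \<Longrightarrow> (P t i has_sum 1) UNIV"
proof -
  assume t: "0 \<le> t"
  have "mass0 t 1 = 1"
  proof -
    have "integral {0..t} (\<lambda>s. A (flow s 1)) = integral {0..t} (\<lambda>s. 0)"
      by (rule Henstock_Kurzweil_Integration.integral_cong) (auto simp: flow_one A_one)
    then show ?thesis by (simp add: mass0_def)
  qed
  then show ?thesis using genfun_P_has_sum[OF t one_in_unit_cube, of i] t by (simp add: flow_one)
qed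

text \<open>Multiplied by \<open>exp (death k * t)\<close>, the difference has a derivative
  proportional to \<open>H k (flow t v) - H k (flow t u)\<close>, which is nonnegative. A strict
  inequality in coordinate \<open>k\<close> is therefore never lost in finite time.\<close>

lemma flow_diff_lower:
  assumes u: "u \<in> unit_cube" and v: "v \<in> unit_cube" and uv: "u \<le> v" and t: "0 \<le> t"
  shows "v $ k - u $ k \<le> exp (death k * t) * (flow t v $ k - flow t u $ k)"
proof -
  have "- (exp (death k * t) * (flow t v $ k - flow t u $ k)) \<le> - (exp (death k * 0) * (flow 0 v $ k - flow 0 u $ k))"
  proof (rule deriv_nonpos_imp_le[where S = "{0..}", OF t])
    fix s assume s: "s \<in> {0..t}"
    then have s0: "0 \<le> s" by simp
    show "((\<lambda>t. - (exp (death k * t) * (flow t v $ k - flow t u $ k))) has_real_derivative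
       - (exp (death k * s) * (death k * (flow s v $ k - flow s u $ k) + (B k (flow s v) - B k (flow s u))))) (at s within {0..})"
      by (rule derivative_eq_intros flow_derivative u v s0 refl)+ (simp add: algebra_simps)
    have "H k (flow s u) \<le> H k (flow s v)" by (intro H_mono flow_cube flow_mono u v uv s0)
    then have "0 \<le> death k * (flow s v $ k - flow s u $ k) + (B k (flow s v) - B k (flow s u))"
      unfolding B_eq[OF flow_cube[OF u s0]] B_eq[OF flow_cube[OF v s0]] by (simp add: algebra_simps)
    then show "- (exp (death k * s) * (death k * (flow s v $ k - flow s u $ k) + (B k (flow s v) - B k (flow s u)))) \<le> 0"
      by simp
  qed auto
  then show ?thesis by (simp add: flow_0 u v)
qed

text \<open>\<open>ext t $ k\<close> is the probability that the progeny of one particle of type \<open>k\<close> is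
  extinct at time \<open>t\<close>.\<close>

abbreviation ext :: "real \<Rightarrow> real ^ 'n" where "ext t \<equiv> flow t 0"

lemma ext_cube: "0 \<le> t \<Longrightarrow> ext t \<in> unit_cube" by (rule flow_cube) auto

lemma ext_mono: assumes "0 \<le> s" "s \<le> t" shows "ext s \<le> ext t"
proof -
  have "flow s 0 \<le> flow s (ext (t - s))"
    using assms by (intro flow_mono flow_cube cube_ge_zero) auto
  also have "\<dots> = ext t" using flow_add[of s "t - s" 0] assms by simp
  finally show ?thesis .
qed

lemma P_to_0: "0 \<le> t \<Longrightarrow> P t i 0 = mass0 t 0 * monomial (ext t) i"
  using genfun_P[of 0 t i] by (simp add: genfun_0)

lemma mass0_antimono: assumes "0 \<le> s" "s \<le> t" "u \<in> unit_cube" shows "mass0 t u \<le> mass0 s u"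
proof -
  have "mass0 t u = mass0 s u * mass0 (t - s) (flow s u)"
    using mass0_add[of "t - s" s u] assms by simp
  also have "\<dots> \<le> mass0 s u"
    using assms mass0_pos[of s u] by (intro mult_left_le mass0_le_one flow_cube) auto
  finally show ?thesis .
qed

text \<open>Defined as the limit of \<open>ext\<close>, so that existence of a least zero of
  \<open>B\<close> becomes a consequence: the limit is fixed by the flow, hence a zero, and every
  zero in the cube stops the flow from \<open>0\<close>.\<close>

definition q :: "real ^ 'n" where "q = (\<chi> k. SUP t\<in>{0..}. ext t $ k)"

lemma ext_le_q: "0 \<le> t \<Longrightarrow> ext t \<le> q"
  unfolding q_def less_eq_vec_def
  by (auto intro!: cSUP_upper bdd_aboveI2[where M = 1] simp: unit_cubeD ext_cube)

lemma q_leI: "(\<And>t. 0 \<le> t \<Longrightarrow> ext t \<le> r) \<Longrightarrow> q \<le> r"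
  unfolding q_def less_eq_vec_def by (auto intro!: cSUP_least)

lemma q_cube: "q \<in> unit_cube"
proof -
  have "q \<le> 1" by (rule q_leI) (simp add: cube_le_one ext_cube)
  moreover have "0 \<le> q" using ext_le_q[of 0] by (simp add: flow_0)
  ultimately show ?thesis by (auto simp: unit_cube_def less_eq_vec_def)
qed

lemma less_q: assumes "x < q $ k" obtains t where "0 \<le> t" "x < ext t $ k"
proof -
  have "bdd_above ((\<lambda>t. ext t $ k) ` {0..})"
    by (rule bdd_aboveI2[where M = 1]) (auto simp: unit_cubeD ext_cube)
  then show thesis using assms that less_cSUP_iff[of "{0..}" "\<lambda>t. ext t $ k" x] by (auto simp: q_def)
qed

lemma ext_tendsto_q: "(ext \<longlongrightarrow> q) at_top"
proof (rule vec_tendstoI)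
  fix k
  show "((\<lambda>t. ext t $ k) \<longlongrightarrow> q $ k) at_top"
  proof (rule order_tendstoI)
    fix x assume "x < q $ k"
    then obtain t where t: "0 \<le> t" "x < ext t $ k" by (rule less_q)
    have "x < ext s $ k" if "t \<le> s" for s
      using ext_mono[OF t(1) that] t(2) by (auto simp: less_eq_vec_def intro: less_le_trans)
    then show "eventually (\<lambda>t. x < ext t $ k) at_top" by (auto simp: eventually_at_top_linorder)
  next
    fix x assume "q $ k < x"
    then have "ext s $ k < x" if "0 \<le> s" for s
      using ext_le_q[OF that] by (auto simp: less_eq_vec_def intro: le_less_trans)
    then show "eventually (\<lambda>t. ext t $ k < x) at_top" by (auto simp: eventually_at_top_linorder)
  qed
qed

lemma ext_seq_tendsto_q: "(\<lambda>N. ext (real N)) \<longlonglongrightarrow> q"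
  using filterlim_compose[OF ext_tendsto_q filterlim_real_sequentially] .

lemma flow_q: assumes t: "0 \<le> t" shows "flow t q = q"
proof (rule LIMSEQ_unique)
  show "(\<lambda>N. flow t (ext (real N))) \<longlonglongrightarrow> flow t q"
    by (rule tendsto_flow[OF t ext_seq_tendsto_q]) (auto intro: ext_cube q_cube)
  have "filterlim (\<lambda>N. t + real N) at_top sequentially"
    by (intro filterlim_tendsto_add_at_top[OF tendsto_const] filterlim_real_sequentially)
  from filterlim_compose[OF ext_tendsto_q this]
  show "(\<lambda>N. flow t (ext (real N))) \<longlonglongrightarrow> q" using t by (simp add: flow_add[symmetric])
qed

lemma B_q: "B k q = 0"
proof -
  have "((\<lambda>t. flow t q $ k) has_real_derivative B k (flow 0 q)) (at 0 within {0..})"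
    by (rule flow_derivative[OF q_cube]) simp
  then have "((\<lambda>t. flow t q $ k) has_real_derivative B k q) (at 0 within {0..})"
    by (simp add: flow_0 q_cube)
  then have "((\<lambda>t. q $ k) has_real_derivative B k q) (at 0 within {0..})"
    by (rule has_field_derivative_transform_within[where d = 1]) (auto simp: flow_q flow_0 q_cube)
  then have "((\<lambda>y. 0 / y) \<longlongrightarrow> B k q) (at_right (0::real))"
    unfolding has_field_derivative_iff by (simp add: at_within_Ici_at_right)
  then show ?thesis by (simp add: tendsto_const_iff)
qed

lemma q_least: "is_least_zero b q"
  unfolding is_least_zero_def
proof (intro conjI ballI impI allI q_cube B_q)
  fix r assume "r \<in> unit_cube" "\<forall>k. B k r = 0"
  then show "q \<le> r" by (intro q_leI flow_le) (auto simp: cube_ge_zero)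
qed

end

section \<open>Communication and the construction of the invariant measure\<close>

context irreducible_branching
begin

text \<open>By communication a single particle of type \<open>k\<close> leads to \<open>0\<close>
  with positive probability, which equals \<open>mass0 t 0 * ext t $ k\<close>. The sum of the
  individual times is a common one because \<open>ext\<close> increases.\<close>

lemma ext_pos: obtains T where "0 < T" "\<And>k. 0 < ext T $ k"
proof -
  have "\<exists>t\<ge>0. 0 < ext t $ k" for k
  proof -
    obtain t where t: "0 \<le> t" "0 < P t (axis k 1) 0" using comm unfolding communicating_def by blast
    then show ?thesis using mass0_pos[of t 0] by (auto simp: P_to_0 zero_less_mult_iff)
  qed
  then obtain \<tau> where \<tau>: "\<And>k. 0 \<le> \<tau> k" "\<And>k. 0 < ext (\<tau> k) $ k" by metis
  define T where "T = 1 + (\<Sum>k\<in>UNIV. \<tau> k)"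
  have "\<tau> k \<le> T" for k using member_le_sum[of k UNIV \<tau>] \<tau> by (simp add: T_def)
  then have "0 < ext T $ k" for k
    using ext_mono[OF \<tau>(1)[of k], of T] \<tau>(2)[of k] by (auto simp: less_eq_vec_def intro: less_le_trans)
  moreover have "0 < T" unfolding T_def using sum_nonneg[of UNIV \<tau>] \<tau> by (simp add: add_pos_nonneg)
  ultimately show thesis using that by blast
qed

text \<open>The gain of \<open>ext T\<close> over \<open>0\<close> is carried along the flow by
  \<open>flow_diff_lower\<close>; the lag \<open>T\<close> does not depend on
  \<open>t\<close>.\<close>

lemma ext_less: obtains T where "0 < T" "\<And>k t. T \<le> t \<Longrightarrow> 0 < ext t $ k"
  "\<And>k t. 0 \<le> t \<Longrightarrow> ext t $ k < ext (t + T) $ k"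
proof -
  obtain T where T: "0 < T" "\<And>k. 0 < ext T $ k" using ext_pos by blast
  have "0 < ext t $ k" if "T \<le> t" for t k
    using ext_mono[of T t] T that by (auto simp: less_eq_vec_def intro: less_le_trans)
  moreover have "ext t $ k < ext (t + T) $ k" if t: "0 \<le> t" for t k
  proof -
    have "ext T $ k - 0 $ k \<le> exp (death k * t) * (flow t (ext T) $ k - flow t 0 $ k)"
      by (rule flow_diff_lower) (use t T in \<open>auto intro!: ext_cube cube_ge_zero\<close>)
    then have "0 < exp (death k * t) * (flow t (ext T) $ k - flow t 0 $ k)" using T(2)[of k] by simp
    then show ?thesis using flow_add[of t T 0] t T by (simp add: zero_less_mult_iff)
  qed
  ultimately show thesis using that T by blast
qed

lemma ext_less_q: "0 \<le> t \<Longrightarrow> ext t $ k < q $ k"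
proof -
  assume t: "0 \<le> t"
  obtain T where "0 < T" "\<And>k t. 0 \<le> t \<Longrightarrow> ext t $ k < ext (t + T) $ k" using ext_less by metis
  then show ?thesis using ext_le_q[of "t + T"] t by (auto simp: less_eq_vec_def intro: less_le_trans)
qed

text \<open>A single term of the generating function of \<open>P s k\<close> at \<open>ext T\<close>
  cannot exceed the whole, which is at most \<open>monomial (ext (s + T)) k\<close>. Dividing by the
  positive number \<open>monomial (ext T) j\<close> gives a bound uniform over
  \<open>s \<le> S\<close>.\<close>

lemma P_bound:
  obtains C \<sigma> where "0 \<le> C" "0 \<le> \<sigma>" "\<And>s k. 0 \<le> s \<Longrightarrow> s \<le> S \<Longrightarrow> P s k j \<le> C * monomial (ext \<sigma>) k"
proof -
  obtain T where T: "0 < T" "\<And>k. 0 < ext T $ k" using ext_pos by blast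
  have Tj: "0 < monomial (ext T) j" by (rule monomial_pos[OF T(2)])
  define \<sigma> where "\<sigma> = max S 0 + T"
  show thesis
  proof (rule that[of "1 / monomial (ext T) j" \<sigma>])
    show "0 \<le> \<sigma>" unfolding \<sigma>_def using T by simp
    fix s k assume s: "0 \<le> s" "s \<le> S"
    have Tc: "ext T \<in> unit_cube" using T by (intro ext_cube) auto
    have "P s k j * monomial (ext T) j \<le> mass0 s (ext T) * monomial (flow s (ext T)) k"
      using finite_sum_le_has_sum[OF genfun_P_has_sum[OF s(1) Tc, of k], of "{j}"]
      by (auto simp: P_nonneg s monomial_cube Tc)
    also have "\<dots> \<le> monomial (flow s (ext T)) k"
      using mass0_le_one[OF Tc s(1)] mult_right_mono[of "mass0 s (ext T)" 1] monomial_cube(1)[OF flow_cube[OF Tc s(1)], of k]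
      by auto
    also have "\<dots> \<le> monomial (ext \<sigma>) k"
    proof -
      have "flow s (ext T) = ext (s + T)" using flow_add[of s T 0] s T by simp
      moreover have "ext (s + T) \<le> ext \<sigma>" using s T by (intro ext_mono) (auto simp: \<sigma>_def)
      ultimately show ?thesis
        using s T by (intro monomial_mono) (auto simp: less_eq_vec_def unit_cubeD ext_cube)
    qed
    finally show "P s k j \<le> 1 / monomial (ext T) j * monomial (ext \<sigma>) k"
      using Tj by (simp add: field_simps)
  qed (use Tj in auto)
qed

lemma continuous_on_P: "continuous_on {0..} (\<lambda>t. P t i j)"
proof -
  have "semi (\<lambda>k. if k = j then 1 else 0) t i = P t i j" for t
    using has_sum_single[of j "P t i j"] unfolding semi_def
    by (simp add: if_distrib[of "\<lambda>x. _ * x"] infsumI cong: if_cong)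
  then show ?thesis using continuous_on_semi[of "\<lambda>k. if k = j then 1 else 0" i] by simp
qed

text \<open>The measures \<open>resolvent lam h i\<close> are discretised \<open>lam\<close>-resolvents.  They fail to be
  \<open>lam\<close>-invariant only by the mass seen during the first steps, which becomes negligible,
  compared with the mass at \<open>0\<close>, as the starting state \<open>i\<close> tends to infinity.\<close>

definition resolvent :: "real \<Rightarrow> real \<Rightarrow> nat ^ 'n \<Rightarrow> nat ^ 'n \<Rightarrow> real" where
  "resolvent lam h i k = (\<Sum>\<^sub>\<infinity>n. exp (lam * (real n * h)) * P (real n * h) i k)"

text \<open>Half of the gap between \<open>lam\<close> and \<open>lamZ\<close> is spent on the
  logarithmic convergence; the other half is the rate of a geometric majorant.\<close>

lemma decay_summable:
  assumes decay: "is_decay_parameter P lamZ" and lam: "lam < lamZ" and h: "0 < h" and t: "0 \<le> t"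
  shows "(\<lambda>n. exp (lam * (real n * h)) * P (real n * h + t) i j) summable_on UNIV"
proof -
  define \<epsilon> where "\<epsilon> = (lamZ - lam) / 2"
  have \<epsilon>: "0 < \<epsilon>" using lam by (simp add: \<epsilon>_def)
  have "((\<lambda>t. ln (P t i j) / t) \<longlongrightarrow> - lamZ) at_top" using decay unfolding is_decay_parameter_def by blast
  then have "eventually (\<lambda>t. ln (P t i j) / t < - lamZ + \<epsilon>) at_top"
    by (rule order_tendstoD) (use \<epsilon> in simp)
  then obtain t0 where t0: "\<And>t. t0 \<le> t \<Longrightarrow> ln (P t i j) / t < - lamZ + \<epsilon>"
    by (auto simp: eventually_at_top_linorder)
  \<comment> \<open>Zero values are treated apart, since the convention \<open>ln 0 = 0\<close> says
    nothing about their decay.\<close>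
  have bnd: "P s i j \<le> exp ((\<epsilon> - lamZ) * s)" if s: "max t0 1 \<le> s" for s
  proof (cases "P s i j = 0")
    case False
    then have pos: "0 < P s i j" using P_nonneg[of s i j] s by simp
    have "ln (P s i j) \<le> (\<epsilon> - lamZ) * s" using t0[of s] s by (simp add: field_simps)
    then show ?thesis using pos by (metis exp_le_cancel_iff exp_ln)
  qed simp
  have "summable (\<lambda>n. exp (lam * (real n * h)) * P (real n * h + t) i j)"
  proof (rule summable_comparison_test_ev)
    have "filterlim (\<lambda>n. real n * h) at_top sequentially"
      by (rule filterlim_at_top_mult_tendsto_pos[OF tendsto_const h filterlim_real_sequentially])
    then have "eventually (\<lambda>n. max t0 1 \<le> real n * h) sequentially"
      unfolding filterlim_at_top by blast
    then show "eventually (\<lambda>n. norm (exp (lam * (real n * h)) * P (real n * h + t) i j)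
        \<le> exp ((\<epsilon> - lamZ) * t) * exp (- \<epsilon> * h) ^ n) sequentially"
    proof eventually_elim
      case (elim n)
      have "exp (lam * (real n * h)) * P (real n * h + t) i j \<le> exp (lam * (real n * h)) * exp ((\<epsilon> - lamZ) * (real n * h + t))"
        by (intro mult_left_mono bnd) (use elim t in auto)
      also have "\<dots> = exp ((\<epsilon> - lamZ) * t) * exp (- \<epsilon> * h) ^ n"
        unfolding exp_of_nat_mult[symmetric] exp_add[symmetric]
        by (rule arg_cong[where f = exp]) (simp add: \<epsilon>_def field_simps)
      finally show ?case using P_nonneg[of "real n * h + t" i j] h t by (simp add: abs_mult)
    qed
    show "summable (\<lambda>n. exp ((\<epsilon> - lamZ) * t) * exp (- \<epsilon> * h) ^ n)"
      using \<epsilon> h by (intro summable_mult summable_geometric) auto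
  qed
  then show ?thesis
    using P_nonneg h t by (subst summable_on_UNIV_nonneg_real_iff) auto
qed

text \<open>Multiplication by \<open>P (real r * h)\<close> shifts the skeleton by \<open>r\<close>
  steps: the weights contribute \<open>exp (- lam * (real r * h))\<close> and the first
  \<open>r\<close> terms drop out.\<close>

lemma resolvent_step:
  assumes decay: "is_decay_parameter P lamZ" and lam: "lam < lamZ" and h: "0 < h"
  shows "((\<lambda>k. resolvent lam h i k * P (real r * h) k j) has_sum
     exp (- lam * (real r * h)) * (resolvent lam h i j - (\<Sum>n<r. exp (lam * (real n * h)) * P (real n * h) i j))) UNIV"
proof -
  let ?f = "\<lambda>n. exp (lam * (real n * h)) * P (real n * h) i j"
  let ?s = "real r * h"
  have s0: "0 \<le> ?s" using h by simp
  have f: "(?f has_sum resolvent lam h i j) UNIV"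
    unfolding resolvent_def using decay_summable[OF decay lam h order_refl, of i j] by simp
  have "(?f has_sum (resolvent lam h i j - sum ?f {..<r})) (UNIV - {..<r})"
    by (intro has_sum_Diff f has_sum_finite) auto
  moreover have "UNIV - {..<r} = range ((+) r)"
    by (auto simp: image_iff) (metis add.commute le_iff_add not_less)
  ultimately have "((?f \<circ> (+) r) has_sum (resolvent lam h i j - sum ?f {..<r})) UNIV"
    by (simp add: has_sum_reindex)
  from has_sum_cmult_right[OF this, of "exp (- lam * ?s)"]
  have 1: "((\<lambda>n. exp (lam * (real n * h)) * P (real n * h + ?s) i j) has_sum
      (exp (- lam * ?s) * (resolvent lam h i j - sum ?f {..<r}))) UNIV"
  proof (rule back_subst[where P = "\<lambda>g. (g has_sum _) _"])
    show "(\<lambda>x. exp (- lam * ?s) * (?f \<circ> (+) r) x) = (\<lambda>n. exp (lam * (real n * h)) * P (real n * h + ?s) i j)"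
    proof
      fix n
      have "exp (- lam * ?s) * exp (lam * (real (r + n) * h)) = exp (lam * (real n * h))"
        unfolding exp_add[symmetric] by (rule arg_cong[where f = exp]) (simp add: algebra_simps)
      then show "exp (- lam * ?s) * (?f \<circ> (+) r) n = exp (lam * (real n * h)) * P (real n * h + ?s) i j"
        by (simp add: algebra_simps)
    qed
  qed
  have "((\<lambda>k. \<Sum>\<^sub>\<infinity>n. exp (lam * (real n * h)) * P (real n * h) i k * P ?s k j) has_sum
      (exp (- lam * ?s) * (resolvent lam h i j - sum ?f {..<r}))) UNIV"
  proof (rule has_sum_swap_nonneg(2)[OF _ _ 1])
    show "((\<lambda>k. exp (lam * (real n * h)) * P (real n * h) i k * P ?s k j) has_sum
        (exp (lam * (real n * h)) * P (real n * h + ?s) i j)) UNIV" for n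
      using has_sum_cmult_right[OF P_CK[of "real n * h" ?s i j], of "exp (lam * (real n * h))"] h
      by (simp add: mult.assoc)
  qed (use P_nonneg h in auto)
  moreover have "(\<Sum>\<^sub>\<infinity>n. exp (lam * (real n * h)) * P (real n * h) i k * P ?s k j) = resolvent lam h i k * P ?s k j" for k
    unfolding resolvent_def
    by (rule infsum_cmult_left) (use decay_summable[OF decay lam h order_refl, of i k] in simp)
  ultimately show ?thesis by simp
qed

lemma resolvent_nonneg: "0 < h \<Longrightarrow> 0 \<le> resolvent lam h i k"
  unfolding resolvent_def by (intro infsum_nonneg) (auto simp: P_nonneg)

lemma resolvent_lower:
  assumes "is_decay_parameter P lamZ" "lam < lamZ" "0 < h"
  shows "exp (lam * (real n * h)) * P (real n * h) i k \<le> resolvent lam h i k"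
proof -
  have "(\<lambda>n. exp (lam * (real n * h)) * P (real n * h) i k) summable_on UNIV"
    using decay_summable[OF assms order_refl, of i k] by simp
  from finite_sum_le_has_sum[OF has_sum_infsum[OF this], of "{n}"]
  show ?thesis unfolding resolvent_def using assms(3) by (auto simp: P_nonneg)
qed

lemma monomial_ext_mono: "0 \<le> s \<Longrightarrow> s \<le> t \<Longrightarrow> monomial (ext s) k \<le> monomial (ext t) k"
  using ext_mono[of s t] by (intro monomial_mono) (auto simp: less_eq_vec_def unit_cubeD ext_cube)

text \<open>The window has length one because every mesh \<open>h \<le> 1\<close> has a multiple in
  it.\<close>

lemma P_to_0_lower:
  assumes "0 \<le> \<tau>" "\<tau> \<le> t" "t \<le> \<tau> + 1"
  shows "mass0 (\<tau> + 1) 0 * monomial (ext \<tau>) k \<le> P t k 0"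
  using assms mass0_antimono[of t "\<tau> + 1" 0] monomial_ext_mono[of \<tau> t k] mass0_pos[of t 0]
  by (auto simp: P_to_0 less_imp_le intro!: mult_mono monomial_nonneg unit_cubeD ext_cube)

theorem invariant_measure_exists:
  assumes decay: "is_decay_parameter P lamZ" and lam: "lam \<le> lamZ"
  obtains m where "m 0 = 1" "invariant_for_P lam P m"
proof -
  obtain T where T: "0 < T" "\<And>k t. T \<le> t \<Longrightarrow> 0 < ext t $ k"
    "\<And>k t. 0 \<le> t \<Longrightarrow> ext t $ k < ext (t + T) $ k" using ext_less by metis
  define \<kappa> where "\<kappa> \<tau> = mass0 (\<tau> + 1) 0" for \<tau>
  have \<kappa>: "0 < \<kappa> \<tau>" for \<tau> unfolding \<kappa>_def by (rule mass0_pos)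
  define h where "h N = inverse (real (Suc N))" for N
  define l where "l N = lam - h N" for N
  have h: "0 < h N" "h N \<le> 1" for N by (auto simp: h_def field_simps)
  have l: "l N < lamZ" "\<bar>l N\<bar> \<le> \<bar>lam\<bar> + 1" for N using lam h[of N] unfolding l_def by auto
  have h0: "h \<longlonglongrightarrow> 0" unfolding h_def by (rule LIMSEQ_inverse_real_of_nat)
  have llim: "l \<longlonglongrightarrow> lam" unfolding l_def using tendsto_diff[OF tendsto_const h0, of lam] by simp
  define L where "L = \<bar>lam\<bar> + 1"
  have L0: "0 \<le> L" unfolding L_def by simp
  have lx: "- l N * x \<le> L * y" "l N * x \<le> L * y" if "0 \<le> x" "x \<le> y" for N x y
  proof -
    have "\<bar>l N * x\<bar> \<le> L * y" unfolding abs_mult using l[of N] that L0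
      by (intro mult_mono) (auto simp: L_def)
    then show "- l N * x \<le> L * y" "l N * x \<le> L * y" by auto
  qed
  \<comment> \<open>Any fixed type serves; the starting states consist of \<open>N\<close> particles
    of this type.\<close>
  define k0 :: 'n where "k0 = undefined"
  define i where "i N = (axis k0 N :: nat ^ 'n)" for N
  define G where "G N k = resolvent (l N) (h N) (i N) k" for N k
  define c where "c N k = G N k / G N 0" for N k
  let ?head = "\<lambda>N n j. \<Sum>p<n. exp (l N * (real p * h N)) * P (real p * h N) (i N) j"
  have ceil: "\<exists>n. \<tau> \<le> real n * h N \<and> real n * h N \<le> \<tau> + 1" if "0 \<le> \<tau>" for \<tau> N
  proof (intro exI conjI)
    have 1: "\<tau> / h N \<le> real (nat \<lceil>\<tau> / h N\<rceil>)" and 2: "real (nat \<lceil>\<tau> / h N\<rceil>) \<le> \<tau> / h N + 1"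
      using that h[of N] by (auto simp: of_nat_nat)
    show "\<tau> \<le> real (nat \<lceil>\<tau> / h N\<rceil>) * h N" "real (nat \<lceil>\<tau> / h N\<rceil>) * h N \<le> \<tau> + 1"
      using mult_right_mono[OF 1, of "h N"] mult_right_mono[OF 2, of "h N"] h[of N]
      by (auto simp: distrib_right)
  qed
  have mpos: "0 < monomial (ext \<tau>) k" if "T \<le> \<tau>" for \<tau> k
    by (rule monomial_pos) (use T that in auto)
  \<comment> \<open>One skeleton time between \<open>\<tau>\<close> and \<open>\<tau> + 1\<close>
    suffices to bound the normalising constant from below.\<close>
  have Glow: "exp (- (L * (\<tau> + 1))) * (\<kappa> \<tau> * monomial (ext \<tau>) (i N)) \<le> G N 0" if \<tau>: "T \<le> \<tau>" for \<tau> N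
  proof -
    have \<tau>0: "0 \<le> \<tau>" using \<tau> T by simp
    obtain n where n: "\<tau> \<le> real n * h N" "real n * h N \<le> \<tau> + 1" using ceil[OF \<tau>0] by blast
    have "exp (- (L * (\<tau> + 1))) * (\<kappa> \<tau> * monomial (ext \<tau>) (i N)) \<le> exp (l N * (real n * h N)) * P (real n * h N) (i N) 0"
    proof (rule mult_mono)
      show "exp (- (L * (\<tau> + 1))) \<le> exp (l N * (real n * h N))"
        using lx(1)[of "real n * h N" "\<tau> + 1" N] n h[of N] by simp
      show "\<kappa> \<tau> * monomial (ext \<tau>) (i N) \<le> P (real n * h N) (i N) 0"
        unfolding \<kappa>_def by (rule P_to_0_lower) (use n \<tau>0 in auto)
      show "0 \<le> \<kappa> \<tau> * monomial (ext \<tau>) (i N)" using \<kappa>[of \<tau>] mpos[OF \<tau>, of "i N"] by simp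
    qed simp
    also have "\<dots> \<le> G N 0" unfolding G_def by (rule resolvent_lower[OF decay l(1) h(1)])
    finally show ?thesis .
  qed
  have G0: "0 < G N 0" for N
    using less_le_trans[OF _ Glow[OF order_refl, of N]] \<kappa>[of T] mpos[OF order_refl, of "i N"] by simp
  have Gn: "0 \<le> G N k" for N k unfolding G_def by (rule resolvent_nonneg[OF h(1)])
  have cn: "0 \<le> c N k" for N k unfolding c_def using G0[of N] Gn[of N k] by simp
  define K where "K \<tau> = exp (L * (\<tau> + 1)) / \<kappa> \<tau>" for \<tau>
  have K0: "0 \<le> K \<tau>" for \<tau> unfolding K_def using \<kappa>[of \<tau>] by simp
  \<comment> \<open>Letting the chain run for a time in the window turns mass at \<open>k\<close>
    into mass at \<open>0\<close>, which cannot exceed a multiple of \<open>G N 0\<close>. The bound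
    is uniform in \<open>N\<close> and holds for each \<open>\<tau> \<ge> T\<close>, so
    \<open>\<tau>\<close> may later depend on \<open>s\<close> and \<open>j\<close>.\<close>
  have cK: "c N k \<le> K \<tau> / monomial (ext \<tau>) k" if \<tau>: "T \<le> \<tau>" for \<tau> N k
  proof -
    have \<tau>0: "0 \<le> \<tau>" using \<tau> T by simp
    obtain n where n: "\<tau> \<le> real n * h N" "real n * h N \<le> \<tau> + 1" using ceil[OF \<tau>0] by blast
    have "G N k * (\<kappa> \<tau> * monomial (ext \<tau>) k) \<le> G N k * P (real n * h N) k 0"
      unfolding \<kappa>_def by (intro mult_left_mono P_to_0_lower Gn) (use n \<tau>0 in auto)
    also have "\<dots> \<le> exp (- l N * (real n * h N)) * (G N 0 - ?head N n 0)"
      using finite_sum_le_has_sum[OF resolvent_step[OF decay l(1)[of N] h(1)[of N], of "i N" n 0], of "{k}"]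
        resolvent_nonneg[OF h(1)[of N]] P_nonneg[of "real n * h N"] h(1)[of N] unfolding G_def by simp
    also have "\<dots> \<le> exp (L * (\<tau> + 1)) * G N 0"
    proof (rule mult_mono')
      show "exp (- l N * (real n * h N)) \<le> exp (L * (\<tau> + 1))"
        using lx(1)[of "real n * h N" "\<tau> + 1" N] n h[of N] by simp
      have "0 \<le> ?head N n 0"
        using h(1)[of N] by (intro sum_nonneg) (auto simp: P_nonneg)
      then show "G N 0 - ?head N n 0 \<le> G N 0" by simp
      show "0 \<le> G N 0 - ?head N n 0"
      proof -
        have "(\<lambda>p. exp (l N * (real p * h N)) * P (real p * h N) (i N) 0) summable_on UNIV"
          using decay_summable[OF decay l(1)[of N] h(1)[of N] order_refl, of "i N" 0] by simp
        from finite_sum_le_has_sum[OF has_sum_infsum[OF this], of "{..<n}"] show ?thesis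
          unfolding G_def resolvent_def using h(1)[of N] by (auto simp: P_nonneg)
      qed
    qed auto
    finally have "c N k * (\<kappa> \<tau> * monomial (ext \<tau>) k) \<le> exp (L * (\<tau> + 1))"
      unfolding c_def using G0[of N] by (simp add: field_simps)
    then show ?thesis unfolding K_def using \<kappa>[of \<tau>] mpos[OF \<tau>, of k] by (simp add: field_simps)
  qed
  obtain r m where r: "strict_mono (r :: nat \<Rightarrow> nat)" and m: "\<And>k. (\<lambda>N. c (r N) k) \<longlonglongrightarrow> m k"
    using pointwise_convergent_subsequence[of c "\<lambda>k. K T / monomial (ext T) k"] cn cK[OF order_refl]
    by (metis abs_of_nonneg)
  have sub: "(\<lambda>N. f (r N)) \<longlonglongrightarrow> x" if "f \<longlonglongrightarrow> x" for f :: "nat \<Rightarrow> real" and x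
    using LIMSEQ_subseq_LIMSEQ[OF that r] by (simp add: o_def)
  have m0: "m 0 = 1"
  proof (rule LIMSEQ_unique[OF m])
    have "c N 0 = 1" for N unfolding c_def using G0[of N] by simp
    then show "(\<lambda>N. c (r N) 0) \<longlonglongrightarrow> 1" by simp
  qed
  have mn: "0 \<le> m k" for k by (rule LIMSEQ_le_const[OF m]) (use cn in auto)
  have inv: "((\<lambda>k. m k * P s k j) has_sum (exp (- lam * s) * m j)) UNIV" if s: "0 \<le> s" for s j
  proof -
    obtain C \<sigma>0 where C: "0 \<le> C" "0 \<le> \<sigma>0" "\<And>t k. 0 \<le> t \<Longrightarrow> t \<le> s \<Longrightarrow> P t k j \<le> C * monomial (ext \<sigma>0) k"
      using P_bound[of s j] by metis
    \<comment> \<open>The lag \<open>T\<close> between \<open>\<sigma>\<close> and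
      \<open>\<tau>\<close> makes every coordinate of the quotient of \<open>ext \<sigma>\<close> by
      \<open>ext \<tau>\<close> smaller than 1; the maximum with \<open>T\<close> keeps both vectors
      positive.\<close>
    define \<sigma> where "\<sigma> = max \<sigma>0 T"
    define \<tau> where "\<tau> = \<sigma> + T"
    have \<sigma>: "0 \<le> \<sigma>" "T \<le> \<tau>" "T \<le> \<sigma>" "0 \<le> \<tau>" using C T unfolding \<sigma>_def \<tau>_def by auto
    have C\<sigma>: "P t k j \<le> C * monomial (ext \<sigma>) k" if "0 \<le> t" "t \<le> s" for t k
      using C(3)[OF that, of k] mult_left_mono[OF monomial_ext_mono[of \<sigma>0 \<sigma> k] C(1)] C(2) unfolding \<sigma>_def by linarith
    have ratio: "0 < ext \<tau> $ k" "0 \<le> ext \<sigma> $ k / ext \<tau> $ k" "ext \<sigma> $ k / ext \<tau> $ k < 1" for k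
      using T(2)[OF \<sigma>(2), of k] T(2)[OF \<sigma>(3), of k] T(3)[OF \<sigma>(1), of k] unfolding \<tau>_def by auto
    have mratio: "monomial (ext \<sigma>) k / monomial (ext \<tau>) k = monomial (\<chi> k. ext \<sigma> $ k / ext \<tau> $ k) k" for k
      unfolding monomial_def by (simp add: power_divide prod_dividef)
    have msum: "(\<lambda>k. monomial (ext \<sigma>) k / monomial (ext \<tau>) k) summable_on UNIV"
      unfolding mratio by (rule monomial_summable) (use ratio in auto)
    \<comment> \<open>\<open>s\<close> is approached from below by skeleton times, so that
      \<open>C\<sigma>\<close>, valid for times up to \<open>s\<close>, applies.\<close>
    define n where "n N = nat \<lfloor>s / h N\<rfloor>" for N
    define t where "t N = real (n N) * h N" for N
    have t: "0 \<le> t N" "t N \<le> s" "s - h N \<le> t N" for N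
    proof -
      have n1: "real (n N) \<le> s / h N" "s / h N - 1 \<le> real (n N)"
        unfolding n_def using s h[of N] by (auto simp: of_nat_nat)
      show "0 \<le> t N" unfolding t_def using h[of N] by simp
      have "real (n N) * h N \<le> s / h N * h N" using n1 h[of N] by (intro mult_right_mono) auto
      then show "t N \<le> s" unfolding t_def using h[of N] by simp
      have "(s / h N - 1) * h N \<le> real (n N) * h N" using n1 h[of N] by (intro mult_right_mono) auto
      then show "s - h N \<le> t N" unfolding t_def using h[of N] by (simp add: left_diff_distrib)
    qed
    have tlim: "t \<longlonglongrightarrow> s"
    proof (rule tendsto_sandwich[OF _ _ _ tendsto_const])
      show "(\<lambda>N. s - h N) \<longlonglongrightarrow> s" using tendsto_diff[OF tendsto_const h0, of s] by simp
    qed (use t in auto)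
    have Plim: "(\<lambda>N. P (t N) k j) \<longlonglongrightarrow> P s k j" for k
      using continuous_on_P[of k j] tlim t(1) s unfolding continuous_on_sequentially
      by (auto simp: o_def)
    have 1: "(\<lambda>k. m k * P s k j) summable_on UNIV"
      and 2: "(\<lambda>N. \<Sum>\<^sub>\<infinity>k. c (r N) k * P (t (r N)) k j) \<longlonglongrightarrow> (\<Sum>\<^sub>\<infinity>k. m k * P s k j)"
    proof -
      have dom: "eventually (\<lambda>N. \<forall>k. \<bar>c (r N) k * P (t (r N)) k j\<bar> \<le> K \<tau> * C * (monomial (ext \<sigma>) k / monomial (ext \<tau>) k)) sequentially"
      proof (intro always_eventually allI)
        fix N k
        have "\<bar>c (r N) k * P (t (r N)) k j\<bar> = c (r N) k * P (t (r N)) k j"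
          using cn P_nonneg t by simp
        also have "\<dots> \<le> (K \<tau> / monomial (ext \<tau>) k) * (C * monomial (ext \<sigma>) k)"
          by (intro mult_mono cK C\<sigma> t \<sigma> cn P_nonneg divide_nonneg_pos K0 mpos)
        finally show "\<bar>c (r N) k * P (t (r N)) k j\<bar> \<le> K \<tau> * C * (monomial (ext \<sigma>) k / monomial (ext \<tau>) k)"
          by simp
      qed
      have lim: "(\<lambda>N. c (r N) k * P (t (r N)) k j) \<longlonglongrightarrow> m k * P s k j" for k
        by (intro tendsto_mult m sub[OF Plim])
      note dc = tendsto_infsum_dominated[OF lim dom summable_on_cmult_right[OF msum] sequentially_bot]
      show "(\<lambda>k. m k * P s k j) summable_on UNIV" by (rule dc(1))
      show "(\<lambda>N. \<Sum>\<^sub>\<infinity>k. c (r N) k * P (t (r N)) k j) \<longlonglongrightarrow> (\<Sum>\<^sub>\<infinity>k. m k * P s k j)" by (rule dc(2))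
    qed
    \<comment> \<open>The discarded head has at most \<open>s * (N + 1)\<close> terms, each at most
      a multiple of \<open>monomial (ext \<sigma>) (i N)\<close>, while \<open>G N 0\<close> is at
      least a multiple of \<open>monomial (ext \<tau>) (i N)\<close>. As \<open>i N\<close> is
      \<open>N\<close> times a unit vector, the ratio of the monomials is
      \<open>\<rho> ^ N\<close>.\<close>
    define err where "err N = ?head N (n N) j / G N 0" for N
    have eq: "(\<Sum>\<^sub>\<infinity>k. c N k * P (t N) k j) = exp (- l N * t N) * (c N j - err N)" for N
    proof -
      have "((\<lambda>k. G N k * P (t N) k j * (1 / G N 0)) has_sum
        (exp (- l N * t N) * (G N j - ?head N (n N) j)) * (1 / G N 0)) UNIV"
        unfolding G_def t_def by (intro has_sum_cmult_left resolvent_step[OF decay l(1) h(1)])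
      from infsumI[OF this] show ?thesis unfolding c_def err_def diff_divide_distrib[symmetric] by simp
    qed
    define \<rho> where "\<rho> = ext \<sigma> $ k0 / ext \<tau> $ k0"
    define Z where "Z = s * exp (L * s) * C / (exp (- (L * (\<tau> + 1))) * \<kappa> \<tau>)"
    have err: "0 \<le> err N" "err N \<le> Z * (real (Suc N) * \<rho> ^ N)" for N
    proof -
      have ti: "real p * h N \<le> s" if "p < n N" for p
      proof -
        have "real p * h N \<le> real (n N) * h N" using that h[of N] by (intro mult_right_mono) auto
        then show ?thesis using t(2)[of N] unfolding t_def by simp
      qed
      show "0 \<le> err N" unfolding err_def using G0[of N] h(1)[of N]
        by (intro divide_nonneg_pos sum_nonneg) (auto simp: P_nonneg)
      have "?head N (n N) j \<le> (\<Sum>p<n N. exp (L * s) * (C * monomial (ext \<sigma>) (i N)))"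
        using ti h(1)[of N] by (intro sum_mono mult_mono C\<sigma>) (auto intro!: lx P_nonneg)
      also have "\<dots> = real (n N) * (exp (L * s) * (C * monomial (ext \<sigma>) (i N)))" by simp
      also have "\<dots> \<le> (s * real (Suc N)) * (exp (L * s) * (C * monomial (ext \<sigma>) (i N)))"
      proof (rule mult_right_mono)
        have "real (n N) \<le> s / h N" unfolding n_def using s h[of N] by (auto simp: of_nat_nat)
        then show "real (n N) \<le> s * real (Suc N)" by (simp add: h_def divide_inverse)
        show "0 \<le> exp (L * s) * (C * monomial (ext \<sigma>) (i N))"
          using C monomial_nonneg[of "ext \<sigma>" "i N"] \<sigma> by (simp add: unit_cubeD ext_cube)
      qed
      finally have num: "?head N (n N) j
          \<le> (s * real (Suc N)) * (exp (L * s) * (C * monomial (ext \<sigma>) (i N)))" .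
      have "err N \<le> (s * real (Suc N)) * (exp (L * s) * (C * monomial (ext \<sigma>) (i N))) /
          (exp (- (L * (\<tau> + 1))) * (\<kappa> \<tau> * monomial (ext \<tau>) (i N)))"
        unfolding err_def
      proof (rule frac_le[OF _ num _ Glow[OF \<sigma>(2)]])
        show "0 < exp (- (L * (\<tau> + 1))) * (\<kappa> \<tau> * monomial (ext \<tau>) (i N))" using \<kappa> mpos[OF \<sigma>(2)] by simp
        show "0 \<le> (s * real (Suc N)) * (exp (L * s) * (C * monomial (ext \<sigma>) (i N)))"
          using C s monomial_nonneg[of "ext \<sigma>" "i N"] \<sigma> by (simp add: unit_cubeD ext_cube)
      qed
      also have "\<dots> = Z * (real (Suc N) * (monomial (ext \<sigma>) (i N) / monomial (ext \<tau>) (i N)))"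
        unfolding Z_def by (simp add: field_simps)
      also have "monomial (ext \<sigma>) (i N) / monomial (ext \<tau>) (i N) = \<rho> ^ N"
        unfolding i_def \<rho>_def by (simp add: power_divide)
      finally show "err N \<le> Z * (real (Suc N) * \<rho> ^ N)" .
    qed
    have errlim: "err \<longlonglongrightarrow> 0"
    proof (rule tendsto_sandwich[OF _ _ tendsto_const])
      have \<rho>: "norm \<rho> < 1" using ratio(2,3)[of k0] unfolding \<rho>_def real_norm_def by linarith
      have "(\<lambda>N. Z * (real N * \<rho> ^ N + \<rho> ^ N)) \<longlonglongrightarrow> Z * (0 + 0)"
        using \<rho> by (intro tendsto_mult tendsto_add tendsto_const powser_times_n_limit_0 LIMSEQ_power_zero) auto
      then show "(\<lambda>N. Z * (real (Suc N) * \<rho> ^ N)) \<longlonglongrightarrow> 0" by (simp add: distrib_right add.commute)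
    qed (use err in auto)
    have "(\<lambda>N. exp (- l (r N) * t (r N)) * (c (r N) j - err (r N))) \<longlonglongrightarrow> exp (- lam * s) * (m j - 0)"
      by (intro tendsto_intros sub[OF llim] sub[OF tlim] sub[OF errlim] m)
    then have "(\<Sum>\<^sub>\<infinity>k. m k * P s k j) = exp (- lam * s) * m j"
      using LIMSEQ_unique[OF 2] unfolding eq by simp
    with 1 show ?thesis by (metis has_sum_infsum)
  qed
  \<comment> \<open>Communication transports the unit mass at \<open>0\<close> to
    \<open>j\<close>.\<close>
  have "0 < m j" for j
  proof -
    obtain s where s: "0 \<le> s" "0 < P s 0 j" using comm unfolding communicating_def by blast
    have "m 0 * P s 0 j \<le> exp (- lam * s) * m j"
      using finite_sum_le_has_sum[OF inv[OF s(1)], of "{0}"] mn P_nonneg[OF s(1)] by auto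
    then have "0 < exp (- lam * s) * m j" using s m0 by simp
    then show ?thesis by (simp add: zero_less_mult_iff)
  qed
  then have "invariant_for_P lam P m" unfolding invariant_for_P_def using inv by auto
  with m0 show thesis by (rule that)
qed

section \<open>Consequences of invariance: the equation for Q and the differential equation\<close>

context
  fixes lam :: real and m :: "nat ^ 'n \<Rightarrow> real"
  assumes inv: "invariant_for_P lam P m"
begin

lemma m_pos: "0 < m i"
  and m_inv: "0 \<le> t \<Longrightarrow> ((\<lambda>i. m i * P t i j) has_sum (exp (- lam * t) * m j)) UNIV"
  using inv unfolding invariant_for_P_def by auto

text \<open>Invariance in column \<open>0\<close>, where
  \<open>P t k 0 = mass0 t 0 * monomial (ext t) k\<close>. It evaluates the generating function of
  \<open>m\<close> exactly along \<open>ext\<close>, which settles convergence below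
  \<open>q\<close> and later the criterion for finite mass.\<close>

lemma m_ext_has_sum:
  assumes "0 \<le> t"
  shows "((\<lambda>k. m k * monomial (ext t) k) has_sum (exp (- lam * t) * m 0 / mass0 t 0)) UNIV"
proof -
  have "((\<lambda>k. m k * P t k 0 * (1 / mass0 t 0)) has_sum (exp (- lam * t) * m 0 * (1 / mass0 t 0))) UNIV"
    by (rule has_sum_cmult_left[OF m_inv[OF assms]])
  then show ?thesis using mass0_pos[of t 0] assms by (simp add: P_to_0)
qed

lemma below_q_conv_domain: "{u \<in> unit_cube. \<forall>k. u $ k < q $ k} \<subseteq> conv_domain m"
proof clarify
  fix u assume u: "u \<in> unit_cube" "\<forall>k. u $ k < q $ k"
  then have "\<exists>t\<ge>0. u $ k < ext t $ k" for k using less_q[of "u $ k" k] by blast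
  then obtain \<tau> where \<tau>: "\<And>k. 0 \<le> \<tau> k" "\<And>k. u $ k < ext (\<tau> k) $ k" by metis
  define t where "t = (\<Sum>k\<in>UNIV. \<tau> k)"
  have t: "0 \<le> t" "\<tau> k \<le> t" for k using \<tau> unfolding t_def by (auto intro!: sum_nonneg member_le_sum)
  have "u $ k \<le> ext t $ k" for k
    using ext_mono[OF \<tau>(1) t(2), of k] \<tau>(2)[of k] by (auto simp: less_eq_vec_def intro: order_trans less_imp_le)
  then have "(\<lambda>k. m k * monomial u k) summable_on UNIV"
    using u m_pos
    by (intro summable_on_le[OF has_sum_imp_summable[OF m_ext_has_sum[OF t(1)]]])
       (auto simp: abs_mult less_imp_le monomial_cube intro!: mult_left_mono monomial_mono unit_cubeD)
  then show "u \<in> conv_domain m" unfolding conv_domain_def by simp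
qed

text \<open>A single term of the generating function is compared with the whole at the vector with
  all entries \<open>t\<close>. In time \<open>t\<close> the flow moves this vector up by at most
  \<open>O(t)\<close>, so the choice balances both effects and gives order
  \<open>size1 i - size1 j\<close> in \<open>t\<close>.\<close>

lemma P_small_time:
  obtains D where "0 < D" "\<And>t i j. 0 < t \<Longrightarrow> t \<le> 1 \<Longrightarrow> P t i j * t ^ size1 j \<le> (D * t) ^ size1 i"
proof -
  define D where "D = 1 + (\<Sum>k\<in>UNIV. death k)"
  have D: "0 < D" "1 + death k \<le> D" for k
    using member_le_sum[of k UNIV death] sum_nonneg[of UNIV death] death_pos
    unfolding D_def by (auto simp: less_imp_le add_pos_nonneg)
  show thesis
  proof (rule that[OF D(1)])
    fix t :: real and i j :: "nat ^ 'n" assume t: "0 < t" "t \<le> 1"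
    let ?u = "(\<chi> k. t) :: real ^ 'n"
    have u: "?u \<in> unit_cube" using t by (simp add: unit_cube_def)
    have t0: "0 \<le> t" using t by simp
    have "P t i j * monomial ?u j \<le> mass0 t ?u * monomial (flow t ?u) i"
      using finite_sum_le_has_sum[OF genfun_P_has_sum[OF t0 u, of i], of "{j}"]
      by (auto simp: P_nonneg t0 monomial_cube u)
    also have "\<dots> \<le> 1 * monomial (flow t ?u) i"
      by (intro mult_right_mono mass0_le_one u t0 monomial_cube flow_cube)
    also have "\<dots> \<le> 1 * monomial (\<chi> k. D * t) i"
    proof (intro mult_left_mono monomial_mono)
      fix k
      show "0 \<le> flow t ?u $ k" by (intro unit_cubeD flow_cube u t0)
      have "flow t ?u $ k \<le> t + death k * t" using flow_le_linear[OF u t0, of k] by simp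
      also have "\<dots> \<le> D * t" using mult_right_mono[OF D(2)[of k] t0] by (simp add: algebra_simps)
      finally show "flow t ?u $ k \<le> (\<chi> k. D * t) $ k" by simp
    qed simp
    finally show "P t i j * t ^ size1 j \<le> (D * t) ^ size1 i" by (simp add: monomial_const)
  qed
qed

text \<open>A jump lowers \<open>size1\<close> by at most one, so column \<open>j\<close> of \<open>Q\<close> is finite; the remaining
  entries of the column of \<open>P t\<close> contribute \<open>O(t\<^sup>2)\<close> to the invariance equation.\<close>

lemma invariant_Q: "invariant_for_Q lam (qmat a b) m"
  unfolding invariant_for_Q_def
proof (intro conjI allI m_pos)
  fix j :: "nat ^ 'n"
  define T where "T = {i :: nat ^ 'n. size1 i \<le> size1 j + 1}"
  have T: "finite T" "j \<in> T" unfolding T_def by (auto intro: finite_size1_le)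
  obtain D where D: "0 < D" "\<And>t i j. 0 < t \<Longrightarrow> t \<le> 1 \<Longrightarrow> P t i j * t ^ size1 j \<le> (D * t) ^ size1 i"
    using P_small_time by metis
  obtain T0 where T0: "0 < T0" "\<And>k. 0 < ext T0 $ k" using ext_pos by blast
  \<comment> \<open>A constant vector below \<open>ext T0\<close>, hence a point where the
    generating function of \<open>m\<close> converges; it supplies summable weights for the
    tail.\<close>
  define e where "e = Min (range (\<lambda>k. ext T0 $ k))"
  have e: "0 < e" "e \<le> ext T0 $ k" for k unfolding e_def using T0 by auto
  define S where "S = (\<Sum>\<^sub>\<infinity>i. m i * e ^ size1 i)"
  have S: "((\<lambda>i. m i * e ^ size1 i) has_sum S) UNIV"
    unfolding S_def
  proof (intro has_sum_infsum summable_on_le[OF has_sum_imp_summable[OF m_ext_has_sum]])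
    show "0 \<le> T0" using T0 by simp
    show "\<bar>m i * e ^ size1 i\<bar> \<le> m i * monomial (ext T0) i" for i
      using m_pos[of i] e monomial_mono[of "\<chi> k. e" "ext T0" i]
      by (auto simp: abs_mult monomial_const less_imp_le)
  qed
  \<comment> \<open>The least size outside \<open>T\<close>: after cancelling
    \<open>t ^ size1 j\<close> in the short-time bound, a factor \<open>t\<^sup>2\<close>
    remains.\<close>
  define M where "M = size1 j + 2"
  define R where "R t = exp (- lam * t) * m j - (\<Sum>i\<in>T. m i * P t i j)" for t
  have R: "0 \<le> R t" "R t \<le> S * (D / e) ^ M * t\<^sup>2" if t: "0 < t" "t \<le> 1" "D * t \<le> e" for t
  proof -
    have Rs: "((\<lambda>i. m i * P t i j) has_sum R t) (UNIV - T)"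
      unfolding R_def by (intro has_sum_Diff m_inv has_sum_finite T) (use t in auto)
    show "0 \<le> R t" by (rule has_sum_nonneg[OF Rs]) (use t in \<open>auto intro!: mult_nonneg_nonneg less_imp_le[OF m_pos] P_nonneg\<close>)
    have "((\<lambda>i. m i * e ^ size1 i * ((D / e) ^ M * t\<^sup>2)) has_sum (S * ((D / e) ^ M * t\<^sup>2))) UNIV"
      by (rule has_sum_cmult_left[OF S])
    then have "R t \<le> S * ((D / e) ^ M * t\<^sup>2)"
    proof (rule has_sum_mono_neutral[OF Rs])
      fix i assume "i \<in> (UNIV - T) \<inter> UNIV"
      then have i: "M \<le> size1 i" unfolding T_def M_def by auto
      have "P t i j * t ^ size1 j \<le> (D * t) ^ size1 i" by (rule D(2)) (use t in auto)
      also have "\<dots> = e ^ size1 i * (D * t / e) ^ size1 i"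
        using e(1) by (simp add: power_mult_distrib power_divide)
      also have "\<dots> \<le> e ^ size1 i * (D * t / e) ^ M"
        using i e(1) t D(1) by (intro mult_left_mono power_decreasing) auto
      also have "\<dots> = e ^ size1 i * ((D / e) ^ M * t\<^sup>2) * t ^ size1 j"
        unfolding M_def by (simp add: power_add power_mult_distrib power_divide power2_eq_square)
      finally have "P t i j \<le> e ^ size1 i * ((D / e) ^ M * t\<^sup>2)"
        using t by (simp add: mult_right_le_imp_le)
      then show "m i * P t i j \<le> m i * e ^ size1 i * ((D / e) ^ M * t\<^sup>2)"
        using m_pos[of i] by (simp add: mult.assoc)
    next
      show "0 \<le> m i * e ^ size1 i * ((D / e) ^ M * t\<^sup>2)" for i
        using e D(1) by (intro mult_nonneg_nonneg less_imp_le[OF m_pos]) auto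
    qed auto
    then show "R t \<le> S * (D / e) ^ M * t\<^sup>2" by (simp add: mult.assoc)
  qed
  have ev: "eventually (\<lambda>t. 0 < t \<and> t \<le> 1 \<and> D * t \<le> e) (at_right 0)"
    unfolding eventually_at_right_field
    by (rule exI[of _ "min 1 (e / D)"]) (use e(1) D(1) in \<open>auto simp: field_simps\<close>)
  have R0: "((\<lambda>t. R t / t) \<longlongrightarrow> 0) (at_right 0)"
  proof (rule tendsto_sandwich[OF _ _ tendsto_const])
    show "eventually (\<lambda>t. 0 \<le> R t / t) (at_right 0)"
      using ev by eventually_elim (use R in auto)
    show "eventually (\<lambda>t. R t / t \<le> S * (D / e) ^ M * t) (at_right 0)"
      using ev
    proof eventually_elim
      case (elim t)
      then have "R t / t \<le> S * (D / e) ^ M * t\<^sup>2 / t" by (intro divide_right_mono R) auto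
      then show ?case using elim by (simp add: power2_eq_square)
    qed
    have "((\<lambda>t. S * (D / e) ^ M * t) \<longlongrightarrow> S * (D / e) ^ M * 0) (at_right 0)"
      by (intro tendsto_intros)
    then show "((\<lambda>t. S * (D / e) ^ M * t) \<longlongrightarrow> 0) (at_right 0)" by simp
  qed
  have "((\<lambda>t. exp (- lam * t)) has_real_derivative - lam) (at 0 within {0..})"
    by (auto intro!: derivative_eq_intros)
  from right_quotient[OF this]
  have "((\<lambda>t. (exp (- lam * t) - 1) / t * m j) \<longlongrightarrow> - lam * m j) (at_right 0)"
    by (intro tendsto_intros) simp
  moreover have "((\<lambda>t. (\<Sum>i\<in>T. m i * ((P t i j - (if i = j then 1 else 0)) / t)) + R t / t) \<longlongrightarrow> (\<Sum>i\<in>T. m i * Q i j) + 0) (at_right 0)"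
    by (intro tendsto_add tendsto_sum tendsto_mult tendsto_const P_deriv R0)
  moreover have "(\<Sum>i\<in>T. m i * ((P t i j - (if i = j then 1 else 0)) / t)) + R t / t = (exp (- lam * t) - 1) / t * m j" for t
  proof -
    have "(\<Sum>i\<in>T. m i * ((P t i j - (if i = j then 1 else 0)) / t)) = (\<Sum>i\<in>T. m i * P t i j / t) - (\<Sum>i\<in>T. if i = j then m i / t else 0)"
      by (subst sum_subtractf[symmetric], rule sum.cong) (auto simp: diff_divide_distrib right_diff_distrib)
    also have "(\<Sum>i\<in>T. if i = j then m i / t else 0) = m j / t" using T by simp
    finally show ?thesis unfolding R_def
      by (simp add: diff_divide_distrib sum_divide_distrib left_diff_distrib)
  qed
  ultimately have "- lam * m j = (\<Sum>i\<in>T. m i * Q i j)"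
    using tendsto_unique[OF trivial_limit_at_right_real] by fastforce
  moreover have "Q i j = 0" if "i \<notin> T" for i
  proof -
    have "\<not> i \<le> j + axis k 1" for k using that size1_mono[of i "j + axis k 1"] unfolding T_def by auto
    moreover have "\<not> i \<le> j" using that size1_mono[of i j] unfolding T_def by auto
    ultimately show ?thesis unfolding qmat_def by simp
  qed
  ultimately show "((\<lambda>i. m i * Q i j) has_sum (- lam * m j)) UNIV"
    by (intro has_sum_finite_neutralI[OF T(1)]) auto
qed

lemma Q_diag: "\<bar>Q i i\<bar> \<le> (\<Sum>k\<in>UNIV. death k * real (i $ k)) + \<bar>a 0\<bar>"
proof -
  have "i \<le> i + axis k 1" "i + axis k 1 - i = axis k 1" for k by (auto simp: less_eq_vec_def vec_eq_iff)
  then have "Q i i = - (\<Sum>k\<in>UNIV. death k * real (i $ k)) + a 0"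
    unfolding qmat_def death_def by (simp add: sum_negf mult.commute)
  moreover have "0 \<le> (\<Sum>k\<in>UNIV. death k * real (i $ k))"
    by (intro sum_nonneg mult_nonneg_nonneg) (auto simp: less_imp_le[OF death_pos])
  ultimately show ?thesis by linarith
qed

text \<open>The double sum of \<open>m i * Q i j * monomial u j\<close> is evaluated by rows through
  \<open>generator_symbol\<close> and by columns through invariance. The negative diagonal prevents
  a direct exchange, so \<open>\<bar>Q i i\<bar>\<close> is added and later cancelled; at an
  interior point the first derivatives converge and make the added part summable.\<close>

lemma pde:
  assumes u: "u \<in> unit_cube" and int: "u \<in> interior (conv_domain m)"
  shows "satisfies_pde_at a b lam m u"
proof -
  let ?d = "\<lambda>k i. real (i $ k) * monomial u (i - axis k 1)"
  define D where "D k = (\<Sum>\<^sub>\<infinity>i. m i * ?d k i)" for k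
  have partial: "has_partial (genfun m) (D k) k u \<and> (\<lambda>i. m i * ?d k i) summable_on UNIV" for k
  proof -
    obtain e where e: "0 < e" "ball u e \<subseteq> conv_domain m" using int unfolding mem_interior by blast
    \<comment> \<open>Raising coordinate \<open>k\<close> by \<open>2 * d\<close> stays within the
      ball of radius \<open>e\<close>. The intermediate value \<open>r\<close> is where the
      derivative series is dominated.\<close>
    define d where "d = e / 4"
    have d: "0 < d" using e unfolding d_def by simp
    define r where "r = u $ k + d"
    define v where "v = (\<chi> l. if l = k then r + d else u $ l)"
    have u0: "0 \<le> u $ l" for l by (rule unit_cubeD[OF u])
    have "v - u = axis k (2 * d)" unfolding v_def r_def by (auto simp: vec_eq_iff axis_def)
    then have "dist u v = 2 * d" using d by (subst dist_commute) (simp add: dist_norm norm_eq_sqrt_inner inner_axis_axis real_sqrt_mult)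
    then have "v \<in> conv_domain m" using e unfolding d_def by (intro subsetD[OF e(2)]) auto
    then have vs: "(\<lambda>i. m i * monomial v i) summable_on UNIV" unfolding conv_domain_def by simp
    have mv: "monomial v i = (r + d) ^ (i $ k) * (\<Prod>l\<in>UNIV - {k}. u $ l ^ i $ l)" for i
      unfolding monomial_def v_def by (subst prod.remove[of _ k]) (auto intro!: prod.cong)
    have sm0: "(\<lambda>i. m i * monomial (\<chi> l. if l = k then s else u $ l) i) summable_on UNIV"
      if "s \<in> {0..1}" "s \<le> r" for s
    proof (rule summable_on_le[OF vs])
      fix i
      have "0 \<le> monomial (\<chi> l. if l = k then s else u $ l) i" using that u0 by (intro monomial_nonneg) auto
      moreover have "monomial (\<chi> l. if l = k then s else u $ l) i \<le> monomial v i"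
        using that u0 d unfolding v_def by (intro monomial_mono) auto
      ultimately show "\<bar>m i * monomial (\<chi> l. if l = k then s else u $ l) i\<bar> \<le> m i * monomial v i"
        using m_pos[of i] by (simp add: abs_mult)
    qed
    have sm: "(\<lambda>i. \<bar>m i\<bar> * (real (i $ k) * r ^ (i $ k - 1) * (\<Prod>l\<in>UNIV - {k}. u $ l ^ i $ l))) summable_on UNIV"
    proof (rule summable_on_le[OF summable_on_cmult_left[OF vs, of "1 / d"]])
      fix i
      let ?rest = "\<Prod>l\<in>UNIV - {k}. u $ l ^ i $ l"
      have r0: "0 \<le> r" unfolding r_def using u0[of k] d by simp
      have rest: "0 \<le> ?rest" using u0 by (intro prod_nonneg) auto
      \<comment> \<open>A single term of the binomial expansion: convergence at \<open>r + d\<close>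
        controls the derivative series at \<open>r\<close>.\<close>
      have "real n * r ^ (n - 1) * d \<le> (r + d) ^ n" for n
      proof (cases n)
        case (Suc p)
        have "real (Suc p) * d * r ^ p \<le> (r + d) ^ Suc p"
        proof (induction p)
          case (Suc p)
          have "real (Suc (Suc p)) * d * r ^ Suc p = r * (real (Suc p) * d * r ^ p) + d * r ^ Suc p"
            by (simp add: algebra_simps)
          also have "\<dots> \<le> r * (r + d) ^ Suc p + d * (r + d) ^ Suc p"
            using Suc r0 d by (intro add_mono mult_left_mono power_mono) auto
          finally show ?case by (simp add: algebra_simps)
        qed (use r0 in simp)
        then show ?thesis using Suc by (simp add: algebra_simps)
      qed (use d in simp)
      then have "real (i $ k) * r ^ (i $ k - 1) \<le> (r + d) ^ (i $ k) * (1 / d)"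
        using d by (simp add: field_simps)
      then have "real (i $ k) * r ^ (i $ k - 1) * ?rest \<le> (r + d) ^ (i $ k) * (1 / d) * ?rest"
        by (rule mult_right_mono[OF _ rest])
      from mult_left_mono[OF this, of "m i"]
      show "\<bar>\<bar>m i\<bar> * (real (i $ k) * r ^ (i $ k - 1) * ?rest)\<bar> \<le> m i * monomial v i * (1 / d)"
        using m_pos[of i] rest r0 unfolding mv by (simp add: abs_mult mult_ac)
    qed
    have *: "real (i $ k) * u $ k ^ (i $ k - 1) * (\<Prod>l\<in>UNIV - {k}. u $ l ^ i $ l) = ?d k i" for i
      unfolding monomial_minus_axis by simp
    have r: "u $ k < r \<or> r = 1" "0 \<le> r" using d u0[of k] unfolding r_def by auto
    show ?thesis
      using has_partial_genfun[OF u r sm0 sm] unfolding * D_def by auto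
  qed
  then have D: "((\<lambda>i. m i * ?d k i) has_sum D k) UNIV" for k
    unfolding D_def by (intro has_sum_infsum) auto
  have "u \<in> conv_domain m" using int interior_subset by blast
  then have M: "((\<lambda>i. m i * monomial u i) has_sum genfun m u) UNIV"
    unfolding conv_domain_def genfun_def by simp
  define w where "w i = \<bar>Q i i\<bar>" for i
  have wsum: "(\<lambda>i. m i * (w i * monomial u i)) summable_on UNIV"
  proof (rule summable_on_le)
    have "((\<lambda>i. (\<Sum>k\<in>UNIV. m i * ?d k i * (death k * u $ k)) + m i * monomial u i * \<bar>a 0\<bar>) has_sum
       ((\<Sum>k\<in>UNIV. D k * (death k * u $ k)) + genfun m u * \<bar>a 0\<bar>)) UNIV"
      by (intro has_sum_add has_sum_finite_sum has_sum_cmult_left D M) auto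
    then show "(\<lambda>i. (\<Sum>k\<in>UNIV. m i * ?d k i * (death k * u $ k)) + m i * monomial u i * \<bar>a 0\<bar>) summable_on UNIV"
      by (rule has_sum_imp_summable)
    fix i
    have red: "?d k i * u $ k = real (i $ k) * monomial u i" for k
    proof (cases "i $ k = 0")
      case False
      show ?thesis using arg_cong[OF minus_axis_add[OF False], of "monomial u"] by (simp add: monomial_add)
    qed simp
    have "m i * ?d k i * (death k * u $ k) = m i * (death k * real (i $ k)) * monomial u i" for k
    proof -
      have "m i * ?d k i * (death k * u $ k) = m i * death k * (?d k i * u $ k)"
        by (simp only: mult_ac)
      then show ?thesis unfolding red by (simp only: mult_ac)
    qed
    then have "(\<Sum>k\<in>UNIV. m i * ?d k i * (death k * u $ k)) = m i * (\<Sum>k\<in>UNIV. death k * real (i $ k)) * monomial u i"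
      unfolding sum_distrib_left sum_distrib_right by (rule sum.cong[OF refl])
    moreover have "m i * (w i * monomial u i) \<le> m i * (((\<Sum>k\<in>UNIV. death k * real (i $ k)) + \<bar>a 0\<bar>) * monomial u i)"
      unfolding w_def by (intro mult_left_mono mult_right_mono Q_diag monomial_cube u less_imp_le[OF m_pos])
    ultimately show "\<bar>m i * (w i * monomial u i)\<bar> \<le> (\<Sum>k\<in>UNIV. m i * ?d k i * (death k * u $ k)) + m i * monomial u i * \<bar>a 0\<bar>"
      using m_pos[of i] monomial_cube(1)[OF u, of i] unfolding w_def by (simp add: abs_mult algebra_simps)
  qed
  define W where "W = (\<Sum>\<^sub>\<infinity>i. m i * (w i * monomial u i))"
  have W: "((\<lambda>i. m i * (w i * monomial u i)) has_sum W) UNIV" unfolding W_def using wsum by simp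
  define E where "E = A u * genfun m u + (\<Sum>k\<in>UNIV. B k u * D k)"
  have "((\<lambda>i. A u * (m i * monomial u i) + (\<Sum>k\<in>UNIV. B k u * (m i * ?d k i))) has_sum E) UNIV"
    unfolding E_def by (intro has_sum_add has_sum_finite_sum has_sum_cmult_right D M) auto
  then have Es: "((\<lambda>i. m i * generator_symbol i u) has_sum E) UNIV"
    unfolding generator_symbol_def by (simp add: sum_distrib_left algebra_simps)
  let ?f = "\<lambda>i j. m i * (Q i j * monomial u j + (if j = i then w i * monomial u i else 0))"
  have "((\<lambda>j. \<Sum>\<^sub>\<infinity>i. ?f i j) has_sum (E + W)) UNIV"
  proof (rule has_sum_swap_nonneg(2))
    show "0 \<le> ?f i j" for i j
    proof (cases "i = j")
      case True
      have "0 \<le> Q i i + w i" unfolding w_def by simp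
      then have "0 \<le> m i * ((Q i i + w i) * monomial u i)"
        using m_pos[of i] monomial_cube(1)[OF u, of i] by (intro mult_nonneg_nonneg) auto
      then show ?thesis using True by (simp add: algebra_simps)
    qed (use m_pos[of i] monomial_cube(1)[OF u, of j] Q_nonneg[of i j] in auto)
    show "(?f i has_sum (m i * (generator_symbol i u + w i * monomial u i))) UNIV" for i
      by (intro has_sum_cmult_right has_sum_add qmat_has_sum[OF u] has_sum_single)
    show "((\<lambda>i. m i * (generator_symbol i u + w i * monomial u i)) has_sum (E + W)) UNIV"
      using has_sum_add[OF Es W] by (simp add: distrib_left)
  qed
  moreover have "(\<Sum>\<^sub>\<infinity>i. ?f i j) = - lam * (m j * monomial u j) + m j * (w j * monomial u j)" for j
  proof (rule infsumI)
    have "((\<lambda>i. m i * Q i j * monomial u j + (if i = j then m j * (w j * monomial u j) else 0)) has_sum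
      (- lam * m j * monomial u j + m j * (w j * monomial u j))) UNIV"
      using invariant_Q unfolding invariant_for_Q_def
      by (intro has_sum_add has_sum_cmult_left has_sum_single) auto
    moreover have "m i * Q i j * monomial u j + (if i = j then m j * (w j * monomial u j) else 0) = ?f i j" for i
      by (auto simp: algebra_simps)
    ultimately show "((\<lambda>i. ?f i j) has_sum (- lam * (m j * monomial u j) + m j * (w j * monomial u j))) UNIV"
      by (simp add: mult.assoc)
  qed
  ultimately have "((\<lambda>j. - lam * (m j * monomial u j) + m j * (w j * monomial u j)) has_sum (E + W)) UNIV" by simp
  moreover have "((\<lambda>j. - lam * (m j * monomial u j) + m j * (w j * monomial u j)) has_sum (- lam * genfun m u + W)) UNIV"
    by (intro has_sum_add has_sum_cmult_right M W)
  ultimately have "E = - lam * genfun m u" using has_sum_unique by fastforce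
  moreover have "partial (genfun m) k u = D k" for k by (rule partial_eqI[OF u]) (use partial in auto)
  ultimately show ?thesis unfolding satisfies_pde_at_def E_def using partial
    by (auto simp: algebra_simps)
qed

end

end

section \<open>The maximal eigenvalue\<close>

text \<open>Applying \<open>K\<close> to the relation and subtracting \<open>y\<close> times the
  relation removes the vector for \<open>y\<close> and multiplies the other coefficients by the
  nonzero numbers \<open>x - y\<close>. Indexing by eigenvalues makes distinctness
  automatic.\<close>

lemma eigenvectors_independent:
  fixes K :: "real ^ 'n ^ 'n" and v :: "real \<Rightarrow> real ^ 'n"
  assumes "finite X" "\<And>x. x \<in> X \<Longrightarrow> v x \<noteq> 0 \<and> K *v v x = x *\<^sub>R v x" "(\<Sum>x\<in>X. c x *\<^sub>R v x) = 0"
  shows "\<forall>x\<in>X. c x = 0"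
  using assms
proof (induction X arbitrary: c rule: finite_induct)
  case (insert y X)
  have Kx: "K *v v x = x *\<^sub>R v x" if "x \<in> insert y X" for x using insert.prems that by auto
  have "K *v (\<Sum>x\<in>insert y X. c x *\<^sub>R v x) = (\<Sum>x\<in>insert y X. c x *\<^sub>R (x *\<^sub>R v x))"
    using Kx by (simp only: linear_sum[OF matrix_vector_mul_linear] matrix_vector_mult_scaleR) simp
  then have "(\<Sum>x\<in>insert y X. c x *\<^sub>R (x *\<^sub>R v x)) = 0" using insert.prems(2) by simp
  then have "(\<Sum>x\<in>insert y X. c x *\<^sub>R (x *\<^sub>R v x)) - y *\<^sub>R (\<Sum>x\<in>insert y X. c x *\<^sub>R v x) = 0"
    using insert.prems(2) by simp
  moreover have "(\<Sum>x\<in>insert y X. c x *\<^sub>R (x *\<^sub>R v x)) - y *\<^sub>R (\<Sum>x\<in>insert y X. c x *\<^sub>R v x)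
      = (\<Sum>x\<in>insert y X. (c x * (x - y)) *\<^sub>R v x)"
    unfolding scaleR_right.sum sum_subtractf[symmetric]
    by (rule sum.cong) (auto simp: scaleR_left_diff_distrib right_diff_distrib mult.commute)
  ultimately have "(\<Sum>x\<in>X. (c x * (x - y)) *\<^sub>R v x) = 0" using insert.hyps by simp
  then have "\<forall>x\<in>X. c x * (x - y) = 0" by (intro insert.IH) (use insert.prems in auto)
  then have cX: "\<forall>x\<in>X. c x = 0" using insert.hyps by auto
  then have "c y *\<^sub>R v y = 0" using insert.prems(2) insert.hyps by simp
  then show ?case using cX insert.prems(1) by auto
qed simp

text \<open>\<open>max_eigenvalue\<close> is a \<open>Max\<close> and needs a finite set to be
  meaningful. More eigenvalues than the dimension would give too many independent vectors.\<close>

lemma finite_eigenvalues: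
  fixes K :: "real ^ 'n ^ 'n" shows "finite {x. \<exists>v. v \<noteq> 0 \<and> K *v v = x *\<^sub>R v}" (is "finite ?E")
proof (rule ccontr)
  assume "infinite ?E"
  then obtain X where X: "X \<subseteq> ?E" "finite X" "card X = Suc CARD('n)"
    using infinite_arbitrarily_large[of ?E "Suc CARD('n)"] by blast
  have "\<forall>x\<in>X. \<exists>v. v \<noteq> 0 \<and> K *v v = x *\<^sub>R v" using X(1) by blast
  then obtain v where v: "\<And>x. x \<in> X \<Longrightarrow> v x \<noteq> 0 \<and> K *v v x = x *\<^sub>R v x"
    using bchoice[of X "\<lambda>x v. v \<noteq> 0 \<and> K *v v = x *\<^sub>R v"] by blast
  have inj: "inj_on v X"
  proof (rule inj_onI)
    fix x y assume "x \<in> X" "y \<in> X" "v x = v y"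
    then have "x *\<^sub>R v x = y *\<^sub>R v x" using v by metis
    then show "x = y" using v \<open>x \<in> X\<close> by simp
  qed
  have "independent (v ` X)"
  proof (rule independent_if_scalars_zero)
    show "finite (v ` X)" using X by simp
    fix f y assume f: "(\<Sum>x\<in>v ` X. f x *\<^sub>R x) = 0" and y: "y \<in> v ` X"
    have "(\<Sum>x\<in>X. f (v x) *\<^sub>R v x) = 0" using f by (simp add: sum.reindex[OF inj])
    from eigenvectors_independent[OF X(2) v this] show "f y = 0" using y by auto
  qed
  from independent_bound[OF this] show False using X inj by (simp add: card_image)
qed

text \<open>Brouwer's theorem on the standard simplex gives a nonnegative eigenvector.\<close>

lemma real_eigenvalue_exists:
  fixes K :: "real ^ 'n ^ 'n"
  assumes off: "\<And>i j. i \<noteq> j \<Longrightarrow> 0 \<le> K $ i $ j"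
  shows "\<exists>x v. v \<noteq> 0 \<and> K *v v = x *\<^sub>R v"
proof -
  \<comment> \<open>The shift makes all diagonal entries at least 1, so \<open>g v\<close> dominates
    \<open>v\<close> on the simplex and its coordinate sum stays away from 0. It only translates the
    eigenvalue.\<close>
  define c where "c = 1 + (\<Sum>i\<in>UNIV. \<bar>K $ i $ i\<bar>)"
  have c: "1 \<le> c + K $ i $ i" for i
    using member_le_sum[of i UNIV "\<lambda>i. \<bar>K $ i $ i\<bar>"] unfolding c_def by auto
  define S where "S = {v :: real ^ 'n. (\<forall>i. 0 \<le> v $ i) \<and> (\<Sum>i\<in>UNIV. v $ i) = 1}"
  define g where "g v = K *v v + c *\<^sub>R v" for v
  define f where "f v = (1 / (\<Sum>i\<in>UNIV. g v $ i)) *\<^sub>R g v" for v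
  have g_ge: "v $ i \<le> g v $ i" if "v \<in> S" for v i
  proof -
    have v0: "0 \<le> v $ j" for j using that unfolding S_def by auto
    have "(K *v v) $ i = K $ i $ i * v $ i + (\<Sum>j\<in>UNIV - {i}. K $ i $ j * v $ j)"
      unfolding matrix_vector_mult_def by (simp add: sum.remove[of _ i])
    moreover have "0 \<le> (\<Sum>j\<in>UNIV - {i}. K $ i $ j * v $ j)"
      by (intro sum_nonneg mult_nonneg_nonneg off v0) auto
    moreover have "1 * v $ i \<le> (c + K $ i $ i) * v $ i" by (intro mult_right_mono c v0)
    ultimately show ?thesis unfolding g_def by (simp add: algebra_simps)
  qed
  have sum_g: "1 \<le> (\<Sum>i\<in>UNIV. g v $ i)" if "v \<in> S" for v
    using sum_mono[of UNIV "\<lambda>i. v $ i" "\<lambda>i. g v $ i"] g_ge[OF that] that unfolding S_def by auto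
  have "S = {v. \<forall>i. 0 \<le> v $ i} \<inter> {v. (\<Sum>i\<in>UNIV. v $ i) = 1}" unfolding S_def by auto
  moreover have "closed {v :: real ^ 'n. \<forall>i. 0 \<le> v $ i}"
    by (intro closed_Collect_all closed_Collect_le continuous_intros)
  moreover have "closed {v :: real ^ 'n. (\<Sum>i\<in>UNIV. v $ i) = 1}"
    by (intro closed_Collect_eq continuous_intros)
  ultimately have "closed S" by auto
  moreover have "bounded S"
  proof (rule boundedI)
    fix v assume v: "v \<in> S"
    have "norm v \<le> (\<Sum>i\<in>UNIV. \<bar>v $ i\<bar>)" by (rule norm_le_l1_cart)
    also have "\<dots> = 1" using v unfolding S_def by simp
    finally show "norm v \<le> 1" .
  qed
  ultimately have "compact S" by (simp add: compact_eq_bounded_closed)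
  moreover have "convex S"
    unfolding convex_def S_def by (auto simp: sum.distrib sum_distrib_left[symmetric])
  moreover have "S \<noteq> {}"
  proof -
    have "axis (undefined :: 'n) 1 \<in> S" unfolding S_def by (auto simp: axis_def)
    then show ?thesis by blast
  qed
  moreover have "continuous_on S f"
  proof -
    have g: "continuous_on S g" unfolding g_def
      by (intro continuous_intros linear_continuous_on linear_linear[THEN iffD1] matrix_vector_mul_linear)
    have "(\<Sum>i\<in>UNIV. g v $ i) \<noteq> 0" if "v \<in> S" for v using sum_g[OF that] by simp
    then show ?thesis unfolding f_def by (intro continuous_intros g) auto
  qed
  moreover have "f \<in> S \<rightarrow> S"
  proof
    fix v assume v: "v \<in> S"
    have "0 \<le> g v $ i" for i using g_ge[OF v, of i] v unfolding S_def by (auto intro: order_trans)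
    then show "f v \<in> S" using sum_g[OF v] unfolding S_def f_def by (simp add: sum_divide_distrib[symmetric])
  qed
  ultimately obtain v where v: "v \<in> S" "f v = v" by (rule brouwer)
  have "v \<noteq> 0" using v(1) unfolding S_def by auto
  moreover have "(\<Sum>i\<in>UNIV. g v $ i) *\<^sub>R v = g v"
    using sum_g[OF v(1)] by (subst v(2)[symmetric]) (simp add: f_def)
  then have "K *v v = ((\<Sum>i\<in>UNIV. g v $ i) - c) *\<^sub>R v"
    unfolding g_def by (simp add: scaleR_left_diff_distrib eq_diff_eq)
  ultimately show ?thesis by blast
qed

lemma max_eigenvalue_attained:
  fixes K :: "real ^ 'n ^ 'n"
  assumes "\<And>i j. i \<noteq> j \<Longrightarrow> 0 \<le> K $ i $ j"
  obtains v where "v \<noteq> 0" "K *v v = max_eigenvalue K *\<^sub>R v"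
proof -
  have "max_eigenvalue K \<in> {x. \<exists>v. v \<noteq> 0 \<and> K *v v = x *\<^sub>R v}"
    unfolding max_eigenvalue_def
    by (rule Max_in[OF finite_eigenvalues]) (use real_eigenvalue_exists[OF assms] in auto)
  then show thesis using that by blast
qed

section \<open>Supersolutions near the corner when the maximal eigenvalue is positive\<close>

context branching
begin

text \<open>Termwise differentiation at the corner is the case \<open>r = 1\<close> of
  \<open>has_partial_genfun\<close>, with the first moments as majorant.\<close>

lemma Bjac_has_sum: "((\<lambda>j. b i j * real (j $ l)) has_sum (Bjac b 1 $ i $ l)) UNIV"
proof -
  have bm: "(\<lambda>j. \<bar>b i j * real (j $ l)\<bar>) summable_on UNIV"
  proof -
    have "(\<lambda>j. births i j * real (j $ l) + (if j = axis i 1 then - (death i * real (axis i 1 $ l)) else 0)) summable_on UNIV"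
      by (intro summable_on_add births_moment has_sum_imp_summable[OF has_sum_single])
    also have "(\<lambda>j. births i j * real (j $ l) + (if j = axis i 1 then - (death i * real (axis i 1 $ l)) else 0)) = (\<lambda>j. b i j * real (j $ l))"
      by (auto simp: b_eq algebra_simps)
    finally show ?thesis by (rule summable_on_iff_abs_summable_on_real[THEN iffD1, unfolded real_norm_def])
  qed
  have "has_partial (genfun (b i)) (\<Sum>\<^sub>\<infinity>j. b i j * (real (j $ l) * 1 $ l ^ (j $ l - 1) * (\<Prod>k\<in>UNIV - {l}. 1 $ k ^ j $ k))) l 1 \<and>
     (\<lambda>j. b i j * (real (j $ l) * 1 $ l ^ (j $ l - 1) * (\<Prod>k\<in>UNIV - {l}. 1 $ k ^ j $ k))) summable_on UNIV"
  proof (intro conjI has_partial_genfun[where r = 1])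
    fix s :: real assume "s \<in> {0..1}"
    then have "(\<chi> k. if k = l then s else 1 $ k) \<in> (unit_cube :: (real ^ 'n) set)" unfolding unit_cube_def by auto
    then show "(\<lambda>j. b i j * monomial (\<chi> k. if k = l then s else 1 $ k) j) summable_on UNIV"
      using has_sum_genfun[OF b_summable] by (auto simp: summable_on_def)
    then show "(\<lambda>j. b i j * monomial (\<chi> k. if k = l then s else 1 $ k) j) summable_on UNIV" .
  qed (use bm in \<open>auto simp: abs_mult\<close>)
  then have "has_partial (genfun (b i)) (\<Sum>\<^sub>\<infinity>j. b i j * real (j $ l)) l 1" "(\<lambda>j. b i j * real (j $ l)) summable_on UNIV"
    by simp_all
  moreover from this(1) have "Bjac b 1 $ i $ l = (\<Sum>\<^sub>\<infinity>j. b i j * real (j $ l))"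
    unfolding Bjac_def by (simp add: partial_eqI[OF one_in_unit_cube])
  ultimately show ?thesis by simp
qed

lemma Bjac_off_diagonal: "i \<noteq> l \<Longrightarrow> 0 \<le> Bjac b 1 $ i $ l"
proof (rule has_sum_nonneg[OF Bjac_has_sum])
  fix j assume "i \<noteq> l"
  then show "0 \<le> b i j * real (j $ l)"
    using births_nonneg[of i j] by (auto simp: b_eq axis_def)
qed

text \<open>If the maximal eigenvalue is positive then, for an eigenvector \<open>v\<close> and small \<open>e\<close>, the
  point \<open>1 - e * \<bar>v\<bar>\<close> is a supersolution that the flow started at \<open>0\<close> cannot cross.\<close>

lemma rho_nonpos:
  assumes lim: "\<And>r. r \<in> unit_cube \<Longrightarrow> (\<And>k. B k r \<le> 0 \<or> r $ k = 1) \<Longrightarrow> r = 1"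
  shows "rho b 1 \<le> 0"
proof (rule ccontr)
  define x where "x = rho b 1"
  assume "\<not> rho b 1 \<le> 0"
  then have x: "0 < x" by (simp add: x_def)
  obtain v where v: "v \<noteq> 0" "Bjac b 1 *v v = x *\<^sub>R v"
    using max_eigenvalue_attained[of "Bjac b 1"] Bjac_off_diagonal unfolding x_def rho_def by blast
  define J where "J k = (\<Sum>l\<in>UNIV. Bjac b 1 $ k $ l * \<bar>v $ l\<bar>)" for k
  \<comment> \<open>Passing to absolute values turns the eigenvector equation into an inequality.
    The diagonal entry may be negative, so it is moved to the left first.\<close>
  have J: "x * \<bar>v $ k\<bar> \<le> J k" for k
  proof -
    let ?b = "Bjac b 1 $ k"
    have "x * v $ k = (\<Sum>l\<in>UNIV. ?b $ l * v $ l)"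
      using arg_cong[OF v(2), of "\<lambda>w. w $ k"] unfolding matrix_vector_mult_def by simp
    also have "\<dots> = ?b $ k * v $ k + (\<Sum>l\<in>UNIV - {k}. ?b $ l * v $ l)" by (simp add: sum.remove[of _ k])
    finally have "(x - ?b $ k) * v $ k = (\<Sum>l\<in>UNIV - {k}. ?b $ l * v $ l)" by (simp add: algebra_simps)
    then have "\<bar>x - ?b $ k\<bar> * \<bar>v $ k\<bar> = \<bar>\<Sum>l\<in>UNIV - {k}. ?b $ l * v $ l\<bar>" by (simp add: abs_mult[symmetric])
    also have "\<dots> \<le> (\<Sum>l\<in>UNIV - {k}. \<bar>?b $ l * v $ l\<bar>)" by (rule sum_abs)
    also have "\<dots> = (\<Sum>l\<in>UNIV - {k}. ?b $ l * \<bar>v $ l\<bar>)"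
      by (rule sum.cong) (auto simp: abs_mult Bjac_off_diagonal)
    finally have "\<bar>x - ?b $ k\<bar> * \<bar>v $ k\<bar> \<le> (\<Sum>l\<in>UNIV - {k}. ?b $ l * \<bar>v $ l\<bar>)" .
    moreover have "(x - ?b $ k) * \<bar>v $ k\<bar> \<le> \<bar>x - ?b $ k\<bar> * \<bar>v $ k\<bar>" by (intro mult_right_mono) auto
    moreover have "J k = ?b $ k * \<bar>v $ k\<bar> + (\<Sum>l\<in>UNIV - {k}. ?b $ l * \<bar>v $ l\<bar>)"
      unfolding J_def by (simp add: sum.remove[of _ k])
    ultimately show ?thesis by (simp add: algebra_simps)
  qed
  define r where "r e = (\<chi> k. 1 - e * \<bar>v $ k\<bar>)" for e :: real
  define V where "V = 1 + (\<Sum>k\<in>UNIV. \<bar>v $ k\<bar>)"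
  have V: "0 < V" "\<bar>v $ k\<bar> \<le> V" for k
    using member_le_sum[of k UNIV "\<lambda>k. \<bar>v $ k\<bar>"] sum_nonneg[of UNIV "\<lambda>k. \<bar>v $ k\<bar>"]
    unfolding V_def by (auto intro: add_pos_nonneg)
  have r_cube: "r e \<in> unit_cube" if "0 < e" "e < 1 / V" for e
  proof -
    have "e * \<bar>v $ k\<bar> \<le> 1" for k
    proof -
      have "e * \<bar>v $ k\<bar> \<le> (1 / V) * V" using that V by (intro mult_mono) auto
      then show ?thesis using V by simp
    qed
    then show ?thesis using that unfolding r_def unit_cube_def by auto
  qed
  have ev_small: "eventually (\<lambda>e. 0 < e \<and> e < 1 / V) (at_right 0)"
    unfolding eventually_at_right_field using V by (intro exI[of _ "1 / V"]) auto
  have Jsum: "((\<lambda>j. b k j * (\<Sum>l\<in>UNIV. real (j $ l) * \<bar>v $ l\<bar>)) has_sum J k) UNIV" for k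
  proof -
    have "((\<lambda>j. \<Sum>l\<in>UNIV. b k j * real (j $ l) * \<bar>v $ l\<bar>) has_sum J k) UNIV"
      unfolding J_def by (intro has_sum_finite_sum has_sum_cmult_left Bjac_has_sum) auto
    then show ?thesis by (simp add: sum_distrib_left mult.assoc)
  qed
  \<comment> \<open>The derivative of \<open>B k\<close> at \<open>1\<close> in the direction
    \<open>- \<bar>v\<bar>\<close>, taken termwise; \<open>monomial_Lipschitz\<close> and the first
    moments give the majorant.\<close>
  have slope: "((\<lambda>e. B k (r e) / e) \<longlongrightarrow> - J k) (at_right 0)" for k
  proof -
    let ?w = "\<lambda>j. \<Sum>l\<in>UNIV. real (j $ l) * \<bar>v $ l\<bar>"
    have lim: "((\<lambda>e. b k j * ((monomial (r e) j - 1) / e)) \<longlongrightarrow> b k j * - ?w j) (at_right 0)" for j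
    proof -
      have "((\<lambda>e. monomial (r e) j) has_real_derivative
         (\<Sum>l\<in>UNIV. real (j $ l) * (- \<bar>v $ l\<bar> * monomial (r 0) (j - axis l 1)))) (at 0 within {0<..})"
        by (rule monomial_derivative) (auto simp: r_def intro!: derivative_eq_intros)
      moreover have "r 0 = 1" by (simp add: r_def vec_eq_iff)
      ultimately have "((\<lambda>e. (monomial (r e) j - 1) / e) \<longlongrightarrow> - ?w j) (at_right 0)"
        unfolding has_field_derivative_iff by (simp add: sum_negf)
      then show ?thesis by (intro tendsto_intros)
    qed
    have dom: "eventually (\<lambda>e. \<forall>j. \<bar>b k j * ((monomial (r e) j - 1) / e)\<bar> \<le> \<bar>b k j * ?w j\<bar>) (at_right 0)"
      using ev_small
    proof eventually_elim
      case (elim e)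
      show ?case
      proof
        fix j
        have "\<bar>monomial (r e) j - monomial 1 j\<bar> \<le> (\<Sum>l\<in>UNIV. real (j $ l) * \<bar>r e $ l - 1 $ l\<bar>)"
          by (rule monomial_Lipschitz) (use elim in \<open>auto intro: r_cube\<close>)
        also have "\<dots> = e * ?w j" using elim by (simp add: r_def abs_mult sum_distrib_left mult_ac)
        finally have "\<bar>(monomial (r e) j - 1) / e\<bar> \<le> ?w j" using elim by (simp add: field_simps)
        moreover have "0 \<le> ?w j" by (intro sum_nonneg) auto
        ultimately show "\<bar>b k j * ((monomial (r e) j - 1) / e)\<bar> \<le> \<bar>b k j * ?w j\<bar>"
          unfolding abs_mult by (intro mult_left_mono) auto
      qed
    qed
    have d: "(\<lambda>j. \<bar>b k j * ?w j\<bar>) summable_on UNIV"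
      using has_sum_imp_summable[OF Jsum[of k]]
      by (rule summable_on_iff_abs_summable_on_real[THEN iffD1, unfolded real_norm_def])
    have "((\<lambda>e. \<Sum>\<^sub>\<infinity>j. b k j * ((monomial (r e) j - 1) / e)) \<longlongrightarrow> (\<Sum>\<^sub>\<infinity>j. b k j * - ?w j)) (at_right 0)"
      by (rule tendsto_infsum_dominated(2)[OF lim dom d]) simp
    moreover have "(\<Sum>\<^sub>\<infinity>j. b k j * - ?w j) = - J k"
      using has_sum_cmult_right[OF Jsum[of k], of "-1"] by (simp add: infsumI)
    moreover have "eventually (\<lambda>e. (\<Sum>\<^sub>\<infinity>j. b k j * ((monomial (r e) j - 1) / e)) = B k (r e) / e) (at_right 0)"
      using ev_small
    proof eventually_elim
      case (elim e)
      have "((\<lambda>j. (b k j * monomial (r e) j - b k j) * (1 / e)) has_sum ((B k (r e) - 0) * (1 / e))) UNIV"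
        by (intro has_sum_cmult_left has_sum_diff_real has_sum_genfun b_summable b_has_sum r_cube) (use elim in auto)
      then show ?case by (intro infsumI) (simp add: right_diff_distrib diff_divide_distrib)
    qed
    ultimately show ?thesis by (auto intro: Lim_transform_eventually)
  qed
  \<comment> \<open>Where \<open>v $ k = 0\<close> the slope may vanish, but there
    \<open>r e $ k = 1\<close>.\<close>
  have "eventually (\<lambda>e. B k (r e) \<le> 0 \<or> r e $ k = 1) (at_right 0)" for k
  proof (cases "v $ k = 0")
    case False
    then have "0 < x * \<bar>v $ k\<bar>" using x by simp
    then have "- J k < 0" using J[of k] by simp
    from order_tendstoD(2)[OF slope this] ev_small show ?thesis
      by eventually_elim (auto simp: divide_less_0_iff)
  qed (simp add: r_def)
  then have "eventually (\<lambda>e. \<forall>k. B k (r e) \<le> 0 \<or> r e $ k = 1) (at_right 0)"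
    by (simp add: eventually_all_finite)
  with ev_small have "eventually (\<lambda>e. (\<forall>k. B k (r e) \<le> 0 \<or> r e $ k = 1) \<and> 0 < e \<and> e < 1 / V) (at_right 0)"
    by eventually_elim auto
  then obtain e where e: "\<And>k. B k (r e) \<le> 0 \<or> r e $ k = 1" "0 < e" "e < 1 / V"
    using eventually_happens[of _ "at_right (0::real)"] by auto
  have "r e = 1" by (rule lim[OF r_cube e(1)]) (use e in auto)
  then have "v = 0" using e(2) by (simp add: r_def vec_eq_iff)
  then show False using v(1) by simp
qed

end

section \<open>The characteristic curve and convergent measures\<close>

context irreducible_branching
begin

abbreviation A_int :: "real \<Rightarrow> real" where "A_int t \<equiv> integral {0..t} (\<lambda>s. A (ext s))"

lemma mass0_ext: "mass0 t 0 = exp (A_int t)" by (simp add: mass0_def)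

text \<open>The curve and \<open>ext\<close> are one trajectory read on different clocks. With the
  clock \<open>\<tau>\<close> of derivative \<open>1 / B k1 (U s)\<close>, both \<open>U\<close> and
  \<open>ext \<circ> \<tau>\<close> solve the same time-changed equation, so
  \<open>flow_unique\<close> applies and substitution evaluates the integral.\<close>

lemma curve_is_ext:
  assumes B0: "0 < B k1 0" and U: "is_curve b k1 U" and S: "0 \<le> S" "S < 1"
  obtains t where "0 \<le> t" "U S = ext t"
    "integral {0..S} (\<lambda>s. (lam + A (U s)) / B k1 (U s)) = lam * t + A_int t"
proof -
  have Uc: "U s \<in> unit_cube" "U s $ k1 = s" if "s \<in> {0..1}" for s using U that unfolding is_curve_def by auto
  have U0: "U 0 = 0" using U unfolding is_curve_def by auto
  have Ucont: "continuous_on {0..S} U"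
    using U S unfolding is_curve_def by (auto intro: continuous_on_subset)
  have Bcont: "continuous_on {0..S} (\<lambda>s. B k1 (U s))"
    by (rule continuous_on_compose2[OF continuous_on_genfun[OF b_summable] Ucont]) (use Uc S in auto)
  have Bne: "B k1 (U s) \<noteq> 0" if "s \<in> {0..S}" for s using U S that unfolding is_curve_def by auto
  \<comment> \<open>\<open>is_curve\<close> only says that \<open>B k1\<close> does not vanish on
    the curve; positivity at the start propagates by the intermediate value theorem.\<close>
  have Bpos: "0 < B k1 (U s)" if s: "s \<in> {0..S}" for s
  proof (rule ccontr)
    assume "\<not> 0 < B k1 (U s)"
    then have "\<exists>x\<ge>0. x \<le> s \<and> B k1 (U x) = 0"
      by (intro IVT2') (use B0 U0 s in \<open>auto intro: continuous_on_subset[OF Bcont]\<close>)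
    then show False using Bne s by auto
  qed
  define g where "g s = 1 / B k1 (U s)" for s
  have gcont: "continuous_on {0..S} g" unfolding g_def by (intro continuous_intros Bcont) (use Bne in auto)
  define \<tau> where "\<tau> s = integral {0..s} g" for s
  have \<tau>': "(\<tau> has_real_derivative g s) (at s within {0..S})" if "s \<in> {0..S}" for s
    unfolding \<tau>_def by (rule integral_has_real_derivative[OF gcont that])
  have \<tau>0: "\<tau> 0 = 0" unfolding \<tau>_def by simp
  have \<tau>n: "0 \<le> \<tau> s" if "s \<in> {0..S}" for s
    unfolding \<tau>_def
  proof (rule integral_nonneg)
    show "g integrable_on {0..s}" by (rule integrable_continuous_real, rule continuous_on_subset[OF gcont]) (use that in auto)
    show "0 \<le> g x" if "x \<in> {0..s}" for x using Bpos[of x] that \<open>s \<in> {0..S}\<close> unfolding g_def by auto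
  qed
  have chain: "((\<lambda>s. F (\<tau> s)) has_real_derivative F' * g s) (at s within {0..S})"
    if "s \<in> {0..S}" and F: "(F has_real_derivative F') (at (\<tau> s) within {0..})" for s F F'
  proof -
    have "(F has_real_derivative F') (at (\<tau> s) within \<tau> ` {0..S})"
      by (rule DERIV_subset[OF F]) (use \<tau>n in auto)
    from DERIV_image_chain[OF this \<tau>'[OF that(1)]] show ?thesis by (simp add: o_def)
  qed
  have eq: "U s = ext (\<tau> s)" if s: "s \<in> {0..S}" for s
  proof (rule flow_unique[where g = g and \<tau> = \<tau> and T = s and x = U and y = "\<lambda>s. ext (\<tau> s)"])
    show "0 \<le> s" using s by simp
    fix r assume "r \<in> {0..s}"
    then have r: "r \<in> {0..S}" using s by auto
    then have r1: "r \<in> {0..1}" "r \<in> {0..<1}" using S by auto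
    show "U r \<in> unit_cube" by (rule Uc[OF r1(1)])
    show "ext (\<tau> r) \<in> unit_cube" by (rule ext_cube[OF \<tau>n[OF r]])
    show "(\<tau> has_real_derivative g r) (at r within {0..s})" by (rule DERIV_subset[OF \<tau>'[OF r]]) (use s in auto)
    show "0 \<le> g r" using Bpos[OF r] unfolding g_def by simp
    show "((\<lambda>s. ext (\<tau> s) $ k) has_real_derivative g r * B k (ext (\<tau> r))) (at r within {0..s})" for k
    proof -
      have "((\<lambda>s. ext (\<tau> s) $ k) has_real_derivative B k (ext (\<tau> r)) * g r) (at r within {0..S})"
        by (rule chain[OF r flow_derivative]) (use \<tau>n[OF r] in auto)
      then show ?thesis using s DERIV_subset[of _ _ r "{0..S}" "{0..s}"] by (auto simp: mult.commute)
    qed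
    show "((\<lambda>s. U s $ k) has_real_derivative g r * B k (U r)) (at r within {0..s})" for k
    proof (cases "k = k1")
      case True
      have "((\<lambda>s. s) has_real_derivative 1) (at r within {0..s})" by (rule DERIV_ident)
      then have "((\<lambda>s. U s $ k1) has_real_derivative 1) (at r within {0..s})"
        by (rule has_field_derivative_transform_within[where d = 1]) (use Uc \<open>r \<in> {0..s}\<close> s S in auto)
      then show ?thesis using True Bne[OF r] unfolding g_def by simp
    next
      case False
      then have "((\<lambda>r. U r $ k) has_real_derivative B k (U r) / B k1 (U r)) (at r within {0..1})"
        using U r1 unfolding is_curve_def by auto
      then have "((\<lambda>r. U r $ k) has_real_derivative B k (U r) / B k1 (U r)) (at r within {0..s})"
        by (rule DERIV_subset) (use s S in auto)
      then show ?thesis unfolding g_def by simp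
    qed
  next
    show "U 0 = ext (\<tau> 0)" using U0 \<tau>0 by (simp add: flow_0)
  qed
  have "((\<lambda>s. (lam + A (U s)) / B k1 (U s)) has_integral
      (lam * \<tau> S + A_int (\<tau> S) - (lam * \<tau> 0 + A_int (\<tau> 0)))) {0..S}"
  proof (rule fundamental_theorem_of_calculus[OF S(1)])
    fix s assume s: "s \<in> {0..S}"
    have "((\<lambda>s. lam * \<tau> s + A_int (\<tau> s)) has_real_derivative lam * g s + A (ext (\<tau> s)) * g s) (at s within {0..S})"
      by (intro DERIV_add DERIV_cmult \<tau>' s chain integral_A_derivative \<tau>n) auto
    then show "((\<lambda>s. lam * \<tau> s + A_int (\<tau> s)) has_vector_derivative (lam + A (U s)) / B k1 (U s)) (at s within {0..S})"
      unfolding has_real_derivative_iff_has_vector_derivative[symmetric] eq[OF s] g_def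
      by (simp add: add_divide_distrib)
  qed
  then have "integral {0..S} (\<lambda>s. (lam + A (U s)) / B k1 (U s)) = lam * \<tau> S + A_int (\<tau> S)"
    by (simp add: integral_unique \<tau>0)
  then show thesis using that[of "\<tau> S"] \<tau>n eq S by auto
qed

text \<open>Along the curve the generating function of \<open>m\<close> equals
  \<open>m 0 * exp (- ?I s)\<close>. A real lower bound \<open>c\<close> for the integrals bounds
  it, hence every finite partial sum, and these are continuous up to \<open>s = 1\<close>.\<close>

lemma summable_if_integral:
  assumes inv: "invariant_for_P lam P m" and B0: "0 < B k1 0" and U: "is_curve b k1 U"
    and int: "has_improper_integral (\<lambda>s. (lam + A (U s)) / B k1 (U s)) L" and L: "L > - \<infinity>"
  shows "m summable_on UNIV"
proof -
  let ?I = "\<lambda>x. integral {0..x} (\<lambda>s. (lam + A (U s)) / B k1 (U s))"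
  obtain c :: real where c: "ereal c < L" using L ereal_dense2[of "- \<infinity>" L] by auto
  have "((\<lambda>x. ereal (?I x)) \<longlongrightarrow> L) (at_left 1)" using int unfolding has_improper_integral_def by auto
  from order_tendstoD(1)[OF this c] have ev1: "eventually (\<lambda>x. c < ?I x) (at_left 1)" by simp
  have ev2: "eventually (\<lambda>x. x \<in> {0<..<1}) (at_left (1::real))" by (rule eventually_at_left_real) simp
  have "\<forall>x\<in>{0..1}. (U \<longlongrightarrow> U x) (at x within {0..1})"
    using U unfolding is_curve_def continuous_on_def by blast
  then have "(U \<longlongrightarrow> U 1) (at 1 within {0..1})" by (rule bspec) simp
  moreover have "at (1::real) within {0..1} = at_left 1" by (rule at_within_Icc_at_left) simp
  ultimately have Ulim: "(U \<longlongrightarrow> 1) (at_left 1)" using U unfolding is_curve_def by simp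
  have bnd: "sum m T \<le> m 0 * exp (- c)" if T: "finite T" for T
  proof (rule tendsto_upperbound)
    show "((\<lambda>s. \<Sum>k\<in>T. m k * monomial (U s) k) \<longlongrightarrow> sum m T) (at_left 1)"
    proof -
      have "((\<lambda>s. \<Sum>k\<in>T. m k * monomial (U s) k) \<longlongrightarrow> (\<Sum>k\<in>T. m k * monomial 1 k)) (at_left 1)"
        by (intro tendsto_sum tendsto_mult tendsto_const tendsto_monomial Ulim)
      then show ?thesis by simp
    qed
    show "eventually (\<lambda>s. (\<Sum>k\<in>T. m k * monomial (U s) k) \<le> m 0 * exp (- c)) (at_left 1)"
      using ev1 ev2
    proof eventually_elim
      case (elim s)
      obtain t where t: "0 \<le> t" "U s = ext t" "?I s = lam * t + A_int t"
        using curve_is_ext[OF B0 U, of s lam] elim by auto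
      have "(\<Sum>k\<in>T. m k * monomial (U s) k) \<le> exp (- lam * t) * m 0 / mass0 t 0"
        unfolding t(2) by (rule finite_sum_le_has_sum[OF m_ext_has_sum[OF inv t(1)] T])
           (auto intro!: mult_nonneg_nonneg less_imp_le[OF m_pos[OF inv]] monomial_cube ext_cube t)
      also have "\<dots> = m 0 * exp (- ?I s)"
        unfolding mass0_ext t(3) by (simp add: exp_diff exp_minus field_simps)
      also have "\<dots> \<le> m 0 * exp (- c)"
        using elim m_pos[OF inv, of 0] by (intro mult_left_mono) auto
      finally show ?case .
    qed
  qed simp
  show ?thesis
    by (rule nonneg_bdd_above_summable_on)
       (use bnd m_pos[OF inv] in \<open>auto intro!: bdd_aboveI2 simp: less_imp_le\<close>)
qed

text \<open>Honesty preserves the total mass of \<open>m\<close>, while invariance over unit time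
  scales it by \<open>exp (- lam)\<close>. In column \<open>0\<close>,
  \<open>P t i 0 \<le> mass0 t 0\<close> then bounds \<open>m 0\<close> by the total mass times
  \<open>mass0 t 0\<close>.\<close>

lemma summable_invariant:
  assumes inv: "invariant_for_P lam P m" and sm: "m summable_on UNIV"
  shows "lam = 0" and "\<exists>p>0. \<forall>t\<ge>0. p \<le> mass0 t 0"
proof -
  define S where "S = (\<Sum>\<^sub>\<infinity>i. m i)"
  have S: "(m has_sum S) UNIV" unfolding S_def using sm by simp
  have S0: "0 < S"
    using finite_sum_le_has_sum[OF S, of "{0}"] m_pos[OF inv] by (auto simp: less_imp_le intro: less_le_trans)
  have 1: "(\<lambda>j. exp (- lam * 1) * m j) = (\<lambda>j. \<Sum>\<^sub>\<infinity>i. m i * P 1 i j)"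
    using infsumI[OF m_inv[OF inv, of 1]] by (auto simp: fun_eq_iff)
  have "((\<lambda>j. \<Sum>\<^sub>\<infinity>i. m i * P 1 i j) has_sum S) UNIV"
  proof (rule has_sum_swap_nonneg(2)[OF _ _ S])
    show "((\<lambda>j. m i * P 1 i j) has_sum m i) UNIV" for i
      using has_sum_cmult_right[OF P_honest[of 1 i], of "m i"] by simp
  qed (auto intro!: mult_nonneg_nonneg less_imp_le[OF m_pos[OF inv]] P_nonneg)
  moreover have "((\<lambda>j. exp (- lam * 1) * m j) has_sum (exp (- lam * 1) * S)) UNIV"
    by (rule has_sum_cmult_right[OF S])
  ultimately have "exp (- lam * 1) * S = S" unfolding 1 using has_sum_unique by blast
  then show lam: "lam = 0" using S0 by simp
  have "m 0 / S \<le> mass0 t 0" if t: "0 \<le> t" for t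
  proof -
    have "m 0 \<le> S * mass0 t 0"
    proof (rule has_sum_mono)
      show "((\<lambda>i. m i * P t i 0) has_sum m 0) UNIV" using m_inv[OF inv t, of 0] lam by simp
      show "((\<lambda>i. m i * mass0 t 0) has_sum (S * mass0 t 0)) UNIV" by (rule has_sum_cmult_left[OF S])
      show "m i * P t i 0 \<le> m i * mass0 t 0" for i
        unfolding P_to_0[OF t] using monomial_cube(2)[OF ext_cube[OF t]] mass0_pos[of t 0] m_pos[OF inv, of i]
        by (intro mult_left_mono mult_left_le) (auto simp: less_imp_le)
    qed
    then show ?thesis using S0 by (simp add: field_simps)
  qed
  then show "\<exists>p>0. \<forall>t\<ge>0. p \<le> mass0 t 0" using S0 m_pos[OF inv, of 0] by (intro exI[of _ "m 0 / S"]) auto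
qed

section \<open>The case in which the return probability to the state 0 stays away from zero\<close>

context
  fixes p :: real
  assumes p: "0 < p" "\<And>t. 0 \<le> t \<Longrightarrow> p \<le> mass0 t 0"
begin

lemma A_int_lower: "0 \<le> t \<Longrightarrow> ln p \<le> A_int t"
  using p(2)[of t] p(1) by (metis exp_gt_zero ln_exp ln_mono mass0_ext)

text \<open>\<open>ln (P t 0 0)\<close> equals \<open>A_int t\<close>, which lies between
  \<open>ln p\<close> and 0 and is negligible against \<open>t\<close>.\<close>

lemma decay_parameter_eq_0:
  assumes "is_decay_parameter P lamZ" shows "lamZ = 0"
proof -
  have "((\<lambda>t. ln (P t 0 0) / t) \<longlongrightarrow> 0) at_top"
  proof (rule tendsto_sandwich[OF _ _ _ tendsto_const])
    have 1: "ln (P t 0 0) = A_int t" if "0 \<le> t" for t using that by (simp add: P_to_0 mass0_ext)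
    show "eventually (\<lambda>t. ln p / t \<le> ln (P t 0 0) / t) at_top"
      using eventually_gt_at_top[of 0] by eventually_elim (simp add: 1 A_int_lower divide_right_mono)
    show "eventually (\<lambda>t. ln (P t 0 0) / t \<le> 0) at_top"
      using eventually_gt_at_top[of 0]
    proof eventually_elim
      case (elim t)
      then have "mass0 t 0 \<le> 1" by (intro mass0_le_one) auto
      then show ?case using elim by (simp add: 1 mass0_ext divide_le_0_iff)
    qed
    show "((\<lambda>t. ln p / t) \<longlongrightarrow> 0) at_top"
      by (intro tendsto_divide_0[OF tendsto_const] filterlim_at_top_imp_at_infinity filterlim_ident)
  qed
  moreover have "((\<lambda>t. ln (P t 0 0) / t) \<longlongrightarrow> - lamZ) at_top"
    using assms unfolding is_decay_parameter_def by blast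
  ultimately show ?thesis using tendsto_unique[of "at_top :: real filter"] by fastforce
qed

text \<open>If \<open>A q\<close> were negative, \<open>A (ext s) \<le> A q\<close> would drive
  \<open>A_int\<close> to minus infinity. So \<open>A q = 0\<close> and, \<open>q\<close> being
  fixed by the flow, the generating function of \<open>P t 0\<close> at \<open>q\<close> is the full
  mass 1; a coordinate \<open>q $ l < 1\<close> would lose mass that communication puts on
  \<open>axis l 1\<close>.\<close>

lemma q_eq_1: "q = 1"
proof -
  have Aq: "A q = 0"
  proof (rule ccontr)
    assume "A q \<noteq> 0"
    then have neg: "A q < 0" using A_nonpos[OF q_cube] by simp
    \<comment> \<open>Chosen so that \<open>t * A q\<close> falls one below
      \<open>- \<bar>ln p\<bar>\<close>.\<close>
    define t where "t = (\<bar>ln p\<bar> + 1) / - A q"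
    have t: "0 \<le> t" unfolding t_def using neg by (intro divide_nonneg_pos) auto
    have "A_int t \<le> integral {0..t} (\<lambda>s. A q)"
      by (rule integral_le) (use t in \<open>auto intro!: integrable_continuous_real continuous_on_subset[OF continuous_on_A_flow]
         A_mono ext_cube q_cube ext_le_q\<close>)
    also have "\<dots> = t * A q" using t by simp
    also have "\<dots> = - (\<bar>ln p\<bar> + 1)" unfolding t_def using neg by (simp add: field_simps)
    finally show False using A_int_lower[OF t] by linarith
  qed
  have "q $ l = 1" for l
  proof -
    obtain t where t: "0 \<le> t" "0 < P t 0 (axis l 1)" using comm unfolding communicating_def by blast
    have "integral {0..t} (\<lambda>s. A (flow s q)) = integral {0..t} (\<lambda>s. 0)"
      by (rule Henstock_Kurzweil_Integration.integral_cong) (auto simp: flow_q Aq)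
    then have "mass0 t q = 1" by (simp add: mass0_def)
    then have "((\<lambda>j. P t 0 j * monomial q j) has_sum 1) UNIV"
      using genfun_P_has_sum[OF t(1) q_cube, of 0] by simp
    then have "((\<lambda>j. P t 0 j - P t 0 j * monomial q j) has_sum (1 - 1)) UNIV"
      by (intro has_sum_diff_real P_honest t)
    from finite_sum_le_has_sum[OF this, of "{axis l 1}"]
    have "P t 0 (axis l 1) - P t 0 (axis l 1) * q $ l \<le> 0"
      using mult_left_le[OF monomial_cube(2)[OF q_cube] P_nonneg[OF t(1)]] by auto
    then have "P t 0 (axis l 1) * 1 \<le> P t 0 (axis l 1) * q $ l" by simp
    then have "1 \<le> q $ l" using t by (simp only: mult_le_cancel_left_pos)
    then show ?thesis using unit_cubeD(2)[OF q_cube, of l] by simp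
  qed
  then show ?thesis by (simp add: vec_eq_iff)
qed

text \<open>Every supersolution stays above \<open>ext\<close>, hence above \<open>q = 1\<close>,
  which is what \<open>rho_nonpos\<close> asks for.\<close>

lemma rho_le_0: "rho b 1 \<le> 0"
proof (rule rho_nonpos)
  fix r assume r: "r \<in> unit_cube" "\<And>k. B k r \<le> 0 \<or> r $ k = 1"
  have "q \<le> r" by (intro q_leI flow_le r) (auto simp: cube_ge_zero r)
  then show "r = 1" using cube_le_one[OF r(1)] unfolding q_eq_1 by simp
qed

lemma A_int_antimono: assumes "0 \<le> s" "s \<le> t" shows "A_int t \<le> A_int s"
proof -
  have "exp (A_int t) \<le> exp (A_int s)" using mass0_antimono[OF assms, of 0] unfolding mass0_ext by simp
  then show ?thesis by simp
qed

lemma A_int_converges: obtains l where "(A_int \<longlongrightarrow> l) at_top"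
proof -
  define l where "l = (INF t\<in>{0..}. A_int t)"
  have bdd: "bdd_below (A_int ` {0..})" by (rule bdd_belowI2[where m = "ln p"]) (auto intro: A_int_lower)
  have "(A_int \<longlongrightarrow> l) at_top"
  proof (rule order_tendstoI)
    fix x assume "x < l"
    then have "x < A_int t" if "0 \<le> t" for t
      using cINF_lower[OF bdd, of t] that unfolding l_def by auto
    then show "eventually (\<lambda>t. x < A_int t) at_top" by (auto simp: eventually_at_top_linorder)
  next
    fix x assume "l < x"
    then obtain t where t: "0 \<le> t" "A_int t < x"
      unfolding l_def using cINF_less_iff[OF _ bdd] by auto
    then have "A_int s < x" if "t \<le> s" for s using A_int_antimono[OF t(1) that] by simp
    then show "eventually (\<lambda>t. A_int t < x) at_top" by (auto simp: eventually_at_top_linorder)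
  qed
  then show thesis by (rule that)
qed

text \<open>The coordinate \<open>f\<close> of \<open>ext\<close> increases strictly from 0 towards
  \<open>q $ k1 = 1\<close>, so its inverse \<open>T\<close> is a clock on \<open>{0..<1}\<close>
  and \<open>ext \<circ> T\<close> is the curve. The integral up to \<open>x\<close> is
  \<open>A_int (T x)\<close> and converges together with \<open>A_int\<close>.\<close>

lemma curve_exists:
  assumes B0: "0 < B k1 0"
  obtains U l where "is_curve b k1 U"
    "has_improper_integral (\<lambda>s. A (U s) / B k1 (U s)) (ereal l)"
proof -
  define f where "f t = ext t $ k1" for t
  have f': "(f has_real_derivative B k1 (ext t)) (at t within {0..})" if "0 \<le> t" for t
    unfolding f_def by (rule flow_derivative) (use that in auto)
  have f0: "f 0 = 0" unfolding f_def by (simp add: flow_0)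
  have f_lt: "f t < 1" if "0 \<le> t" for t using ext_less_q[OF that, of k1] by (simp add: f_def q_eq_1)
  have f_ge: "0 \<le> f t" if "0 \<le> t" for t unfolding f_def using ext_cube[OF that] by (rule unit_cubeD)
  \<comment> \<open>The bound of \<open>flow_diff_lower\<close> for the trajectories from
    \<open>0\<close> and \<open>ext h\<close>, divided by \<open>h\<close>, compares the speed at
    time \<open>t\<close> with the initial speed \<open>B k1 0\<close>.\<close>
  have Bpos: "0 < B k1 (ext t)" if t: "0 \<le> t" for t
  proof -
    have "B k1 0 \<le> exp (death k1 * t) * B k1 (ext t)"
    proof (rule tendsto_le)
      show "((\<lambda>h. exp (death k1 * t) * ((f (t + h) - f t) / h)) \<longlongrightarrow> exp (death k1 * t) * B k1 (ext t)) (at_right 0)"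
        by (intro tendsto_mult tendsto_const right_quotient f' t)
      show "((\<lambda>h. (f (0 + h) - f 0) / h) \<longlongrightarrow> B k1 0) (at_right 0)"
        using right_quotient[OF f'[OF order_refl] order_refl] by (simp add: flow_0)
      show "eventually (\<lambda>h. (f (0 + h) - f 0) / h \<le> exp (death k1 * t) * ((f (t + h) - f t) / h)) (at_right 0)"
        using eventually_at_right_less[of 0]
      proof eventually_elim
        case (elim h)
        have "ext h $ k1 - 0 $ k1 \<le> exp (death k1 * t) * (flow t (ext h) $ k1 - flow t 0 $ k1)"
          by (rule flow_diff_lower) (use t elim in \<open>auto intro!: ext_cube cube_ge_zero\<close>)
        then have "f h \<le> exp (death k1 * t) * (f (t + h) - f t)"
          using flow_add[of t h 0] t elim by (simp add: f_def)
        then show ?case using elim f0 by (simp add: divide_right_mono)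
      qed
    qed simp
    then have "0 < exp (death k1 * t) * B k1 (ext t)" using B0 by linarith
    then show ?thesis by (simp add: zero_less_mult_iff)
  qed
  have f_cont: "continuous_on {0..} f" by (rule DERIV_continuous_on) (rule f', simp)
  have f_mono: "f s < f t" if st: "0 \<le> s" "s < t" for s t
  proof (rule DERIV_pos_imp_increasing_open[OF st(2)])
    fix x assume x: "s < x" "x < t"
    then have "at x within {0..} = at x" using st by (intro at_within_interior) simp
    then show "\<exists>y. (f has_real_derivative y) (at x) \<and> 0 < y"
      using f'[of x] Bpos[of x] x st by auto
  qed (rule continuous_on_subset[OF f_cont], use st in auto)
  have f_inj: "s = t" if "0 \<le> s" "0 \<le> t" "f s = f t" for s t
    using f_mono[of s t] f_mono[of t s] that by (cases s t rule: linorder_cases) auto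
  have f_surj: "\<exists>t\<ge>0. f t = s" if s: "0 \<le> s" "s < 1" for s
  proof -
    have "s < q $ k1" using s by (simp add: q_eq_1)
    then obtain t where t: "0 \<le> t" "s < ext t $ k1" by (rule less_q)
    then have "\<exists>x\<ge>0. x \<le> t \<and> f x = s"
      by (intro IVT') (use f0 s in \<open>auto simp: f_def[symmetric] intro: continuous_on_subset[OF f_cont]\<close>)
    then show ?thesis by blast
  qed
  define T where "T s = (THE t. 0 \<le> t \<and> f t = s)" for s
  have Tf: "T (f t) = t" if "0 \<le> t" for t
    unfolding T_def by (rule the_equality) (use that f_inj in auto)
  have T: "0 \<le> T s" "f (T s) = s" if "0 \<le> s" "s < 1" for s
    using f_surj[OF that] Tf by auto
  have T_mono: "t \<le> T s" if "0 \<le> t" "f t \<le> s" "s < 1" for s t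
    using f_mono[of "T s" t] T[of s] f_ge[of t] that by (auto simp: not_less[symmetric])
  have T_cont: "(T \<longlongrightarrow> T s) (at s within {0..<1})" if s: "0 \<le> s" "s < 1" for s
  proof -
    \<comment> \<open>Continuity of the inverse is obtained on the compact interval
      \<open>{0..N}\<close>; one unit beyond \<open>T s\<close> leaves a relative neighbourhood of
      \<open>s\<close> inside the image.\<close>
    define N where "N = T s + 1"
    have N: "0 \<le> N" "s < f N" using T[OF s] f_mono[of "T s" N] unfolding N_def by auto
    have "continuous_on (f ` {0..N}) T"
      by (rule continuous_on_inv) (use Tf in \<open>auto intro: continuous_on_subset[OF f_cont]\<close>)
    moreover have "{0..<f N} \<subseteq> f ` {0..N}"
    proof
      fix x assume x: "x \<in> {0..<f N}"
      then have x1: "0 \<le> x" "x < 1" using f_lt[OF N(1)] by auto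
      have "T x \<le> N" using f_mono[of N "T x"] N T[OF x1] x by (cases "T x \<le> N") auto
      then show "x \<in> f ` {0..N}" using T[OF x1] by (intro image_eqI[of _ _ "T x"]) auto
    qed
    ultimately have "continuous_on {0..<f N} T" by (rule continuous_on_subset)
    then have "(T \<longlongrightarrow> T s) (at s within {0..<f N})" using s N unfolding continuous_on_def by auto
    moreover have "at s within {0..<f N} = at s within {0..<1}"
      by (rule at_within_nhd[where S = "{..<f N}"]) (use N f_lt[OF N(1)] in auto)
    ultimately show ?thesis by simp
  qed
  have T': "(T has_real_derivative 1 / B k1 (ext (T s))) (at s within {0..<1})" if s: "0 \<le> s" "s < 1" for s
  proof -
    have ev: "eventually (\<lambda>y. y \<in> {0..<1} \<and> y \<noteq> s) (at s within {0..<1})"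
      by (simp add: eventually_at_filter)
    have "filterlim T (at (T s) within {0..}) (at s within {0..<1})"
      unfolding filterlim_at
    proof (intro conjI T_cont s)
      show "eventually (\<lambda>y. T y \<in> {0..} \<and> T y \<noteq> T s) (at s within {0..<1})"
        using ev
      proof eventually_elim
        case (elim y)
        then have "f (T y) = y" "0 \<le> T y" "f (T s) = s" using T s by auto
        then show ?case using elim by auto
      qed
    qed
    moreover have "((\<lambda>t. (f t - f (T s)) / (t - T s)) \<longlongrightarrow> B k1 (ext (T s))) (at (T s) within {0..})"
      using f'[OF T(1)[OF s]] unfolding has_field_derivative_iff .
    ultimately have "((\<lambda>y. (f (T y) - f (T s)) / (T y - T s)) \<longlongrightarrow> B k1 (ext (T s))) (at s within {0..<1})"
      by (rule filterlim_compose[rotated])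
    then have "((\<lambda>y. 1 / ((f (T y) - f (T s)) / (T y - T s))) \<longlongrightarrow> 1 / B k1 (ext (T s))) (at s within {0..<1})"
      using Bpos[OF T(1)[OF s]] by (intro tendsto_divide tendsto_const) auto
    then have "((\<lambda>y. (T y - T s) / (y - s)) \<longlongrightarrow> 1 / B k1 (ext (T s))) (at s within {0..<1})"
    proof (rule Lim_transform_eventually)
      show "eventually (\<lambda>y. 1 / ((f (T y) - f (T s)) / (T y - T s)) = (T y - T s) / (y - s)) (at s within {0..<1})"
        using ev by eventually_elim (use T s in auto)
    qed
    then show ?thesis unfolding has_field_derivative_iff .
  qed
  \<comment> \<open>The clock \<open>T\<close> tends to infinity at the end point, where the limit
    \<open>q = 1\<close> is inserted.\<close>
  define U where "U s = (if s < 1 then ext (T s) else 1)" for s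
  have U_eq: "U s = ext (T s)" if "s < 1" for s using that by (simp add: U_def)
  have near1: "at s within {0..<1} = at s within {0..1}" if "s < 1" for s :: real
    by (rule at_within_nhd[where S = "{..<1}"]) (use that in auto)
  have chain: "((\<lambda>s. F (T s)) has_real_derivative F' * (1 / B k1 (ext (T s)))) (at s within {0..<1})"
    if s: "0 \<le> s" "s < 1" and F: "(F has_real_derivative F') (at (T s) within {0..})" for s F F'
  proof -
    have "(F has_real_derivative F') (at (T s) within T ` {0..<1})"
      by (rule DERIV_subset[OF F]) (use T in auto)
    from DERIV_image_chain[OF this T'[OF s]] show ?thesis by (simp add: o_def)
  qed
  have U_deriv: "((\<lambda>r. U r $ k) has_real_derivative B k (U s) / B k1 (U s)) (at s within {0..1})"
    if s: "0 \<le> s" "s < 1" for s k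
  proof -
    have "((\<lambda>r. ext (T r) $ k) has_real_derivative B k (ext (T s)) * (1 / B k1 (ext (T s)))) (at s within {0..<1})"
      by (rule chain[OF s flow_derivative]) (use T[OF s] in auto)
    then have "((\<lambda>r. ext (T r) $ k) has_real_derivative B k (ext (T s)) * (1 / B k1 (ext (T s)))) (at s within {0..1})"
      using near1[OF s(2)] by simp
    then have "((\<lambda>r. U r $ k) has_real_derivative B k (ext (T s)) * (1 / B k1 (ext (T s)))) (at s within {0..1})"
      by (rule has_field_derivative_transform_within[where d = "1 - s"])
         (use s in \<open>auto simp: U_def dist_real_def\<close>)
    then show ?thesis using U_eq[OF s(2)] by simp
  qed
  have T_top: "filterlim T at_top (at_left 1)"
    unfolding filterlim_at_top
  proof
    fix Z :: real
    define t where "t = max Z 0"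
    have "eventually (\<lambda>s. s \<in> {f t<..<1}) (at_left 1)"
      by (rule eventually_at_left_real) (auto simp: t_def intro: f_lt)
    then show "eventually (\<lambda>s. Z \<le> T s) (at_left 1)"
    proof eventually_elim
      case (elim s)
      then have "t \<le> T s" by (intro T_mono) (auto simp: t_def)
      then show ?case by (simp add: t_def)
    qed
  qed
  have "is_curve b k1 U"
    unfolding is_curve_def
  proof (intro conjI ballI)
    show "continuous_on {0..1} U"
      unfolding continuous_on_eq_continuous_within
    proof
      fix s :: real assume s: "s \<in> {0..1}"
      show "continuous (at s within {0..1}) U"
      proof (cases "s < 1")
        case True
        have "continuous (at s within {0..1}) (\<lambda>r. U r $ k)" for k
          by (rule DERIV_continuous[OF U_deriv]) (use s True in auto)
        then show ?thesis unfolding continuous_within by (intro vec_tendstoI)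
      next
        case False
        have "((\<lambda>s. ext (T s)) \<longlongrightarrow> 1) (at_left 1)"
          using filterlim_compose[OF ext_tendsto_q T_top] by (simp add: q_eq_1)
        moreover have "eventually (\<lambda>s. ext (T s) = U s) (at_left 1)"
          unfolding eventually_at_filter by (auto simp: U_def)
        ultimately have "(U \<longlongrightarrow> 1) (at_left 1)" by (rule Lim_transform_eventually)
        moreover have "s = 1" using s False by simp
        ultimately show ?thesis
          unfolding continuous_within by (simp add: at_within_Icc_at_left U_def)
      qed
    qed
    show "U 0 = 0" using Tf[of 0] f0 by (simp add: U_def flow_0)
    show "U 1 = 1" by (simp add: U_def)
    show "U s \<in> unit_cube" "U s $ k1 = s" if "s \<in> {0..1}" for s
      using that T[of s] by (auto simp: U_def ext_cube f_def)
    show "B k1 (U s) \<noteq> 0" if "s \<in> {0..<1}" for s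
      using that T[of s] Bpos[of "T s"] by (auto simp: U_def)
    show "\<forall>k. k \<noteq> k1 \<longrightarrow> ((\<lambda>r. U r $ k) has_real_derivative B k (U s) / B k1 (U s)) (at s within {0..1})"
      if "s \<in> {0..<1}" for s using that U_deriv by auto
  qed
  moreover obtain l where l: "(A_int \<longlongrightarrow> l) at_top" by (rule A_int_converges)
  have hi: "((\<lambda>s. A (U s) / B k1 (U s)) has_integral A_int (T x)) {0..x}" if x: "x \<in> {0..<1}" for x
  proof -
    have "((\<lambda>s. A (U s) / B k1 (U s)) has_integral (A_int (T x) - A_int (T 0))) {0..x}"
    proof (rule fundamental_theorem_of_calculus)
      fix s assume s: "s \<in> {0..x}"
      then have s1: "0 \<le> s" "s < 1" using x by auto
      have "((\<lambda>s. A_int (T s)) has_real_derivative A (ext (T s)) * (1 / B k1 (ext (T s)))) (at s within {0..<1})"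
        by (rule chain[OF s1 integral_A_derivative]) (use T[OF s1] in auto)
      then have "((\<lambda>s. A_int (T s)) has_real_derivative A (ext (T s)) * (1 / B k1 (ext (T s)))) (at s within {0..x})"
        by (rule DERIV_subset) (use x in auto)
      then show "((\<lambda>s. A_int (T s)) has_vector_derivative A (U s) / B k1 (U s)) (at s within {0..x})"
        unfolding has_real_derivative_iff_has_vector_derivative[symmetric] U_eq[OF s1(2)] by simp
    qed (use x in auto)
    moreover have "T 0 = 0" using Tf[of 0] f0 by simp
    ultimately show ?thesis by simp
  qed
  have "has_improper_integral (\<lambda>s. A (U s) / B k1 (U s)) (ereal l)"
    unfolding has_improper_integral_def
  proof (intro conjI ballI)
    show "(\<lambda>s. A (U s) / B k1 (U s)) integrable_on {0..x}" if "x \<in> {0..<1}" for x using hi[OF that] by blast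
    have "((\<lambda>x. ereal (A_int (T x))) \<longlongrightarrow> ereal l) (at_left 1)"
      by (intro tendsto_ereal filterlim_compose[OF l T_top])
    moreover have "eventually (\<lambda>x. x \<in> {0<..<1}) (at_left (1::real))" by (rule eventually_at_left_real) simp
    then have "eventually (\<lambda>x. ereal (A_int (T x)) = ereal (integral {0..x} (\<lambda>s. A (U s) / B k1 (U s)))) (at_left 1)"
      by eventually_elim (auto simp: integral_unique[OF hi])
    ultimately show "((\<lambda>x. ereal (integral {0..x} (\<lambda>s. A (U s) / B k1 (U s)))) \<longlongrightarrow> ereal l) (at_left 1)"
      by (rule Lim_transform_eventually)
  qed
  ultimately show thesis by (rule that)
qed

end

text \<open>A convergent measure forces both \<open>lam\<close> and \<open>lamZ\<close> to vanish,
  so the integrand of the condition becomes that of \<open>curve_exists\<close>.\<close>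

lemma summable_iff:
  assumes inv: "invariant_for_P lam P m" and B0: "0 < B k1 0" and decay: "is_decay_parameter P lamZ"
  shows "m summable_on UNIV \<longleftrightarrow>
         lam = lamZ \<and> rho b 1 \<le> 0 \<and>
         (\<exists>U L. is_curve b k1 U \<and>
            has_improper_integral (\<lambda>s. (lam + A (U s)) / B k1 (U s)) L \<and> L > - \<infinity>)"
proof
  assume sm: "m summable_on UNIV"
  obtain p where p: "0 < p" "\<And>t. 0 \<le> t \<Longrightarrow> p \<le> mass0 t 0" using summable_invariant(2)[OF inv sm] by blast
  have lam: "lam = 0" by (rule summable_invariant(1)[OF inv sm])
  have lamZ: "lamZ = 0" by (rule decay_parameter_eq_0[OF p decay])
  obtain U l where "is_curve b k1 U" "has_improper_integral (\<lambda>s. A (U s) / B k1 (U s)) (ereal l)"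
    using curve_exists[OF p B0] by blast
  then show "lam = lamZ \<and> rho b 1 \<le> 0 \<and> (\<exists>U L. is_curve b k1 U \<and>
            has_improper_integral (\<lambda>s. (lam + A (U s)) / B k1 (U s)) L \<and> L > - \<infinity>)"
    using rho_le_0[OF p] lam lamZ by (auto intro!: exI[of _ U] exI[of _ "ereal l"])
qed (use summable_if_integral[OF inv B0] in blast)

end

theorem theorem6p4:
  fixes a :: "nat ^ 'n \<Rightarrow> real"
    and b :: "'n \<Rightarrow> nat ^ 'n \<Rightarrow> real"
    and k1 :: 'n
    and P :: "real \<Rightarrow> nat ^ 'n \<Rightarrow> nat ^ 'n \<Rightarrow> real"
    and lamZ lam :: real
  assumes "immigration_rates a"
    and "branching_rates b"
    and "conservative (qmat a b)"
    and "Feller_minimal (qmat a b) P"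
    and "communicating P"
    and "\<And>i j. \<exists>d. has_partial (genfun (b i)) d j 1"
    and "positively_regular (Gmat b 1)"
    and "nonsingular b"
    and "genfun (b k1) 0 > 0"
    and "is_decay_parameter P lamZ"
    and "0 \<le> lam" and "lam \<le> lamZ"
  shows "\<exists>m.
      (invariant_for_Q lam (qmat a b) m \<and>
       (\<exists>q. is_least_zero b q \<and> {u \<in> unit_cube. \<forall>k. u $ k < q $ k} \<subseteq> conv_domain m) \<and>
       (\<forall>u \<in> unit_cube \<inter> interior (conv_domain m). satisfies_pde_at a b lam m u))
    \<and> invariant_for_P lam P m
    \<and> (m summable_on UNIV \<longleftrightarrow>
         lam = lamZ \<and> rho b 1 \<le> 0 \<and>
         (\<exists>U L. is_curve b k1 U \<and>
            has_improper_integral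
              (\<lambda>s. (lam + genfun a (U s)) / genfun (b k1) (U s)) L \<and> L > - \<infinity>))"
proof -
  interpret irreducible_branching b a P
    by unfold_locales (use assms in \<open>auto simp: Feller_minimal_def\<close>)
  obtain m where m: "invariant_for_P lam P m"
    using invariant_measure_exists[OF assms(10,12)] by blast
  show ?thesis
    by (intro exI[of _ m] conjI exI[of _ q] ballI m invariant_Q[OF m] q_least below_q_conv_domain[OF m]
        summable_iff[OF m assms(9,10)] pde[OF m]) auto
qed

end
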